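(* For every map $f\colon X\to Y$ between locally compact subspaces of some Euclidean neighbourhood retract we have the estimate $$\mathrm{TC}(f)\ge\mathrm{nil}\big(\mathrm{Ker}\,(1,f)^*\colon \check H^*(X\times Y)\to \check H^*(X)\big),$$ where $\check H^*$ denotes Čech cohomology with any ring coefficients. Moreover, if both $X$ and $Y$ are Euclidean neighbourhood retracts, then the same estimate holds for singular cohomology with any ring coefficients, i.e. $\mathrm{TC}(f)\ge\mathrm{nil}\big(\mathrm{Ker}\,(1,f)^*\colon H^*(X\times Y)\to H^*(X)\big)$.
   Context: A Euclidean neighbourhood retract (ENR) is a space homeomorphic to a retract of an open subset of some Euclidean space. For a locally compact subspace $Z$ of an ENR $E$, the Čech cohomology $\check H^*(Z)$ is the direct limit of the singular cohomology groups $H^*(U)$ over all open $U\subseteq E$ containing $Z$ (ordered downward by inclusion), with the induced ring structure. The map $(1,f)\colon X\to X\times Y$ is $x\mapsto(x,f(x))$. For an ideal $J$, $\mathrm{nil}(J)$ is the minimal integer $n$ such that every product of $n$ elements of $J$ is zero. Let $I=[0,1]$ and let $X^I$ be the space of continuous paths in $X$ with the compact-open topology. For a continuous surjection $p\colon E\to B$, the sectional number $\mathrm{sec}(p)$ is the minimal integer $n$ for which there is an increasing sequence of open subsets $\emptyset=U_0\subseteq U_1\subseteq\cdots\subseteq U_n=B$ such that for each $i=1,\dots,n$ there is a continuous map $s\colon U_i-U_{i-1}\to E$ with $p(s(b))=b$ for all $b$; if no such $n$ exists, $\mathrm{sec}(p)=\infty$. Maps $f\colon X\to Y$ are continuous surjections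 between path-connected spaces, and $\mathrm{TC}(f)=\mathrm{sec}(\pi_f)$, where $\pi_f\colon X^I\to X\times Y$, $\pi_f(\alpha)=(\alpha(0),f(\alpha(1)))$. *)

theory Defs
  imports "HOL-Analysis.Analysis" "HOL-Homology.Homology" "HOL-Algebra.QuotRing"
    "HOL-Library.Extended_Nat"
begin

section \<open>Euclidean neighbourhood retracts\<close>

definition ENR_space :: "'a topology \<Rightarrow> bool" where
  "ENR_space E \<longleftrightarrow>
     (\<exists>n U S. openin (Euclidean_space n) U \<and>
              S retract_of_space (subtopology (Euclidean_space n) U) \<and>
              E homeomorphic_space (subtopology (Euclidean_space n) S))"


section \<open>Sectional number and topological complexity of a map\<close>

text \<open>Continuous maps are represented by functions that are \<^const>\<open>undefined\<close> outside
  the topspace of the domain, so that distinct points of the mapping space are distinct maps.\<close>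

definition continuous_maps :: "'a topology \<Rightarrow> 'b topology \<Rightarrow> ('a \<Rightarrow> 'b) set" where
  "continuous_maps S T = {g \<in> extensional (topspace S). continuous_map S T g}"

definition compact_open_topology :: "'a topology \<Rightarrow> 'b topology \<Rightarrow> ('a \<Rightarrow> 'b) topology" where
  "compact_open_topology S T =
     topology_generated_by
       {{g \<in> continuous_maps S T. g ` K \<subseteq> U} | K U. compactin S K \<and> openin T U}"

definition path_space :: "'a topology \<Rightarrow> (real \<Rightarrow> 'a) topology" where
  "path_space X = compact_open_topology (subtopology euclideanreal {0..1}) X"

definition sectional_number :: "'a topology \<Rightarrow> 'b topology \<Rightarrow> ('a \<Rightarrow> 'b) \<Rightarrow> enat" where
  "sectional_number E B p =
     Inf {enat n | n. \<exists>U :: nat \<Rightarrow> 'b set.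
        U 0 = {} \<and> U n = topspace B \<and>
        (\<forall>i\<le>n. openin B (U i)) \<and>
        (\<forall>i<n. U i \<subseteq> U (Suc i)) \<and>
        (\<forall>i\<in>{1..n}. \<exists>s. continuous_map (subtopology B (U i - U (i - 1))) E s \<and>
                          (\<forall>b \<in> U i - U (i - 1). p (s b) = b))}"

definition TC :: "'a topology \<Rightarrow> 'b topology \<Rightarrow> ('a \<Rightarrow> 'b) \<Rightarrow> enat" where
  "TC X Y f =
     sectional_number (path_space X) (prod_topology X Y) (\<lambda>\<alpha>. (\<alpha> 0, f (\<alpha> 1)))"


section \<open>Nilpotency index\<close>

text \<open>The ring need not be commutative, hence products are indexed by lists.  The empty product
  is the unit, and the value is \<^term>\<open>\<infinity>\<close> if there is no \<open>n\<close> as required.\<close>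

definition nil_index :: "('a, 'm) ring_scheme \<Rightarrow> 'a set \<Rightarrow> enat" where
  "nil_index R J =
     Inf {enat n | n. \<forall>xs. length xs = n \<and> set xs \<subseteq> J \<longrightarrow>
                          foldr (\<lambda>x y. x \<otimes>\<^bsub>R\<^esub> y) xs \<one>\<^bsub>R\<^esub> = \<zero>\<^bsub>R\<^esub>}"


section \<open>The singular cohomology ring\<close>

text \<open>Coefficients are taken in a type of sort \<open>{ring, monoid_mult}\<close>, that is, an associative
  ring with unit; it may be noncommutative, and the zero ring is allowed (the class \<open>ring_1\<close>
  would exclude it).

  An element of the total cochain group (the direct sum of the groups of \<open>n\<close>-cochains) is a family
  \<open>c\<close>, where \<open>c n\<close> is the component in degree \<open>n\<close>.  An \<open>n\<close>-cochain is a function on the singular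
  \<open>n\<close>-simplices of \<open>X\<close>, extended by zero to functions that are not singular simplices of \<open>X\<close>.\<close>

type_synonym ('a, 'r) cochains = "nat \<Rightarrow> ((nat \<Rightarrow> real) \<Rightarrow> 'a) \<Rightarrow> 'r"

definition singular_cochains :: "'a topology \<Rightarrow> ('a, 'r::{ring,monoid_mult}) cochains set" where
  "singular_cochains X =
     {c. (\<forall>n \<sigma>. \<not> singular_simplex n X \<sigma> \<longrightarrow> c n \<sigma> = 0) \<and>
         finite {n. \<exists>\<sigma>. c n \<sigma> \<noteq> 0}}"

definition coboundary ::
    "'a topology \<Rightarrow> ('a, 'r::{ring,monoid_mult}) cochains \<Rightarrow> ('a, 'r) cochains" where
  "coboundary X c n \<sigma> =
     (if 0 < n \<and> singular_simplex n X \<sigma>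
      then \<Sum>k\<le>n. (if even k then c (n - 1) (singular_face n k \<sigma>)
                          else - c (n - 1) (singular_face n k \<sigma>))
      else 0)"

definition front_face :: "nat \<Rightarrow> ((nat \<Rightarrow> real) \<Rightarrow> 'a) \<Rightarrow> (nat \<Rightarrow> real) \<Rightarrow> 'a" where
  "front_face p \<sigma> = restrict \<sigma> (standard_simplex p)"

text \<open>For an \<open>n\<close>-simplex \<open>\<sigma>\<close>, \<open>back_face p q \<sigma>\<close> with \<open>p + q = n\<close> is its restriction to the face
  spanned by the last \<open>q + 1\<close> vertices, numbered \<open>p, \<dots>, n\<close>.\<close>

definition back_face :: "nat \<Rightarrow> nat \<Rightarrow> ((nat \<Rightarrow> real) \<Rightarrow> 'a) \<Rightarrow> (nat \<Rightarrow> real) \<Rightarrow> 'a" where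
  "back_face p q \<sigma> =
     restrict (\<lambda>x. \<sigma> (\<lambda>i. if i < p then 0 else x (i - p))) (standard_simplex q)"

definition cup_product ::
    "'a topology \<Rightarrow> ('a, 'r::{ring,monoid_mult}) cochains \<Rightarrow> ('a, 'r) cochains
       \<Rightarrow> ('a, 'r) cochains" where
  "cup_product X a b n \<sigma> =
     (if singular_simplex n X \<sigma>
      then \<Sum>p\<le>n. a p (front_face p \<sigma>) * b (n - p) (back_face p (n - p) \<sigma>)
      else 0)"

definition cocycle_ring ::
    "'r::{ring,monoid_mult} itself \<Rightarrow> 'a topology \<Rightarrow> ('a, 'r) cochains ring" where
  "cocycle_ring R X =
     \<lparr>carrier = {c \<in> singular_cochains X. coboundary X c = (\<lambda>n \<sigma>. 0)},
      mult = cup_product X,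
      one = (\<lambda>n \<sigma>. if n = 0 \<and> singular_simplex n X \<sigma> then 1 else 0),
      zero = (\<lambda>n \<sigma>. 0),
      add = (\<lambda>a b n \<sigma>. a n \<sigma> + b n \<sigma>)\<rparr>"

definition coboundaries ::
    "'r::{ring,monoid_mult} itself \<Rightarrow> 'a topology \<Rightarrow> ('a, 'r) cochains set" where
  "coboundaries R X = coboundary X ` singular_cochains X"

definition singular_cohomology ::
    "'r::{ring,monoid_mult} itself \<Rightarrow> 'a topology \<Rightarrow> ('a, 'r) cochains set ring" where
  "singular_cohomology R X = cocycle_ring R X Quot coboundaries R X"

definition cochain_pullback ::
    "'a topology \<Rightarrow> ('a \<Rightarrow> 'b) \<Rightarrow> ('b, 'r::{ring,monoid_mult}) cochains \<Rightarrow> ('a, 'r) cochains" where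
  "cochain_pullback X g c n \<sigma> =
     (if singular_simplex n X \<sigma> then c n (simplex_map n g \<sigma>) else 0)"

text \<open>The induced map \<open>g\<^sup>*\<close> for a continuous map \<open>g\<close> from \<open>X\<close>.  Cohomology classes are cosets
  of cocycles; all cocycles in a class yield the same coset, which is therefore the union.\<close>

definition cohomology_induced ::
    "'r::{ring,monoid_mult} itself \<Rightarrow> 'a topology \<Rightarrow> ('a \<Rightarrow> 'b)
       \<Rightarrow> ('b, 'r) cochains set \<Rightarrow> ('a, 'r) cochains set" where
  "cohomology_induced R X g u =
     (\<Union>c\<in>u. coboundaries R X +>\<^bsub>cocycle_ring R X\<^esub> cochain_pullback X g c)"


section \<open>Direct limits of rings\<close>

text \<open>The direct limit of the rings \<open>A i\<close> for \<open>i\<close> in a set \<open>D\<close> directed by \<open>leq\<close>, with transition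
  homomorphisms \<open>\<rho> i j\<close> from \<open>A i\<close> to \<open>A j\<close> whenever \<open>leq i j\<close>.  Operations are performed on
  representatives, after moving them to a common index.\<close>

definition direct_limit_rel ::
    "'i set \<Rightarrow> ('i \<Rightarrow> 'i \<Rightarrow> bool) \<Rightarrow> ('i \<Rightarrow> ('c, 'm) ring_scheme) \<Rightarrow> ('i \<Rightarrow> 'i \<Rightarrow> 'c \<Rightarrow> 'c)
       \<Rightarrow> (('i \<times> 'c) \<times> ('i \<times> 'c)) set" where
  "direct_limit_rel D leq A \<rho> =
     {((i, a), (j, b)). i \<in> D \<and> a \<in> carrier (A i) \<and> j \<in> D \<and> b \<in> carrier (A j) \<and>
        (\<exists>k\<in>D. leq i k \<and> leq j k \<and> \<rho> i k a = \<rho> j k b)}"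

definition direct_limit_class ::
    "'i set \<Rightarrow> ('i \<Rightarrow> 'i \<Rightarrow> bool) \<Rightarrow> ('i \<Rightarrow> ('c, 'm) ring_scheme) \<Rightarrow> ('i \<Rightarrow> 'i \<Rightarrow> 'c \<Rightarrow> 'c)
       \<Rightarrow> 'i \<Rightarrow> 'c \<Rightarrow> ('i \<times> 'c) set" where
  "direct_limit_class D leq A \<rho> i a = direct_limit_rel D leq A \<rho> `` {(i, a)}"

definition direct_limit ::
    "'i set \<Rightarrow> ('i \<Rightarrow> 'i \<Rightarrow> bool) \<Rightarrow> ('i \<Rightarrow> ('c, 'm) ring_scheme) \<Rightarrow> ('i \<Rightarrow> 'i \<Rightarrow> 'c \<Rightarrow> 'c)
       \<Rightarrow> ('i \<times> 'c) set ring" where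
  "direct_limit D leq A \<rho> =
     \<lparr>carrier = (SIGMA i:D. carrier (A i)) // direct_limit_rel D leq A \<rho>,
      mult = (\<lambda>P Q. \<Union>(i, a)\<in>P. \<Union>(j, b)\<in>Q. \<Union>k\<in>{k\<in>D. leq i k \<and> leq j k}.
                direct_limit_class D leq A \<rho> k (\<rho> i k a \<otimes>\<^bsub>A k\<^esub> \<rho> j k b)),
      one = (\<Union>k\<in>D. direct_limit_class D leq A \<rho> k \<one>\<^bsub>A k\<^esub>),
      zero = (\<Union>k\<in>D. direct_limit_class D leq A \<rho> k \<zero>\<^bsub>A k\<^esub>),
      add = (\<lambda>P Q. \<Union>(i, a)\<in>P. \<Union>(j, b)\<in>Q. \<Union>k\<in>{k\<in>D. leq i k \<and> leq j k}.
                direct_limit_class D leq A \<rho> k (\<rho> i k a \<oplus>\<^bsub>A k\<^esub> \<rho> j k b))\<rparr>"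


section \<open>Cech cohomology of subspaces of ENRs\<close>

definition open_nbhds :: "'a topology \<Rightarrow> 'a set \<Rightarrow> 'a set set" where
  "open_nbhds E Z = {U. openin E U \<and> Z \<subseteq> U}"

definition nbhd_cohomology ::
    "'r::{ring,monoid_mult} itself \<Rightarrow> 'a topology \<Rightarrow> 'a set \<Rightarrow> ('a, 'r) cochains set ring" where
  "nbhd_cohomology R E U = singular_cohomology R (subtopology E U)"

definition cohomology_restrict ::
    "'r::{ring,monoid_mult} itself \<Rightarrow> 'a topology \<Rightarrow> 'a set \<Rightarrow> 'a set
       \<Rightarrow> ('a, 'r) cochains set \<Rightarrow> ('a, 'r) cochains set" where
  "cohomology_restrict R E U V = cohomology_induced R (subtopology E V) (\<lambda>x. x)"

definition cech_cohomology ::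
    "'r::{ring,monoid_mult} itself \<Rightarrow> 'a topology \<Rightarrow> 'a set
       \<Rightarrow> ('a set \<times> ('a, 'r) cochains set) set ring" where
  "cech_cohomology R E Z =
     direct_limit (open_nbhds E Z) (\<lambda>U V. V \<subseteq> U) (nbhd_cohomology R E) (cohomology_restrict R E)"

definition cech_class ::
    "'r::{ring,monoid_mult} itself \<Rightarrow> 'a topology \<Rightarrow> 'a set \<Rightarrow> 'a set
       \<Rightarrow> ('a, 'r) cochains set \<Rightarrow> ('a set \<times> ('a, 'r) cochains set) set" where
  "cech_class R E Z =
     direct_limit_class (open_nbhds E Z) (\<lambda>U V. V \<subseteq> U) (nbhd_cohomology R E)
       (cohomology_restrict R E)"

text \<open>The homomorphism induced by a continuous map \<open>g\<close> from \<open>Z \<subseteq> E\<close> to \<open>Z' \<subseteq> E'\<close>: the class of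
  \<open>v \<in> H\<^sup>*(V)\<close>, where \<open>V\<close> is an open neighbourhood of \<open>Z'\<close>, is sent to the class of \<open>G\<^sup>* v\<close>, where
  \<open>G : W \<rightarrow> V\<close> is a continuous extension of \<open>g\<close> to an open neighbourhood \<open>W\<close> of \<open>Z\<close>.  If \<open>E\<close> and
  \<open>E'\<close> are ENRs and \<open>Z\<close> is locally compact, then such extensions exist and any two of them are
  homotopic, as maps into \<open>V\<close>, on some neighbourhood of \<open>Z\<close>; hence the result is uniquely
  determined.\<close>

definition cech_induced ::
    "'r::{ring,monoid_mult} itself \<Rightarrow> 'a topology \<Rightarrow> 'a set \<Rightarrow> 'b topology \<Rightarrow> 'b set
       \<Rightarrow> ('a \<Rightarrow> 'b) \<Rightarrow> ('b set \<times> ('b, 'r) cochains set) set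
       \<Rightarrow> ('a set \<times> ('a, 'r) cochains set) set" where
  "cech_induced R E Z E' Z' g \<xi> =
     (THE \<eta>. \<exists>V v W G. V \<in> open_nbhds E' Z' \<and> v \<in> carrier (nbhd_cohomology R E' V) \<and>
                \<xi> = cech_class R E' Z' V v \<and>
                W \<in> open_nbhds E Z \<and>
                continuous_map (subtopology E W) (subtopology E' V) G \<and>
                (\<forall>z\<in>Z. G z = g z) \<and>
                \<eta> = cech_class R E Z W (cohomology_induced R (subtopology E W) G v))"

end

theory Submission
  imports Defs
begin

text \<open>Let \<open>A = U\<^sub>i - U\<^sub>i\<^sub>-\<^sub>1\<close> carry a section \<open>s\<close> of \<open>\<pi>\<^sub>f\<close>. Then \<open>(t, (x, y)) \<mapsto> (x, f (s (x, y) t))\<close> is a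
  homotopy on \<open>A\<close> from \<open>(1, f)\<close> composed with the first projection to the inclusion, so a class killed
  by \<open>(1, f)\<^sup>*\<close> vanishes on \<open>A\<close>. As \<open>A\<close> is locally closed in an ENR, the homotopy extends to a
  neighbourhood, and the class vanishes on an open neighbourhood \<open>N\<^sub>i\<close> of \<open>A\<close>. The cup product of \<open>n\<close>
  classes that vanish on \<open>N\<^sub>1, \<dots>, N\<^sub>n\<close>, respectively, vanishes on the union of the \<open>N\<^sub>i\<close>, because it is
  represented by a cocycle that is zero on simplices lying in one of these open sets; and the union
  contains \<open>X \<times> Y\<close>.\<close>


section \<open>Faces of singular simplices\<close>

text \<open>That a class vanishes on the set \<open>A\<close> itself is not enough for products: the
  subdivision argument needs open sets. Local compactness is used here. It makes \<open>X\<close>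
  and \<open>Y\<close>, and with them \<open>A\<close>, closed in an open subset of the ambient
  space, where Tietze's theorem extends maps coordinate by coordinate and the retraction carries the
  result back into the ENR. In the Cech case the graph lives on \<open>X\<close> only, so a class of
  the kernel is represented by a cocycle on an open \<open>V\<close> together with an extension
  \<open>G\<close> of the graph to an open \<open>W\<close> along which the cocycle pulls back to a
  coboundary; the homotopy is compared with \<open>G\<close> after the projection. On the algebraic
  side two operators on chains are transposed to cochains, which works for all coefficients: a prism
  operator for homotopic maps, and a contraction of the singular chains modulo the small ones. The
  latter takes the place of relative cohomology: a cocycle exact on an open set is changed by a
  coboundary until it is zero on the simplices there.\<close>

definition shift_vertices :: "nat \<Rightarrow> (nat \<Rightarrow> real) \<Rightarrow> nat \<Rightarrow> real" where
  "shift_vertices p x = (\<lambda>i. if i < p then 0 else x (i - p))"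

lemma back_face_shift: "back_face p q \<sigma> = restrict (\<sigma> \<circ> shift_vertices p) (standard_simplex q)"
  by (simp add: back_face_def shift_vertices_def comp_def)

lemma shift_vertices_0 [simp]: "shift_vertices 0 x = x"
  by (simp add: shift_vertices_def)

lemma shift_shift_vertices: "shift_vertices p (shift_vertices q x) = shift_vertices (p + q) x"
  by (auto simp: shift_vertices_def fun_eq_iff)

lemma shift_vertices_in_standard_simplex:
  assumes "x \<in> standard_simplex q"
  shows "shift_vertices p x \<in> standard_simplex (p + q)"
proof -
  have "(\<Sum>i\<le>p + q. shift_vertices p x i) = (\<Sum>i\<in>{p..p + q}. shift_vertices p x i)"
    by (rule sum.mono_neutral_right) (auto simp: shift_vertices_def)
  also have "\<dots> = (\<Sum>i\<in>{0..q}. shift_vertices p x (i + p))"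
    using sum.shift_bounds_cl_nat_ivl [of "shift_vertices p x" 0 p q] by (simp add: add.commute)
  also have "\<dots> = (\<Sum>i\<le>q. x i)"
    by (simp add: shift_vertices_def atLeast0AtMost)
  finally show ?thesis
    using assms by (auto simp: standard_simplex_def shift_vertices_def)
qed

lemma continuous_map_shift_vertices:
  "continuous_map (subtopology (powertop_real UNIV) (standard_simplex q))
     (subtopology (powertop_real UNIV) (standard_simplex (p + q))) (shift_vertices p)"
proof -
  have "continuous_map (powertop_real UNIV) euclideanreal (\<lambda>x. shift_vertices p x i)" for i
    by (auto simp: shift_vertices_def intro: continuous_map_product_projection)
  then show ?thesis
    by (auto simp: continuous_map_in_subtopology continuous_map_componentwise_UNIV
        shift_vertices_in_standard_simplex intro: continuous_map_from_subtopology)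
qed

text \<open>Points of the \<open>p\<close>-simplex are sequences that vanish beyond index
  \<open>p\<close>, so a zero inserted there changes nothing. This encoding lets faces of simplices
  of different dimensions be compared as plain functions.\<close>

lemma simplical_face_above:
  assumes "x \<in> standard_simplex p" "p < k"
  shows "simplical_face k x = x"
  using assms by (auto simp: standard_simplex_def simplical_face_def fun_eq_iff)

lemma simplical_face_shift_low:
  "k \<le> p \<Longrightarrow> simplical_face k (shift_vertices p x) = shift_vertices (Suc p) x"
  by (auto simp: simplical_face_def shift_vertices_def fun_eq_iff)

lemma simplical_face_shift_high:
  "simplical_face (p + j) (shift_vertices p x) = shift_vertices p (simplical_face j x)"
  by (auto simp: simplical_face_def shift_vertices_def fun_eq_iff)

lemma simplical_face_in:
  "k \<le> Suc p \<Longrightarrow> x \<in> standard_simplex p \<Longrightarrow> simplical_face k x \<in> standard_simplex (Suc p)"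
  using simplical_face_in_standard_simplex [of "Suc p" k x] by simp

lemma standard_simplex_le: "x \<in> standard_simplex p \<Longrightarrow> p \<le> n \<Longrightarrow> x \<in> standard_simplex n"
  using standard_simplex_mono by blast

text \<open>Together with the three companions below this is the bookkeeping for the Leibniz rule:
  deleting a vertex numbered at most \<open>p\<close> changes the front and renumbers the start of
  the back, deleting a later one leaves the front alone and changes the back.\<close>

lemma front_face_singular_face_low:
  assumes "p \<le> n" "k \<le> p"
  shows "front_face p (singular_face (Suc n) k \<sigma>) = singular_face (Suc p) k (front_face (Suc p) \<sigma>)"
  using assms
  by (auto simp: front_face_def singular_face_def restrict_def fun_eq_iff simplical_face_in
      dest: standard_simplex_le)

lemma front_face_singular_face_high:
  assumes "p \<le> n" "p < k"
  shows "front_face p (singular_face (Suc n) k \<sigma>) = front_face p \<sigma>"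
  using assms
  by (auto simp: front_face_def singular_face_def restrict_def fun_eq_iff simplical_face_above
      dest: standard_simplex_le)

text \<open>This face and the one in \<open>singular_face_first_back_face\<close> are the two that
  do not come from a face of the whole simplex; they produce the terms that cancel in the Leibniz
  rule.\<close>

lemma singular_face_last_front_face:
  "singular_face (Suc p) (Suc p) (front_face (Suc p) \<sigma>) = front_face p \<sigma>"
  using standard_simplex_le [of _ p "Suc p"]
  by (auto simp: front_face_def singular_face_def restrict_def fun_eq_iff simplical_face_above)

lemma back_face_singular_face_low:
  assumes "p \<le> n" "k \<le> p"
  shows "back_face p (n - p) (singular_face (Suc n) k \<sigma>) = back_face (Suc p) (n - p) \<sigma>"
proof -
  have "shift_vertices p x \<in> standard_simplex n" if "x \<in> standard_simplex (n - p)" for x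
    using shift_vertices_in_standard_simplex [OF that, of p] assms by simp
  then show ?thesis
    using assms by (auto simp: back_face_shift singular_face_def restrict_def fun_eq_iff
        simplical_face_shift_low)
qed

lemma back_face_singular_face_high:
  assumes "p \<le> n" "j \<le> Suc (n - p)"
  shows "back_face p (n - p) (singular_face (Suc n) (p + j) \<sigma>)
           = singular_face (Suc (n - p)) j (back_face p (Suc (n - p)) \<sigma>)"
proof -
  have "shift_vertices p x \<in> standard_simplex n" if "x \<in> standard_simplex (n - p)" for x
    using shift_vertices_in_standard_simplex [OF that, of p] assms by simp
  then show ?thesis
    using assms by (auto simp: back_face_shift singular_face_def restrict_def fun_eq_iff
        simplical_face_shift_high simplical_face_in)
qed

lemma singular_face_first_back_face:
  "singular_face (Suc q) 0 (back_face p (Suc q) \<sigma>) = back_face (Suc p) q \<sigma>"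
proof -
  have "shift_vertices p (simplical_face 0 x) = shift_vertices (Suc p) x" for x
    using simplical_face_shift_high [of p 0 x] by (simp add: simplical_face_shift_low)
  then show ?thesis
    by (simp add: back_face_shift singular_face_def restrict_def simplical_face_in cong: if_cong)
qed

lemma front_face_front_face: "q \<le> p \<Longrightarrow> front_face q (front_face p \<sigma>) = front_face q \<sigma>"
  by (auto simp: front_face_def restrict_def fun_eq_iff dest: standard_simplex_le)

lemma back_face_front_face:
  assumes "q \<le> p" "p \<le> n"
  shows "back_face q (p - q) (front_face p \<sigma>) = front_face (p - q) (back_face q (n - q) \<sigma>)"
proof -
  have "shift_vertices q x \<in> standard_simplex p" if "x \<in> standard_simplex (p - q)" for x
    using shift_vertices_in_standard_simplex [OF that, of q] assms by simp
  moreover have "x \<in> standard_simplex (n - q)" if "x \<in> standard_simplex (p - q)" for x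
    by (rule standard_simplex_le [OF that]) (use assms in auto)
  ultimately show ?thesis
    by (auto simp: back_face_shift front_face_def restrict_def fun_eq_iff)
qed

lemma back_face_back_face: "back_face r s (back_face q (r + s) \<sigma>) = back_face (q + r) s \<sigma>"
  by (auto simp: back_face_shift restrict_def fun_eq_iff shift_shift_vertices
      shift_vertices_in_standard_simplex)

lemma front_face_self: "singular_simplex n X \<sigma> \<Longrightarrow> front_face n \<sigma> = \<sigma>"
  by (auto simp: front_face_def singular_simplex_def extensional_restrict)

lemma back_face_self: "singular_simplex n X \<sigma> \<Longrightarrow> back_face 0 n \<sigma> = \<sigma>"
  by (auto simp: back_face_shift singular_simplex_def extensional_restrict comp_def)

lemma singular_simplex_front_face:
  assumes "singular_simplex n X \<sigma>" "p \<le> n"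
  shows "singular_simplex p X (front_face p \<sigma>)"
proof -
  have "continuous_map (subtopology (powertop_real UNIV) (standard_simplex p)) X \<sigma>"
    using assms standard_simplex_mono [of p n] unfolding singular_simplex_def
    by (metis continuous_map_from_subtopology_mono)
  then show ?thesis
    by (auto simp: singular_simplex_def front_face_def elim: continuous_map_eq)
qed

lemma singular_simplex_back_face:
  assumes "singular_simplex (p + q) X \<sigma>"
  shows "singular_simplex q X (back_face p q \<sigma>)"
proof -
  have "continuous_map (subtopology (powertop_real UNIV) (standard_simplex q)) X (\<sigma> \<circ> shift_vertices p)"
    by (rule continuous_map_compose [OF continuous_map_shift_vertices])
      (use assms in \<open>simp add: singular_simplex_def\<close>)
  then show ?thesis
    by (auto simp: singular_simplex_def back_face_shift elim: continuous_map_eq)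
qed

lemma singular_simplex_face:
  "singular_simplex (Suc n) X \<sigma> \<Longrightarrow> k \<le> Suc n \<Longrightarrow> singular_simplex n X (singular_face (Suc n) k \<sigma>)"
  using singular_simplex_singular_face [of "Suc n" X \<sigma> k] by simp

lemma front_face_simplex_map:
  "p \<le> n \<Longrightarrow> front_face p (simplex_map n g \<sigma>) = simplex_map p g (front_face p \<sigma>)"
  by (auto simp: front_face_def simplex_map_def restrict_def fun_eq_iff dest: standard_simplex_le)

lemma back_face_simplex_map:
  "back_face p q (simplex_map (p + q) g \<sigma>) = simplex_map q g (back_face p q \<sigma>)"
  by (auto simp: back_face_shift simplex_map_def restrict_def fun_eq_iff
      shift_vertices_in_standard_simplex)

lemma singular_face_simplex_map':
  "k \<le> Suc n \<Longrightarrow> singular_face (Suc n) k (simplex_map (Suc n) g \<sigma>) = simplex_map n g (singular_face (Suc n) k \<sigma>)"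
  by (auto simp: singular_face_def simplex_map_def restrict_def fun_eq_iff simplical_face_in)


section \<open>The cup product on cochains\<close>

text \<open>The sign of parity \<open>k\<close>, written so that it makes sense in any additive
  group and matches the case distinction in \<open>coboundary\<close>.\<close>

definition alt :: "nat \<Rightarrow> 'r::ab_group_add \<Rightarrow> 'r" where
  "alt k r = (if even k then r else - r)"

lemma alt_0 [simp]: "alt 0 r = r"
  and alt_zero [simp]: "alt k 0 = 0"
  and alt_Suc: "alt (Suc k) r = - alt k r"
  and alt_alt: "alt k (alt j r) = alt (k + j) r"
  by (auto simp: alt_def)

lemma alt_mult_left: "alt k r * s = alt k (r * s)"
  and alt_mult_right: "r * alt k s = alt k (r * s)" for r s :: "'r::ring"
  by (auto simp: alt_def)

lemma alt_sum: "alt k (\<Sum>i\<in>I. f i) = (\<Sum>i\<in>I. alt k (f i))"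
  by (auto simp: alt_def sum_negf)

lemma coboundary_0 [simp]: "coboundary X c 0 \<sigma> = 0"
  by (simp add: coboundary_def)

lemma coboundary_Suc:
  "coboundary X c (Suc n) \<sigma> =
     (if singular_simplex (Suc n) X \<sigma> then \<Sum>k\<le>Suc n. alt k (c n (singular_face (Suc n) k \<sigma>)) else 0)"
  by (simp add: coboundary_def alt_def del: sum.atMost_Suc cong: if_cong)

text \<open>A cochain here is a family over all degrees, so the sign in d(ab) = (da)b + (-1)^p a(db)
  for \<open>a\<close> of degree p has to become an operator on the whole family.\<close>

definition twist :: "('a, 'r::ab_group_add) cochains \<Rightarrow> ('a, 'r) cochains" where
  "twist c = (\<lambda>n \<sigma>. alt n (c n \<sigma>))"

lemma sum_atMost_split:
  fixes f :: "nat \<Rightarrow> 'b::comm_monoid_add"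
  assumes "p \<le> n"
  shows "(\<Sum>k\<le>Suc n. f k) = (\<Sum>k\<le>p. f k) + (\<Sum>j\<le>n - p. f (p + Suc j))"
proof -
  have "(\<Sum>k\<le>Suc n. f k) = (\<Sum>k\<in>{..p} \<union> {Suc p..Suc n}. f k)"
    by (rule sum.cong) (use assms in auto)
  also have "\<dots> = (\<Sum>k\<le>p. f k) + (\<Sum>k\<in>{Suc p..Suc n}. f k)"
    by (rule sum.union_disjoint) auto
  also have "(\<Sum>k\<in>{Suc p..Suc n}. f k) = (\<Sum>j\<in>{0..n - p}. f (j + Suc p))"
    using sum.shift_bounds_cl_nat_ivl [of f 0 "Suc p" "n - p"] assms by simp
  finally show ?thesis
    by (simp add: atLeast0AtMost add.commute)
qed

text \<open>The last face of the front and the first face of the back occur with opposite signs and cancel.\<close>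

lemma coboundary_cup_product:
  fixes a b :: "('a, 'r::{ring,monoid_mult}) cochains"
  shows "coboundary X (cup_product X a b) =
    (\<lambda>n \<sigma>. cup_product X (coboundary X a) b n \<sigma> + cup_product X (twist a) (coboundary X b) n \<sigma>)"
proof (intro ext)
  fix m \<sigma>
  show "coboundary X (cup_product X a b) m \<sigma> =
     cup_product X (coboundary X a) b m \<sigma> + cup_product X (twist a) (coboundary X b) m \<sigma>"
  proof (cases "m = 0 \<or> \<not> singular_simplex m X \<sigma>")
    case True
    then show ?thesis
      by (auto simp: cup_product_def coboundary_def)
  next
    case False
    then obtain n where m: "m = Suc n" and \<sigma>: "singular_simplex (Suc n) X \<sigma>"
      by (metis not0_implies_Suc)
    \<comment> \<open>\<open>F p\<close> and \<open>G p\<close> list the terms of the coboundaries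
      on the front and on the back; \<open>A p\<close> and \<open>B p\<close> are the values on the
      front and the back that meet in vertex \<open>p\<close> and \<open>Suc p\<close>
      respectively.\<close>
    define F where "F p k = alt k (a p (singular_face (Suc p) k (front_face (Suc p) \<sigma>)))" for p k
    define G where "G p j = alt j (b (n - p) (singular_face (Suc (n - p)) j (back_face p (Suc (n - p)) \<sigma>)))" for p j
    define A where "A p = a p (front_face p \<sigma>)" for p
    define B where "B p = b (n - p) (back_face (Suc p) (n - p) \<sigma>)" for p
    have FG: "alt k (a p (front_face p (singular_face (Suc n) k \<sigma>)) *
          b (n - p) (back_face p (n - p) (singular_face (Suc n) k \<sigma>)))
        = (if k \<le> p then F p k * B p else alt p (A p * G p (k - p)))" if "p \<le> n" "k \<le> Suc n" for p k
    proof (cases "k \<le> p")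
      case True
      then show ?thesis
        using that by (simp add: F_def B_def front_face_singular_face_low back_face_singular_face_low
            alt_mult_left)
    next
      case False
      then show ?thesis
        using that back_face_singular_face_high [of p n "k - p" \<sigma>]
        by (simp add: A_def G_def front_face_singular_face_high alt_mult_right alt_alt)
    qed
    have inner: "(\<Sum>k\<le>Suc n. alt k (a p (front_face p (singular_face (Suc n) k \<sigma>)) *
          b (n - p) (back_face p (n - p) (singular_face (Suc n) k \<sigma>))))
        = (\<Sum>k\<le>Suc p. F p k) * B p + alt p (A p) * (\<Sum>j\<le>Suc (n - p). G p j)" if "p \<le> n" for p
    proof -
      have "(\<Sum>k\<le>Suc n. alt k (a p (front_face p (singular_face (Suc n) k \<sigma>)) *
          b (n - p) (back_face p (n - p) (singular_face (Suc n) k \<sigma>))))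
        = (\<Sum>k\<le>Suc n. if k \<le> p then F p k * B p else alt p (A p * G p (k - p)))"
        by (intro sum.cong refl) (use FG that in \<open>auto simp del: sum.atMost_Suc\<close>)
      also have "\<dots> = (\<Sum>k\<le>p. F p k * B p) + (\<Sum>j\<le>n - p. alt p (A p * G p (Suc j)))"
        unfolding sum_atMost_split [OF that] by simp
      \<comment> \<open>Each sum lacks one term of a full coboundary. The missing ones are
        \<open>F p (Suc p)\<close>, which is minus \<open>alt p (A p)\<close>, and
        \<open>G p 0\<close>, which is \<open>B p\<close>; after multiplication they are opposite,
        so both may be added.\<close>
      also have "\<dots> = (\<Sum>k\<le>Suc p. F p k) * B p + alt p (A p) * (\<Sum>j\<le>Suc (n - p). G p j)"
      proof -
        have "F p (Suc p) = - alt p (A p)"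
          by (simp add: F_def A_def singular_face_last_front_face alt_Suc)
        moreover have "G p 0 = B p"
          by (simp add: G_def B_def singular_face_first_back_face)
        ultimately show ?thesis
          by (subst sum.atMost_Suc, subst sum.atMost_Suc_shift)
            (simp add: left_diff_distrib distrib_left distrib_right sum_distrib_left sum_distrib_right
              alt_mult_left alt_mult_right)
      qed
      finally show ?thesis .
    qed
    have "coboundary X (cup_product X a b) m \<sigma>
        = (\<Sum>k\<le>Suc n. \<Sum>p\<le>n. alt k (a p (front_face p (singular_face (Suc n) k \<sigma>)) *
          b (n - p) (back_face p (n - p) (singular_face (Suc n) k \<sigma>))))"
      unfolding m coboundary_Suc using \<sigma>
      by (simp add: cup_product_def singular_simplex_face alt_sum del: sum.atMost_Suc)
    also have "\<dots> = (\<Sum>p\<le>n. (\<Sum>k\<le>Suc p. F p k) * B p + alt p (A p) * (\<Sum>j\<le>Suc (n - p). G p j))"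
      by (subst sum.swap) (simp add: inner del: sum.atMost_Suc)
    also have "\<dots> = (\<Sum>p\<le>n. (\<Sum>k\<le>Suc p. F p k) * B p) + (\<Sum>p\<le>n. alt p (A p) * (\<Sum>j\<le>Suc (n - p). G p j))"
      by (rule sum.distrib)
    \<comment> \<open>The cup product in degree \<open>Suc n\<close> has one summand more. A
      coboundary has no component in degree 0, so the summand \<open>p = 0\<close> drops out here
      and the summand \<open>p = Suc n\<close> in the other product.\<close>
    also have "(\<Sum>p\<le>n. (\<Sum>k\<le>Suc p. F p k) * B p) = cup_product X (coboundary X a) b m \<sigma>"
    proof -
      have "coboundary X a (Suc p) (front_face (Suc p) \<sigma>) = (\<Sum>k\<le>Suc p. F p k)" if "p \<le> n" for p
        using that singular_simplex_front_face [OF \<sigma>, of "Suc p"] by (simp add: coboundary_Suc F_def del: sum.atMost_Suc)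
      then show ?thesis
        using \<sigma> by (simp add: m cup_product_def sum.atMost_Suc_shift B_def del: sum.atMost_Suc)
    qed
    also have "(\<Sum>p\<le>n. alt p (A p) * (\<Sum>j\<le>Suc (n - p). G p j)) = cup_product X (twist a) (coboundary X b) m \<sigma>"
    proof -
      have "coboundary X b (Suc n - p) (back_face p (Suc n - p) \<sigma>) = (\<Sum>j\<le>Suc (n - p). G p j)" if "p \<le> n" for p
        using that singular_simplex_back_face [of p "Suc (n - p)" X \<sigma>] \<sigma>
        by (simp add: Suc_diff_le coboundary_Suc G_def del: sum.atMost_Suc)
      then show ?thesis
        using \<sigma> by (simp add: m cup_product_def sum.atMost_Suc [of _ n] A_def twist_def)
    qed
    finally show ?thesis .
  qed
qed


text \<open>Both bracketings sum over the ways to cut the simplex at two vertices into a front, a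
  middle and a back, of dimensions \<open>q\<close>, \<open>r\<close> and the rest; they differ only
  in whether \<open>q + r\<close> or \<open>q\<close> is chosen first.\<close>

lemma cup_product_assoc:
  fixes a b c :: "('a, 'r::{ring,monoid_mult}) cochains"
  shows "cup_product X (cup_product X a b) c = cup_product X a (cup_product X b c)"
proof (intro ext)
  fix n \<sigma>
  show "cup_product X (cup_product X a b) c n \<sigma> = cup_product X a (cup_product X b c) n \<sigma>"
  proof (cases "singular_simplex n X \<sigma>")
    case \<sigma>: True
    define g where "g q r = a q (front_face q \<sigma>) * b r (back_face q r (front_face (q + r) \<sigma>)) *
        c (n - (q + r)) (back_face (q + r) (n - (q + r)) \<sigma>)" for q r
    have "cup_product X (cup_product X a b) c n \<sigma> = (\<Sum>p\<le>n. \<Sum>q\<le>p. g q (p - q))"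
      using \<sigma> by (simp add: cup_product_def g_def singular_simplex_front_face front_face_front_face
          sum_distrib_right)
    also have "\<dots> = (\<Sum>(q, r)\<in>{(q, r). q + r \<le> n}. g q r)"
      by (rule sum.triangle_reindex_eq [symmetric])
    also have "{(q, r). q + r \<le> n} = (SIGMA q:{..n}. {..n - q})"
      by auto
    also have "(\<Sum>(q, r)\<in>(SIGMA q:{..n}. {..n - q}). g q r) = (\<Sum>q\<le>n. \<Sum>r\<le>n - q. g q r)"
      by (simp add: sum.Sigma)
    also have "\<dots> = cup_product X a (cup_product X b c) n \<sigma>"
    proof -
      have "g q r = a q (front_face q \<sigma>) * (b r (front_face r (back_face q (n - q) \<sigma>)) *
          c (n - q - r) (back_face r (n - q - r) (back_face q (n - q) \<sigma>)))" if "q \<le> n" "r \<le> n - q" for q r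
        using that back_face_front_face [of q "q + r" n \<sigma>] back_face_back_face [of r "n - q - r" q \<sigma>]
        by (simp add: g_def mult.assoc)
      moreover have "singular_simplex (n - q) X (back_face q (n - q) \<sigma>)" if "q \<le> n" for q
        using that \<sigma> by (simp add: singular_simplex_back_face)
      ultimately show ?thesis
        using \<sigma> by (simp add: cup_product_def sum_distrib_left)
    qed
    finally show ?thesis .
  qed (simp add: cup_product_def)
qed

lemma cup_product_add_left:
  fixes a b c :: "('a, 'r::{ring,monoid_mult}) cochains"
  shows "cup_product X (\<lambda>n \<sigma>. a n \<sigma> + b n \<sigma>) c = (\<lambda>n \<sigma>. cup_product X a c n \<sigma> + cup_product X b c n \<sigma>)"
  by (intro ext) (simp add: cup_product_def distrib_right sum.distrib)

lemma cup_product_add_right: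
  fixes a b c :: "('a, 'r::{ring,monoid_mult}) cochains"
  shows "cup_product X c (\<lambda>n \<sigma>. a n \<sigma> + b n \<sigma>) = (\<lambda>n \<sigma>. cup_product X c a n \<sigma> + cup_product X c b n \<sigma>)"
  by (intro ext) (simp add: cup_product_def distrib_left sum.distrib)

lemma cup_product_zero [simp]:
  "cup_product X (\<lambda>n \<sigma>. 0) b = (\<lambda>n \<sigma>. 0)" "cup_product X b (\<lambda>n \<sigma>. 0) = (\<lambda>n \<sigma>. 0)"
  by (intro ext; simp add: cup_product_def)+

lemma cup_product_one_left:
  fixes a :: "('a, 'r::{ring,monoid_mult}) cochains"
  assumes "a \<in> singular_cochains X"
  shows "cup_product X (\<lambda>n \<sigma>. if n = 0 \<and> singular_simplex n X \<sigma> then 1 else 0) a = a"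
proof (intro ext)
  fix n \<sigma>
  show "cup_product X (\<lambda>n \<sigma>. if n = 0 \<and> singular_simplex n X \<sigma> then 1 else 0) a n \<sigma> = a n \<sigma>"
  proof (cases "singular_simplex n X \<sigma>")
    case True
    have "(\<Sum>p\<le>n. (if p = 0 \<and> singular_simplex p X (front_face p \<sigma>) then 1 else 0) *
              a (n - p) (back_face p (n - p) \<sigma>))
        = (\<Sum>p\<le>n. if p = 0 then a n \<sigma> else 0)"
      by (intro sum.cong refl) (use True back_face_self [OF True] in
          \<open>auto simp: singular_simplex_front_face\<close>)
    then show ?thesis
      using True by (simp add: cup_product_def)
  next
    case False
    then show ?thesis
      using assms by (simp add: cup_product_def singular_cochains_def)
  qed
qed

lemma cup_product_one_right:
  fixes a :: "('a, 'r::{ring,monoid_mult}) cochains"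
  assumes "a \<in> singular_cochains X"
  shows "cup_product X a (\<lambda>n \<sigma>. if n = 0 \<and> singular_simplex n X \<sigma> then 1 else 0) = a"
proof (intro ext)
  fix n \<sigma>
  show "cup_product X a (\<lambda>n \<sigma>. if n = 0 \<and> singular_simplex n X \<sigma> then 1 else 0) n \<sigma> = a n \<sigma>"
  proof (cases "singular_simplex n X \<sigma>")
    case True
    have "(\<Sum>p\<le>n. a p (front_face p \<sigma>) *
            (if n - p = 0 \<and> singular_simplex (n - p) X (back_face p (n - p) \<sigma>) then 1 else 0))
        = (\<Sum>p\<le>n. if p = n then a n \<sigma> else 0)"
      by (intro sum.cong refl) (use True singular_simplex_back_face [of n 0 X \<sigma>] in
          \<open>auto simp: front_face_self [OF True]\<close>)
    then show ?thesis
      using True by (simp add: cup_product_def)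
  next
    case False
    then show ?thesis
      using assms by (simp add: cup_product_def singular_cochains_def)
  qed
qed

section \<open>Linearity of the coboundary, closure of the cochains under the operations, and
  pullbacks\<close>

lemma coboundary_add:
  "coboundary X (\<lambda>n \<sigma>. a n \<sigma> + b n \<sigma>) = (\<lambda>n \<sigma>. coboundary X a n \<sigma> + coboundary X b n \<sigma>)"
  by (intro ext) (auto simp: coboundary_def sum.distrib [symmetric] intro!: sum.cong)

lemma coboundary_minus:
  "coboundary X (\<lambda>n \<sigma>. - a n \<sigma>) = (\<lambda>n \<sigma>. - coboundary X a n \<sigma>)"
  by (intro ext) (auto simp: coboundary_def sum_negf [symmetric] intro!: sum.cong)

lemma coboundary_diff:
  "coboundary X (\<lambda>n \<sigma>. a n \<sigma> - b n \<sigma>) = (\<lambda>n \<sigma>. coboundary X a n \<sigma> - coboundary X b n \<sigma>)"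
  using coboundary_add [of X a "\<lambda>n \<sigma>. - b n \<sigma>"] by (simp add: coboundary_minus)

lemma coboundary_zero [simp]: "coboundary X (\<lambda>n \<sigma>. 0) = (\<lambda>n \<sigma>. 0)"
  by (intro ext) (simp add: coboundary_def cong: if_cong)

text \<open>Only degree 1 is at stake, where the two end points contribute 1 and -1.\<close>

lemma coboundary_one:
  "coboundary X (\<lambda>n \<sigma>. if n = 0 \<and> singular_simplex n X \<sigma> then 1 else 0 :: 'r::{ring,monoid_mult}) = (\<lambda>n \<sigma>. 0)"
proof (intro ext)
  fix n \<sigma>
  show "coboundary X (\<lambda>n \<sigma>. if n = 0 \<and> singular_simplex n X \<sigma> then 1 else 0 :: 'r) n \<sigma> = 0"
    proof (cases n)
    case (Suc m)
    then show ?thesis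
      by (cases m) (auto simp: coboundary_Suc singular_simplex_face alt_def cong: if_cong)
  qed simp
qed

lemma singular_cochainsI:
  assumes "\<And>n \<sigma>. \<not> singular_simplex n X \<sigma> \<Longrightarrow> c n \<sigma> = 0" "{n. \<exists>\<sigma>. c n \<sigma> \<noteq> 0} \<subseteq> F" "finite F"
  shows "c \<in> singular_cochains X"
  using assms by (simp add: singular_cochains_def finite_subset)

lemma singular_cochains_zero: "(\<lambda>n \<sigma>. 0) \<in> singular_cochains X"
  by (simp add: singular_cochains_def)

lemma singular_cochains_one:
  "(\<lambda>n \<sigma>. if n = 0 \<and> singular_simplex n X \<sigma> then 1 else 0) \<in> singular_cochains X"
  by (auto simp: singular_cochains_def intro: finite_subset [of _ "{0}"])

lemma singular_cochains_add:
  assumes "a \<in> singular_cochains X" "b \<in> singular_cochains X"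
  shows "(\<lambda>n \<sigma>. a n \<sigma> + b n \<sigma>) \<in> singular_cochains X"
proof -
  have "{n. \<exists>\<sigma>. a n \<sigma> + b n \<sigma> \<noteq> 0} \<subseteq> {n. \<exists>\<sigma>. a n \<sigma> \<noteq> 0} \<union> {n. \<exists>\<sigma>. b n \<sigma> \<noteq> 0}"
    by (simp add: subset_iff) (metis add_0)
  then show ?thesis
    using assms by (auto simp: singular_cochains_def intro: finite_subset)
qed

lemma singular_cochains_minus:
  "a \<in> singular_cochains X \<Longrightarrow> (\<lambda>n \<sigma>. - a n \<sigma>) \<in> singular_cochains X"
  by (simp add: singular_cochains_def)

lemma singular_cochains_diff:
  "a \<in> singular_cochains X \<Longrightarrow> b \<in> singular_cochains X \<Longrightarrow> (\<lambda>n \<sigma>. a n \<sigma> - b n \<sigma>) \<in> singular_cochains X"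
  using singular_cochains_add [of a X "\<lambda>n \<sigma>. - b n \<sigma>"] by (simp add: singular_cochains_minus)

lemma singular_cochains_twist:
  "a \<in> singular_cochains X \<Longrightarrow> twist a \<in> singular_cochains X"
proof -
  have "alt n (a n \<sigma>) \<noteq> 0 \<longleftrightarrow> a n \<sigma> \<noteq> 0" for n \<sigma>
    by (simp add: alt_def)
  then show "a \<in> singular_cochains X \<Longrightarrow> twist a \<in> singular_cochains X"
    by (simp add: singular_cochains_def twist_def)
qed

lemma singular_cochains_cup_product:
  assumes "a \<in> singular_cochains X" "b \<in> singular_cochains X"
  shows "cup_product X a b \<in> singular_cochains X"
proof -
  have "{n. \<exists>\<sigma>. cup_product X a b n \<sigma> \<noteq> 0}
      \<subseteq> (\<lambda>(p, q). p + q) ` ({n. \<exists>\<sigma>. a n \<sigma> \<noteq> 0} \<times> {n. \<exists>\<sigma>. b n \<sigma> \<noteq> 0})"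
  proof clarify
    fix n \<sigma>
    assume "cup_product X a b n \<sigma> \<noteq> 0"
    then obtain p where "p \<le> n" "a p (front_face p \<sigma>) * b (n - p) (back_face p (n - p) \<sigma>) \<noteq> 0"
      by (auto simp: cup_product_def split: if_splits elim: sum.not_neutral_contains_not_neutral)
    moreover from this have "a p (front_face p \<sigma>) \<noteq> 0" "b (n - p) (back_face p (n - p) \<sigma>) \<noteq> 0"
      by auto
    ultimately show "n \<in> (\<lambda>(p, q). p + q) ` ({n. \<exists>\<sigma>. a n \<sigma> \<noteq> 0} \<times> {n. \<exists>\<sigma>. b n \<sigma> \<noteq> 0})"
      by (intro image_eqI [where x = "(p, n - p)"]) auto
  qed
  then show ?thesis
  proof (rule singular_cochainsI [rotated])
    show "finite ((\<lambda>(p, q). p + q) ` ({n. \<exists>\<sigma>. a n \<sigma> \<noteq> 0} \<times> {n. \<exists>\<sigma>. b n \<sigma> \<noteq> 0}))"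
      using assms by (simp add: singular_cochains_def)
  qed (simp add: cup_product_def)
qed

lemma singular_cochains_coboundary:
  assumes "a \<in> singular_cochains X"
  shows "coboundary X a \<in> singular_cochains X"
proof -
  have "{n. \<exists>\<sigma>. coboundary X a n \<sigma> \<noteq> 0} \<subseteq> Suc ` {n. \<exists>\<sigma>. a n \<sigma> \<noteq> 0}"
  proof clarify
    fix n \<sigma>
    assume n: "coboundary X a n \<sigma> \<noteq> 0"
    then obtain m where "n = Suc m"
      by (cases n) auto
    with n obtain k where "alt k (a m (singular_face (Suc m) k \<sigma>)) \<noteq> 0"
      by (auto simp: coboundary_Suc simp del: sum.atMost_Suc split: if_splits
          elim: sum.not_neutral_contains_not_neutral)
    then show "n \<in> Suc ` {n. \<exists>\<sigma>. a n \<sigma> \<noteq> 0}"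
      using \<open>n = Suc m\<close> by (auto simp: alt_def split: if_splits)
  qed
  then show ?thesis
  proof (rule singular_cochainsI [rotated])
    show "finite (Suc ` {n. \<exists>\<sigma>. a n \<sigma> \<noteq> 0})"
      using assms by (simp add: singular_cochains_def)
  qed (simp add: coboundary_def)
qed

lemma singular_cochains_pullback:
  assumes "c \<in> singular_cochains Y"
  shows "cochain_pullback X g c \<in> singular_cochains X"
proof -
  have "{n. \<exists>\<sigma>. cochain_pullback X g c n \<sigma> \<noteq> 0} \<subseteq> {n. \<exists>\<sigma>. c n \<sigma> \<noteq> 0}"
    by (auto simp: cochain_pullback_def split: if_splits)
  then show ?thesis
  proof (rule singular_cochainsI [rotated])
    show "finite {n. \<exists>\<sigma>. c n \<sigma> \<noteq> 0}"
      using assms by (simp add: singular_cochains_def)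
  qed (simp add: cochain_pullback_def)
qed

lemma coboundary_pullback:
  assumes "continuous_map X Y g"
  shows "coboundary X (cochain_pullback X g c) = cochain_pullback X g (coboundary Y c)"
proof (intro ext)
  fix n \<sigma>
  show "coboundary X (cochain_pullback X g c) n \<sigma> = cochain_pullback X g (coboundary Y c) n \<sigma>"
  proof (cases n)
    case (Suc m)
    then show ?thesis
      using singular_simplex_simplex_map [OF _ assms, of n \<sigma>]
      by (simp add: cochain_pullback_def coboundary_Suc singular_simplex_face
          singular_face_simplex_map' del: sum.atMost_Suc)
  qed (simp add: cochain_pullback_def)
qed

lemma cup_product_pullback:
  assumes "continuous_map X Y g"
  shows "cochain_pullback X g (cup_product Y a b)
           = cup_product X (cochain_pullback X g a) (cochain_pullback X g b)"
proof (intro ext)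
  fix n \<sigma>
  show "cochain_pullback X g (cup_product Y a b) n \<sigma>
           = cup_product X (cochain_pullback X g a) (cochain_pullback X g b) n \<sigma>"
  proof (cases "singular_simplex n X \<sigma>")
    case True
    have "back_face p (n - p) (simplex_map n g \<sigma>) = simplex_map (n - p) g (back_face p (n - p) \<sigma>)"
      "singular_simplex (n - p) X (back_face p (n - p) \<sigma>)" if "p \<le> n" for p
      using back_face_simplex_map [of p "n - p" g \<sigma>] singular_simplex_back_face [of p "n - p" X \<sigma>]
        True that by simp_all
    then show ?thesis
      using True singular_simplex_simplex_map [OF True assms]
      by (simp add: cochain_pullback_def cup_product_def front_face_simplex_map
          singular_simplex_front_face)
  qed (simp add: cochain_pullback_def cup_product_def)
qed

lemma cochain_pullback_compose:
  assumes "continuous_map X Y g"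
  shows "cochain_pullback X g (cochain_pullback Y h c) = cochain_pullback X (h \<circ> g) c"
  using singular_simplex_simplex_map [OF _ assms]
  by (intro ext) (simp add: cochain_pullback_def simplex_map_compose)

lemma cochain_pullback_ident:
  assumes "c \<in> singular_cochains X"
  shows "cochain_pullback X (\<lambda>x. x) c = c"
  using assms by (intro ext) (auto simp: cochain_pullback_def singular_cochains_def simplex_map_id_gen)

lemma cochain_pullback_add:
  "cochain_pullback X f (\<lambda>n \<sigma>. a n \<sigma> + b n \<sigma>) = (\<lambda>n \<sigma>. cochain_pullback X f a n \<sigma> + cochain_pullback X f b n \<sigma>)"
  by (intro ext) (simp add: cochain_pullback_def)

lemma cochain_pullback_zero [simp]: "cochain_pullback X f (\<lambda>n \<sigma>. 0) = (\<lambda>n \<sigma>. 0)"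
  by (intro ext) (simp add: cochain_pullback_def)


section \<open>The ring of cocycles\<close>

lemma cocycle_ring_simps:
  "carrier (cocycle_ring R X) = {c \<in> singular_cochains X. coboundary X c = (\<lambda>n \<sigma>. 0)}"
  "a \<otimes>\<^bsub>cocycle_ring R X\<^esub> b = cup_product X a b"
  "\<one>\<^bsub>cocycle_ring R X\<^esub> = (\<lambda>n \<sigma>. if n = 0 \<and> singular_simplex n X \<sigma> then 1 else 0)"
  "\<zero>\<^bsub>cocycle_ring R X\<^esub> = (\<lambda>n \<sigma>. 0)"
  "a \<oplus>\<^bsub>cocycle_ring R X\<^esub> b = (\<lambda>n \<sigma>. a n \<sigma> + b n \<sigma>)"
  by (simp_all add: cocycle_ring_def)

lemma ring_cocycle_ring: "ring (cocycle_ring (R :: 'r::{ring,monoid_mult} itself) X)"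
proof (rule ringI)
  show "abelian_group (cocycle_ring R X)"
  proof (rule abelian_groupI, unfold cocycle_ring_simps)
    fix x :: "('a, 'r) cochains"
    assume x: "x \<in> {c \<in> singular_cochains X. coboundary X c = (\<lambda>n \<sigma>. 0)}"
    show "\<exists>y\<in>{c \<in> singular_cochains X. coboundary X c = (\<lambda>n \<sigma>. 0)}. (\<lambda>n \<sigma>. y n \<sigma> + x n \<sigma>) = (\<lambda>n \<sigma>. 0)"
      by (rule bexI [where x = "\<lambda>n \<sigma>. - x n \<sigma>"])
        (use x in \<open>auto simp: singular_cochains_minus coboundary_minus\<close>)
  qed (auto simp: singular_cochains_add singular_cochains_zero coboundary_add ac_simps)
  show "Group.monoid (cocycle_ring R X)"
    by (rule monoidI) (auto simp: cocycle_ring_simps singular_cochains_cup_product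
        coboundary_cup_product singular_cochains_one coboundary_one cup_product_assoc
        cup_product_one_left cup_product_one_right)
qed (auto simp: cocycle_ring_simps cup_product_add_left cup_product_add_right)

lemma twist_cocycle:
  assumes "coboundary X a = (\<lambda>n \<sigma>. 0)"
  shows "coboundary X (twist a) = (\<lambda>n \<sigma>. 0)"
proof (intro ext)
  fix n \<sigma>
  show "coboundary X (twist a) n \<sigma> = 0"
  proof (cases n)
    case (Suc m)
    have "coboundary X (twist a) (Suc m) \<sigma> = alt m (coboundary X a (Suc m) \<sigma>)"
      by (simp add: coboundary_Suc twist_def alt_sum alt_alt add.commute del: sum.atMost_Suc)
    then show ?thesis
      using assms Suc by simp
  qed simp
qed

lemma twist_twist [simp]: "twist (twist a) = a"
  by (auto simp: twist_def alt_def fun_eq_iff)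


section \<open>Evaluation of cochains on chains\<close>

text \<open>The coefficient ring need not be an instance of \<open>ring_1\<close>, so \<open>of_int\<close> is not available for
  the action of the integers.\<close>

definition int_scale :: "int \<Rightarrow> 'r::ab_group_add \<Rightarrow> 'r" where
  "int_scale k r = (\<Sum>i<nat k. r) - (\<Sum>i<nat (- k). r)"

lemma sum_const_add: "(\<Sum>i<m + n. r) = (\<Sum>i<m. r) + (\<Sum>i<n. r :: 'r::ab_group_add)" for m n :: nat
  by (induction n) (simp_all add: ac_simps)

text \<open>Any presentation of an integer as a difference of naturals may be used in place of the
  one by positive and negative part; additivity then reduces to natural numbers.\<close>

lemma int_scale_diff_nat: "int_scale (int m - int n) r = (\<Sum>i<m. r) - (\<Sum>i<n. r)"
proof (cases "m \<ge> n")
  case True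
  then show ?thesis
    using sum_const_add [of r "m - n" n] by (simp add: int_scale_def nat_diff_distrib')
next
  case False
  then show ?thesis
    using sum_const_add [of r "n - m" m] by (simp add: int_scale_def nat_diff_distrib')
qed

lemma int_scale_add: "int_scale (j + k) r = int_scale j r + int_scale k r"
proof -
  obtain a b c d where "j = int a - int b" "k = int c - int d"
    by (metis int_diff_cases)
  moreover from this have "j + k = int (a + c) - int (b + d)"
    by simp
  ultimately show ?thesis
    by (simp only: int_scale_diff_nat sum_const_add) (simp add: algebra_simps)
qed

lemma int_scale_0 [simp]: "int_scale 0 r = 0" and int_scale_1 [simp]: "int_scale 1 r = r"
  by (simp_all add: int_scale_def)

text \<open>The additive extension of a cochain in one degree to integral chains. It is the pairing
  through which identities between chains become identities between cochains.\<close>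

definition chain_eval :: "('b \<Rightarrow> 'r::ab_group_add) \<Rightarrow> ('b \<Rightarrow>\<^sub>0 int) \<Rightarrow> 'r" where
  "chain_eval c x = (\<Sum>\<sigma>\<in>Poly_Mapping.keys x. int_scale (Poly_Mapping.lookup x \<sigma>) (c \<sigma>))"

lemma chain_eval_superset:
  assumes "finite S" "Poly_Mapping.keys x \<subseteq> S"
  shows "chain_eval c x = (\<Sum>\<sigma>\<in>S. int_scale (Poly_Mapping.lookup x \<sigma>) (c \<sigma>))"
  unfolding chain_eval_def
  by (rule sum.mono_neutral_left) (use assms in \<open>auto simp: in_keys_iff\<close>)

lemma chain_eval_add: "chain_eval c (x + y) = chain_eval c x + chain_eval c y"
proof -
  let ?S = "Poly_Mapping.keys x \<union> Poly_Mapping.keys y"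
  have "Poly_Mapping.keys (x + y) \<subseteq> ?S"
    by (rule keys_add)
  then show ?thesis
    by (simp add: chain_eval_superset [of ?S] lookup_add int_scale_add sum.distrib)
qed

lemma chain_eval_0 [simp]: "chain_eval c 0 = 0"
  by (simp add: chain_eval_def)

lemma chain_eval_minus: "chain_eval c (- x) = - chain_eval c x"
  using chain_eval_add [of c x "- x"] by (simp add: eq_neg_iff_add_eq_0 add.commute)

lemma chain_eval_diff: "chain_eval c (x - y) = chain_eval c x - chain_eval c y"
  using chain_eval_add [of c x "- y"] by (simp add: chain_eval_minus)

lemma chain_eval_of [simp]: "chain_eval c (frag_of \<sigma>) = c \<sigma>"
  by (simp add: chain_eval_def)

lemma chain_eval_sum: "chain_eval c (\<Sum>i\<in>I. f i) = (\<Sum>i\<in>I. chain_eval c (f i))"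
  by (induction I rule: infinite_finite_induct) (simp_all add: chain_eval_add)

lemma chain_eval_sign: "chain_eval c (frag_cmul ((-1) ^ k) x) = alt k (chain_eval c x)"
  by (cases "even k") (simp_all add: alt_def chain_eval_minus)

lemma chain_eval_zero: "(\<And>\<sigma>. \<sigma> \<in> Poly_Mapping.keys x \<Longrightarrow> c \<sigma> = 0) \<Longrightarrow> chain_eval c x = 0"
  by (simp add: chain_eval_def int_scale_def)

text \<open>The coboundary carries the same signs as the boundary of chains, so it is exactly the
  transpose, without a further sign.\<close>

lemma coboundary_eq_chain_eval:
  assumes "singular_simplex (Suc n) X \<sigma>"
  shows "coboundary X c (Suc n) \<sigma> = chain_eval (c n) (chain_boundary (Suc n) (frag_of \<sigma>))"
  using assms by (simp add: coboundary_Suc chain_boundary_of chain_eval_sum chain_eval_sign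
      del: sum.atMost_Suc)

lemma chain_eval_coboundary:
  assumes "singular_chain (Suc n) X x"
  shows "chain_eval (coboundary X c (Suc n)) x = chain_eval (c n) (chain_boundary (Suc n) x)"
  using assms unfolding singular_chain_def
  by (induction x rule: frag_induction)
    (simp_all add: coboundary_eq_chain_eval chain_eval_diff chain_boundary_diff)

text \<open>Transposed twice, the value on a simplex is that of \<open>c\<close> on a boundary of a
  boundary.\<close>

lemma coboundary_coboundary:
  fixes c :: "('a, 'r::{ring,monoid_mult}) cochains"
  shows "coboundary X (coboundary X c) = (\<lambda>n \<sigma>. 0)"
proof (intro ext)
  fix n \<sigma>
  show "coboundary X (coboundary X c) n \<sigma> = 0"
  proof (cases "\<exists>m. n = Suc m \<and> singular_simplex n X \<sigma>")
    case True
    then obtain m where m: "n = Suc m" and \<sigma>: "singular_simplex (Suc m) X \<sigma>"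
      by auto
    have ch: "singular_chain m X (chain_boundary (Suc m) (frag_of \<sigma>))"
      using \<sigma> by (intro singular_chain_boundary_alt) (simp add: singular_chain_of)
    have "chain_eval (coboundary X c m) (chain_boundary (Suc m) (frag_of \<sigma>)) = 0"
    proof (cases m)
      case 0
      then show ?thesis
        by (simp add: chain_eval_zero)
    next
      case (Suc l)
      then show ?thesis
        using chain_eval_coboundary [of l X _ c] ch
          chain_boundary_boundary_alt [of "Suc l" X "frag_of \<sigma>"] \<sigma>
        by (simp add: singular_chain_of)
    qed
    then show ?thesis
      by (simp add: m coboundary_eq_chain_eval [OF \<sigma>])
  next
    case False
    then show ?thesis
      by (cases n) (auto simp: coboundary_def)
  qed
qed


section \<open>The cohomology ring\<close>

lemma cup_product_coboundary_left:
  assumes "coboundary X b = (\<lambda>n \<sigma>. 0)"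
  shows "cup_product X (coboundary X a) b = coboundary X (cup_product X a b)"
  using assms by (simp add: coboundary_cup_product)

text \<open>The Leibniz rule is applied to \<open>twist a\<close>: its sign twists \<open>a\<close>
  back, and \<open>twist a\<close> is still a cocycle. Since the coefficients may be noncommutative,
  this is needed beside the version on the left to get a two-sided ideal.\<close>

lemma cup_product_coboundary_right:
  assumes "coboundary X a = (\<lambda>n \<sigma>. 0)"
  shows "cup_product X a (coboundary X b) = coboundary X (cup_product X (twist a) b)"
  using assms by (simp add: coboundary_cup_product twist_cocycle)

lemma coboundaries_subset: "coboundaries R X \<subseteq> carrier (cocycle_ring R X)"
  by (auto simp: coboundaries_def cocycle_ring_simps singular_cochains_coboundary coboundary_coboundary)

lemma coboundaries_add:
  assumes "a \<in> coboundaries R X" "b \<in> coboundaries R X"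
  shows "(\<lambda>n \<sigma>. a n \<sigma> + b n \<sigma>) \<in> coboundaries R X"
proof -
  obtain c d where "c \<in> singular_cochains X" "d \<in> singular_cochains X"
      "a = coboundary X c" "b = coboundary X d"
    using assms by (auto simp: coboundaries_def)
  then show ?thesis
    unfolding coboundaries_def
    by (intro image_eqI [where x = "\<lambda>n \<sigma>. c n \<sigma> + d n \<sigma>"]) (simp_all add: coboundary_add singular_cochains_add)
qed

lemma coboundaries_minus:
  assumes "a \<in> coboundaries R X"
  shows "(\<lambda>n \<sigma>. - a n \<sigma>) \<in> coboundaries R X"
proof -
  obtain c where "c \<in> singular_cochains X" "a = coboundary X c"
    using assms by (auto simp: coboundaries_def)
  then show ?thesis
    unfolding coboundaries_def
    by (intro image_eqI [where x = "\<lambda>n \<sigma>. - c n \<sigma>"]) (simp_all add: coboundary_minus singular_cochains_minus)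
qed

lemma coboundaries_diff:
  assumes "a \<in> coboundaries R X" "b \<in> coboundaries R X"
  shows "(\<lambda>n \<sigma>. a n \<sigma> - b n \<sigma>) \<in> coboundaries R X"
  using coboundaries_add [OF assms(1) coboundaries_minus [OF assms(2)]] by simp

lemma coboundaries_zero: "(\<lambda>n \<sigma>. 0) \<in> coboundaries R X"
  unfolding coboundaries_def by (rule image_eqI [where x = "\<lambda>n \<sigma>. 0"]) (simp_all add: singular_cochains_zero)

lemma a_inv_cocycle_ring:
  assumes "a \<in> carrier (cocycle_ring R X)"
  shows "\<ominus>\<^bsub>cocycle_ring R X\<^esub> a = (\<lambda>n \<sigma>. - a n \<sigma>)"
proof -
  interpret ring "cocycle_ring R X"
    by (rule ring_cocycle_ring)
  show ?thesis
    by (rule minus_equality) (use assms in \<open>auto simp: cocycle_ring_simps singular_cochains_minus coboundary_minus\<close>)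
qed

lemma ideal_coboundaries: "ideal (coboundaries R X) (cocycle_ring R X)"
proof (rule idealI [OF ring_cocycle_ring])
  interpret ring "cocycle_ring R X"
    by (rule ring_cocycle_ring)
  show "subgroup (coboundaries R X) (add_monoid (cocycle_ring R X))"
  proof (rule add.subgroupI)
    show "\<ominus>\<^bsub>cocycle_ring R X\<^esub> a \<in> coboundaries R X" if "a \<in> coboundaries R X" for a
      using that coboundaries_subset [of R X] by (auto simp: a_inv_cocycle_ring coboundaries_minus)
    show "coboundaries R X \<noteq> {}"
      using coboundaries_zero by blast
    show "a \<oplus>\<^bsub>cocycle_ring R X\<^esub> b \<in> coboundaries R X"
      if "a \<in> coboundaries R X" "b \<in> coboundaries R X" for a b
      using coboundaries_add [OF that] by (simp add: cocycle_ring_simps)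
  qed (rule coboundaries_subset)
  fix a x
  assume "a \<in> coboundaries R X" and x: "x \<in> carrier (cocycle_ring R X)"
  then obtain c where c: "c \<in> singular_cochains X" "a = coboundary X c"
    by (auto simp: coboundaries_def)
  show "x \<otimes>\<^bsub>cocycle_ring R X\<^esub> a \<in> coboundaries R X"
    using x c by (auto simp: cocycle_ring_simps cup_product_coboundary_right coboundaries_def
        singular_cochains_cup_product singular_cochains_twist)
  show "a \<otimes>\<^bsub>cocycle_ring R X\<^esub> x \<in> coboundaries R X"
    using x c by (auto simp: cocycle_ring_simps cup_product_coboundary_left coboundaries_def
        singular_cochains_cup_product)
qed

lemma ring_singular_cohomology: "ring (singular_cohomology R X)"
  unfolding singular_cohomology_def by (rule ideal.quotient_is_ring [OF ideal_coboundaries])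

definition cohomology_class ::
    "'r::{ring,monoid_mult} itself \<Rightarrow> 'a topology \<Rightarrow> ('a, 'r) cochains \<Rightarrow> ('a, 'r) cochains set" where
  "cohomology_class R X c = coboundaries R X +>\<^bsub>cocycle_ring R X\<^esub> c"

lemma carrier_singular_cohomology:
  "carrier (singular_cohomology R X) = cohomology_class R X ` carrier (cocycle_ring R X)"
  by (auto simp: singular_cohomology_def FactRing_def A_RCOSETS_def' cohomology_class_def)

lemma cohomology_class_ring_hom:
  "cohomology_class R X \<in> ring_hom (cocycle_ring R X) (singular_cohomology R X)"
  using ideal.rcos_ring_hom [OF ideal_coboundaries, of R X]
  by (simp add: singular_cohomology_def cohomology_class_def [abs_def])

lemma in_cohomology_class_iff:
  "b \<in> cohomology_class R X a \<longleftrightarrow> (\<exists>d\<in>coboundaries R X. b = (\<lambda>n \<sigma>. d n \<sigma> + a n \<sigma>))"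
  by (auto simp: cohomology_class_def a_r_coset_def r_coset_def cocycle_ring_simps)

lemma cohomology_class_eq_iff:
  assumes "a \<in> carrier (cocycle_ring R X)" "b \<in> carrier (cocycle_ring R X)"
  shows "cohomology_class R X a = cohomology_class R X b \<longleftrightarrow> (\<lambda>n \<sigma>. a n \<sigma> - b n \<sigma>) \<in> coboundaries R X"
proof
  assume "cohomology_class R X a = cohomology_class R X b"
  moreover have "a \<in> cohomology_class R X a"
    unfolding in_cohomology_class_iff by (rule bexI [OF _ coboundaries_zero]) simp
  ultimately show "(\<lambda>n \<sigma>. a n \<sigma> - b n \<sigma>) \<in> coboundaries R X"
    by (auto simp: in_cohomology_class_iff)
next
  assume d: "(\<lambda>n \<sigma>. a n \<sigma> - b n \<sigma>) \<in> coboundaries R X"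
  show "cohomology_class R X a = cohomology_class R X b"
  proof (rule Set.set_eqI, rule iffI)
    fix c
    assume "c \<in> cohomology_class R X a"
    then obtain e where "e \<in> coboundaries R X" "c = (\<lambda>n \<sigma>. e n \<sigma> + a n \<sigma>)"
      by (auto simp: in_cohomology_class_iff)
    then show "c \<in> cohomology_class R X b"
      unfolding in_cohomology_class_iff
      by (intro bexI [OF _ coboundaries_add [OF \<open>e \<in> _\<close> d]]) (auto simp: fun_eq_iff)
  next
    fix c
    assume "c \<in> cohomology_class R X b"
    then obtain e where "e \<in> coboundaries R X" "c = (\<lambda>n \<sigma>. e n \<sigma> + b n \<sigma>)"
      by (auto simp: in_cohomology_class_iff)
    then show "c \<in> cohomology_class R X a"
      unfolding in_cohomology_class_iff
      by (intro bexI [OF _ coboundaries_diff [OF \<open>e \<in> _\<close> d]]) (auto simp: fun_eq_iff)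
  qed
qed

lemma zero_singular_cohomology:
  "\<zero>\<^bsub>singular_cohomology R X\<^esub> = cohomology_class R X (\<lambda>n \<sigma>. 0)"
  by (auto simp: singular_cohomology_def FactRing_def in_cohomology_class_iff)

lemma cohomology_class_eq_zero_iff:
  assumes "a \<in> carrier (cocycle_ring R X)"
  shows "cohomology_class R X a = \<zero>\<^bsub>singular_cohomology R X\<^esub> \<longleftrightarrow> a \<in> coboundaries R X"
  using cohomology_class_eq_iff [OF assms, of "\<lambda>n \<sigma>. 0"]
  by (simp add: zero_singular_cohomology cocycle_ring_simps singular_cochains_zero)

lemma cocycle_pullback:
  assumes "continuous_map X Y g" "c \<in> carrier (cocycle_ring R Y)"
  shows "cochain_pullback X g c \<in> carrier (cocycle_ring R X)"
  using assms by (auto simp: cocycle_ring_simps singular_cochains_pullback coboundary_pullback)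

lemma coboundaries_pullback:
  assumes "continuous_map X Y g" "c \<in> coboundaries R Y"
  shows "cochain_pullback X g c \<in> coboundaries R X"
  using assms by (auto simp: coboundaries_def coboundary_pullback [OF assms(1), symmetric]
      intro: singular_cochains_pullback)

lemma cohomology_induced_class:
  assumes g: "continuous_map X Y g" and c: "c \<in> carrier (cocycle_ring R Y)"
  shows "cohomology_induced R X g (cohomology_class R Y c) = cohomology_class R X (cochain_pullback X g c)"
proof -
  have "cohomology_class R X (cochain_pullback X g b) = cohomology_class R X (cochain_pullback X g c)"
    if b: "b \<in> cohomology_class R Y c" for b
  proof -
    obtain d where d: "d \<in> coboundaries R Y" "b = (\<lambda>n \<sigma>. d n \<sigma> + c n \<sigma>)"
      using b by (auto simp: in_cohomology_class_iff)
    have "b \<in> carrier (cocycle_ring R Y)"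
      using d c coboundaries_subset [of R Y]
      by (auto simp: cocycle_ring_simps singular_cochains_add coboundary_add)
    moreover have "(\<lambda>n \<sigma>. cochain_pullback X g b n \<sigma> - cochain_pullback X g c n \<sigma>) \<in> coboundaries R X"
      using coboundaries_pullback [OF g d(1)] by (simp add: d(2) cochain_pullback_add)
    ultimately show ?thesis
      using c g by (simp add: cohomology_class_eq_iff cocycle_pullback)
  qed
  moreover have "c \<in> cohomology_class R Y c"
    unfolding in_cohomology_class_iff by (rule bexI [OF _ coboundaries_zero]) simp
  ultimately show ?thesis
    unfolding cohomology_induced_def cohomology_class_def [symmetric] by blast
qed

lemma cohomology_induced_ring_hom:
  assumes g: "continuous_map X Y g"
  shows "cohomology_induced R X g \<in> ring_hom (singular_cohomology R Y) (singular_cohomology R X)"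
proof -
  note X = cohomology_class_ring_hom [of R X] and Y = cohomology_class_ring_hom [of R Y]
  interpret cX: ring "cocycle_ring R X"
    by (rule ring_cocycle_ring)
  interpret cY: ring "cocycle_ring R Y"
    by (rule ring_cocycle_ring)
  have one: "cochain_pullback X g (\<one>\<^bsub>cocycle_ring R Y\<^esub>) = \<one>\<^bsub>cocycle_ring R X\<^esub>"
    using singular_simplex_simplex_map [OF _ g]
    by (intro ext) (auto simp: cochain_pullback_def cocycle_ring_simps)
  have mult: "cochain_pullback X g (a \<otimes>\<^bsub>cocycle_ring R Y\<^esub> b) =
      cochain_pullback X g a \<otimes>\<^bsub>cocycle_ring R X\<^esub> cochain_pullback X g b" for a b
    by (simp add: cocycle_ring_simps cup_product_pullback [OF g])
  have add: "cochain_pullback X g (a \<oplus>\<^bsub>cocycle_ring R Y\<^esub> b) =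
      cochain_pullback X g a \<oplus>\<^bsub>cocycle_ring R X\<^esub> cochain_pullback X g b" for a b
    by (simp add: cocycle_ring_simps cochain_pullback_add)
  show ?thesis
  proof (rule ring_hom_memI)
    fix x assume "x \<in> carrier (singular_cohomology R Y)"
    then show "cohomology_induced R X g x \<in> carrier (singular_cohomology R X)"
      by (auto simp: carrier_singular_cohomology cohomology_induced_class [OF g] cocycle_pullback [OF g])
  next
    fix x y assume "x \<in> carrier (singular_cohomology R Y)" "y \<in> carrier (singular_cohomology R Y)"
    then obtain a b where ab: "a \<in> carrier (cocycle_ring R Y)" "b \<in> carrier (cocycle_ring R Y)"
        "x = cohomology_class R Y a" "y = cohomology_class R Y b"
      by (auto simp: carrier_singular_cohomology)
    show "cohomology_induced R X g (x \<otimes>\<^bsub>singular_cohomology R Y\<^esub> y) =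
        cohomology_induced R X g x \<otimes>\<^bsub>singular_cohomology R X\<^esub> cohomology_induced R X g y"
      using ab by (simp add: ring_hom_mult [OF Y, symmetric] ring_hom_mult [OF X, symmetric]
          cohomology_induced_class [OF g] cocycle_pullback [OF g] mult)
    show "cohomology_induced R X g (x \<oplus>\<^bsub>singular_cohomology R Y\<^esub> y) =
        cohomology_induced R X g x \<oplus>\<^bsub>singular_cohomology R X\<^esub> cohomology_induced R X g y"
      using ab by (simp add: ring_hom_add [OF Y, symmetric] ring_hom_add [OF X, symmetric]
          cohomology_induced_class [OF g] cocycle_pullback [OF g] add)
  next
    show "cohomology_induced R X g \<one>\<^bsub>singular_cohomology R Y\<^esub> = \<one>\<^bsub>singular_cohomology R X\<^esub>"
      by (simp add: ring_hom_one [OF Y, symmetric] ring_hom_one [OF X, symmetric]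
          cohomology_induced_class [OF g] one)
  qed
qed


section \<open>Homotopy invariance\<close>

definition simplex_space :: "nat \<Rightarrow> (nat \<Rightarrow> real) topology" where
  "simplex_space p = subtopology (powertop_real UNIV) (standard_simplex p)"

abbreviation cylinder :: "'a topology \<Rightarrow> (real \<times> 'a) topology" where
  "cylinder X \<equiv> prod_topology (top_of_set {0..1}) X"

lemma topspace_simplex_space [simp]: "topspace (simplex_space p) = standard_simplex p"
  by (simp add: simplex_space_def topspace_standard_simplex)

lemma singular_simplex_iff:
  "singular_simplex p X \<sigma> \<longleftrightarrow> continuous_map (simplex_space p) X \<sigma> \<and> \<sigma> \<in> extensional (standard_simplex p)"
  by (simp add: singular_simplex_def simplex_space_def)

abbreviation id_simplex :: "nat \<Rightarrow> (nat \<Rightarrow> real) \<Rightarrow> nat \<Rightarrow> real" where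
  "id_simplex p \<equiv> restrict id (standard_simplex p)"

lemma singular_simplex_id_simplex: "singular_simplex p (simplex_space p) (id_simplex p)"
  unfolding singular_simplex_iff
  by (auto intro: continuous_map_eq [where f = id])

text \<open>The cylinder is convex, so it contracts along straight lines to the point over vertex 0
  at height 0.\<close>

lemma contractible_cylinder_simplex_space: "contractible_space (cylinder (simplex_space p))"
proof -
  \<comment> \<open>Vertex 0 of the simplex, the only vertex present for every
    \<open>p\<close>.\<close>
  define e :: "nat \<Rightarrow> real" where "e = (\<lambda>i. if i = 0 then 1 else 0)"
  have e: "e \<in> standard_simplex p"
    by (simp add: e_def basis_in_standard_simplex)
  define H :: "real \<times> real \<times> (nat \<Rightarrow> real) \<Rightarrow> real \<times> (nat \<Rightarrow> real)"
    where "H = (\<lambda>(s, t, x). ((1 - s) * t, \<lambda>i. (1 - s) * x i + s * e i))"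
  let ?D = "prod_topology (top_of_set {0..1::real}) (cylinder (simplex_space p))"
  have s: "continuous_map ?D euclideanreal (\<lambda>z. fst z)"
    and t: "continuous_map ?D euclideanreal (\<lambda>z. fst (snd z))"
    using continuous_map_fst [of "top_of_set {0..1::real}" "cylinder (simplex_space p)"]
      continuous_map_compose [OF continuous_map_snd continuous_map_fst,
        of "top_of_set {0..1::real}" "top_of_set {0..1::real}" "simplex_space p"]
    by (auto simp: o_def continuous_map_in_subtopology)
  have x: "continuous_map ?D euclideanreal (\<lambda>z. snd (snd z) i)" for i
  proof -
    have "continuous_map (simplex_space p) euclideanreal (\<lambda>x. x i)"
      unfolding simplex_space_def by (intro continuous_map_from_subtopology continuous_map_product_projection) auto
    then have "continuous_map ?D euclideanreal ((\<lambda>x. x i) \<circ> (snd \<circ> snd))"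
      by (intro continuous_map_compose [OF continuous_map_compose [OF continuous_map_snd continuous_map_snd]])
    then show ?thesis
      by (simp add: o_def)
  qed
  have "continuous_map ?D (cylinder (simplex_space p)) H"
    unfolding continuous_map_pairwise
  proof
    have "continuous_map ?D euclideanreal (\<lambda>z. (1 - fst z) * fst (snd z))"
      by (intro continuous_intros s t)
    then show "continuous_map ?D (top_of_set {0..1}) (fst \<circ> H)"
      by (auto simp: continuous_map_in_subtopology H_def o_def case_prod_unfold mult_le_one)
    have "continuous_map ?D euclideanreal (\<lambda>z. (1 - fst z) * snd (snd z) i + fst z * e i)" for i
      by (intro continuous_intros s x)
    then show "continuous_map ?D (simplex_space p) (snd \<circ> H)"
      using e by (auto simp: simplex_space_def continuous_map_in_subtopology H_def o_def case_prod_unfold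
          continuous_map_componentwise_UNIV convex_standard_simplex topspace_standard_simplex)
  qed
  moreover have "H (0, z) = id z" "H (1, z) = (0, e)" for z
    by (auto simp: H_def case_prod_unfold)
  ultimately show ?thesis
    unfolding contractible_space_def homotopic_with_def by blast
qed

text \<open>The identity is homotopic to a constant map, so the cycle is homologous to its image in
  a point. In positive degree that image bounds inside the point; in degree 0 the hypothesis says
  that it is zero, which is the condition of augmentation zero.\<close>

lemma cycle_boundary_contractible:
  fixes z :: "'a chain"
  assumes X: "contractible_space X" and z: "singular_chain q X z" "chain_boundary q z = 0"
    and 0: "\<And>a :: 'a. q = 0 \<Longrightarrow> chain_map 0 (\<lambda>_. a) z = 0"
  obtains w where "singular_chain (Suc q) X w" "chain_boundary (Suc q) w = z"
proof -
  obtain a where a: "homotopic_with (\<lambda>x. True) X X id (\<lambda>x. a)"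
    using X by (auto simp: contractible_space_def)
  \<comment> \<open>Homotopy invariance is quoted in its relative form; with the empty subspace its
    condition on the intermediate maps holds trivially.\<close>
  then have h: "homotopic_with (\<lambda>h. h \<in> {} \<rightarrow> {}) X X id (\<lambda>x. a)"
    by (simp add: Pi_def)
  have c: "singular_relcycle q X {} z"
    using z by (simp add: singular_cycle)
  have "homologous_rel q X {} (chain_map q id z) (chain_map q (\<lambda>x. a) z)"
    by (rule homotopic_imp_homologous_rel_chain_maps [OF h c])
  then have 1: "singular_relboundary q X {} (z - chain_map q (\<lambda>x. a) z)"
    using z by (simp add: homologous_rel_def chain_map_ident)
  have "singular_relboundary q X {} (chain_map q (\<lambda>x. a) z)"
  proof (cases "q = 0 \<or> topspace X = {}")
    case True
    then show ?thesis
      using 0 z by (auto simp: singular_chain_empty)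
  next
    case False
    have cont: "continuous_map X X (\<lambda>x. a)"
      using a homotopic_with_imp_continuous_maps by blast
    then have "a \<in> topspace X"
      using False by (simp add: continuous_map_const)
    then have "topspace (subtopology X {a}) = {a}" "continuous_map X (subtopology X {a}) (\<lambda>x. a)"
      by (auto simp: continuous_map_const)
    then have "singular_relboundary q (subtopology X {a}) {} (chain_map q (\<lambda>x. a) z)"
      using False singular_relcycle_chain_map [OF c, of "subtopology X {a}" "\<lambda>x. a" "{}"]
      by (subst singular_boundary_eq_cycle_singleton [of _ a]) auto
    then show ?thesis
      by (metis singular_boundary singular_chain_subtopology)
  qed
  then have "singular_relboundary q X {} z"
    using singular_relboundary_add [OF 1] by fastforce
  then show thesis
    using that by (auto simp: singular_boundary)
qed

text \<open>The chain homotopy on a singular \<open>q\<close>-simplex \<open>\<sigma>\<close> is the image of a universal chain \<open>w\<close> of the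
  cylinder over the standard simplex, which is found by the method of acyclic models.\<close>

definition prism :: "nat \<Rightarrow> (real \<times> (nat \<Rightarrow> real)) chain \<Rightarrow> (real \<times> 'a \<Rightarrow> 'b) \<Rightarrow> 'a chain \<Rightarrow> 'b chain" where
  "prism q w h = frag_extend (\<lambda>\<sigma>. chain_map (Suc q) (\<lambda>(t, x). h (t, \<sigma> x)) w)"

lemma prism_0 [simp]: "prism q w h 0 = 0"
  and prism_of: "prism q w h (frag_of \<sigma>) = chain_map (Suc q) (\<lambda>(t, x). h (t, \<sigma> x)) w"
  and prism_diff: "prism q w h (a - b) = prism q w h a - prism q w h b"
  by (simp_all add: prism_def frag_extend_diff)

lemma chain_map_prism: "chain_map (Suc q) k (prism q w h c) = prism q w (k \<circ> h) c"
  using subset_UNIV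
proof (induction c rule: frag_induction)
  case (one \<sigma>)
  have "(\<lambda>(t, x). (k \<circ> h) (t, \<sigma> x)) = k \<circ> (\<lambda>(t, x). h (t, \<sigma> x))"
    by auto
  then show ?case
    by (simp add: prism_of chain_map_compose)
qed (auto simp: prism_diff chain_map_diff)

text \<open>Naturality in the source. The position of \<open>w\<close> matters:
  \<open>simplex_map q g \<sigma>\<close> agrees with the composite of \<open>g\<close> and \<sigma>
  only on the standard simplex.\<close>

lemma prism_chain_map:
  assumes "singular_chain (Suc q) (cylinder (simplex_space q)) w"
  shows "prism q w h (chain_map q g c) = prism q w (\<lambda>(t, x). h (t, g x)) c"
  using subset_UNIV
proof (induction c rule: frag_induction)
  case (one \<sigma>)
  have "chain_map (Suc q) (\<lambda>(t, x). h (t, simplex_map q g \<sigma> x)) w = chain_map (Suc q) (\<lambda>(t, x). h (t, g (\<sigma> x))) w"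
    by (rule chain_map_eq [OF assms]) (auto simp: simplex_map_def)
  then show ?case
    by (simp add: prism_of)
qed (auto simp: prism_diff chain_map_diff)

lemma singular_chain_prism:
  assumes w: "singular_chain (Suc q) (cylinder (simplex_space q)) w"
    and h: "continuous_map (cylinder X) Y h" and c: "singular_chain q X c"
  shows "singular_chain (Suc q) Y (prism q w h c)"
  unfolding prism_def
proof (rule singular_chain_extend)
  fix \<sigma>
  assume "\<sigma> \<in> Poly_Mapping.keys c"
  then have \<sigma>: "continuous_map (simplex_space q) X \<sigma>"
    using c by (auto simp: singular_chain_def singular_simplex_iff)
  have "continuous_map (cylinder (simplex_space q)) (cylinder X) (\<lambda>(t, x). (t, \<sigma> x))"
    using continuous_map_prod_top [of "top_of_set {0..1::real}" "simplex_space q" "top_of_set {0..1::real}" X "\<lambda>t. t" \<sigma>] \<sigma>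
    by simp
  then have "continuous_map (cylinder (simplex_space q)) Y (h \<circ> (\<lambda>(t, x). (t, \<sigma> x)))"
    by (rule continuous_map_compose [OF _ h])
  moreover have "h \<circ> (\<lambda>(t, x). (t, \<sigma> x)) = (\<lambda>(t, x). h (t, \<sigma> x))"
    by auto
  ultimately show "singular_chain (Suc q) Y (chain_map (Suc q) (\<lambda>(t, x). h (t, \<sigma> x)) w)"
    using singular_chain_chain_map [OF w] by simp
qed

definition cylinder_end :: "real \<Rightarrow> nat \<Rightarrow> (nat \<Rightarrow> real) \<Rightarrow> real \<times> (nat \<Rightarrow> real)" where
  "cylinder_end t p = simplex_map p (Pair t) (id_simplex p)"

lemma singular_simplex_cylinder_end:
  assumes "t \<in> {0..1}"
  shows "singular_simplex p (cylinder (simplex_space p)) (cylinder_end t p)"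
  unfolding cylinder_end_def
  by (rule singular_simplex_simplex_map [OF singular_simplex_id_simplex])
    (use assms in \<open>simp add: continuous_map_pairwise o_def\<close>)

text \<open>The assumption \<open>dw\<close> is the prism identity for the identity simplex alone;
  naturality transports it to every singular simplex, and linearity to every chain.\<close>

lemma chain_boundary_prism:
  assumes w: "singular_chain (Suc p) (cylinder (simplex_space p)) w"
    and v: "p > 0 \<Longrightarrow> singular_chain p (cylinder (simplex_space (p - 1))) v"
    and dw: "chain_boundary (Suc p) w = frag_of (cylinder_end 1 p) - frag_of (cylinder_end 0 p)
               - prism (p - 1) v (\<lambda>x. x) (chain_boundary p (frag_of (id_simplex p)))"
    and c: "singular_chain p X c"
  shows "chain_boundary (Suc p) (prism p w h c) =
           chain_map p (\<lambda>x. h (1, x)) c - chain_map p (\<lambda>x. h (0, x)) c - prism (p - 1) v h (chain_boundary p c)"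
  using c unfolding singular_chain_def
proof (induction c rule: frag_induction)
  case (one \<sigma>)
  let ?h = "\<lambda>(t, x). h (t, \<sigma> x)"
  have e: "chain_map p ?h (frag_of (cylinder_end t p)) = chain_map p (\<lambda>x. h (t, x)) (frag_of \<sigma>)" for t
  proof -
    have "simplex_map p ?h (cylinder_end t p) = simplex_map p (\<lambda>x. h (t, x)) \<sigma>"
      by (auto simp: cylinder_end_def simplex_map_def restrict_def fun_eq_iff)
    then show ?thesis
      by simp
  qed
  have "prism (p - 1) v h (chain_boundary p (frag_of \<sigma>)) =
      prism (p - 1) v ?h (chain_boundary p (frag_of (id_simplex p)))"
  proof (cases "p = 0")
    case False
    \<comment> \<open>The identity simplex is universal: \<sigma> is its image under \<sigma>
      itself, read as a map out of the simplex.\<close>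
    have "frag_of \<sigma> = chain_map p \<sigma> (frag_of (id_simplex p))"
      using one by (simp add: singular_simplex_chain_map_id del: chain_map_of)
    then have "chain_boundary p (frag_of \<sigma>) = chain_map (p - 1) \<sigma> (chain_boundary p (frag_of (id_simplex p)))"
      using chain_boundary_chain_map [of p "simplex_space p" "frag_of (id_simplex p)" \<sigma>]
        singular_simplex_id_simplex by (simp add: singular_chain_of)
    then show ?thesis
      using False v by (simp add: prism_chain_map)
  qed (simp add: chain_boundary_def)
  moreover have "chain_map p ?h (prism (p - 1) v (\<lambda>x. x) (chain_boundary p (frag_of (id_simplex p)))) =
      prism (p - 1) v ?h (chain_boundary p (frag_of (id_simplex p)))"
  proof (cases "p = 0")
    case False
    then show ?thesis
      using chain_map_prism [of "p - 1" ?h v "\<lambda>x. x"] by (simp add: o_def)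
  qed (simp add: chain_boundary_def)
  ultimately show ?case
    using chain_boundary_chain_map [OF w, of ?h] by (simp add: prism_of dw chain_map_diff e del: chain_map_of)
next
  case (diff a b)
  then show ?case
    by (simp add: prism_diff chain_boundary_diff chain_map_diff)
qed (simp_all)

text \<open>Recursion on the degree: by the identity one degree lower the prescribed boundary is a
  cycle, and in the contractible cylinder it bounds some chain, which is taken as
  \<open>P p\<close>.\<close>

lemma universal_prism_exists:
  obtains P where
    "\<And>p. singular_chain (Suc p) (cylinder (simplex_space p)) (P p)"
    "\<And>p. chain_boundary (Suc p) (P p) = frag_of (cylinder_end 1 p) - frag_of (cylinder_end 0 p)
            - prism (p - 1) (P (p - 1)) (\<lambda>x. x) (chain_boundary p (frag_of (id_simplex p)))"
proof -
  let ?C = "\<lambda>p. cylinder (simplex_space p)"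
  let ?I = "\<lambda>p. frag_of (id_simplex p)"
  let ?E = "\<lambda>p. frag_of (cylinder_end 1 p) - frag_of (cylinder_end 0 p)"
  define Q where "Q p v w \<longleftrightarrow> chain_boundary (Suc (Suc p)) w = ?E (Suc p) - prism p v (\<lambda>x. x) (chain_boundary (Suc p) (?I (Suc p)))"
    for p v w
  \<comment> \<open>The recursion carries the prism identity only for cycles in the next simplex,
    where the lower prism term is absent. This suffices, because it is applied to the boundary of
    the identity simplex, which is a cycle.\<close>
  define A where "A p w \<longleftrightarrow> singular_chain (Suc p) (?C p) w \<and>
      (p = 0 \<longrightarrow> chain_boundary (Suc 0) w = ?E 0) \<and>
      (\<forall>y. singular_chain p (simplex_space (Suc p)) y \<and> chain_boundary p y = 0 \<longrightarrow>
        chain_boundary (Suc p) (prism p w (\<lambda>x. x) y) = chain_map p (Pair 1) y - chain_map p (Pair 0) y)" for p w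
  have E: "singular_chain p (?C p) (?E p)" for p
    by (intro singular_chain_diff) (auto simp: singular_chain_of intro!: singular_simplex_cylinder_end)
  have "\<exists>P. \<forall>p. A p (P p) \<and> Q p (P p) (P (Suc p))"
  proof (rule dependent_nat_choice)
    \<comment> \<open>A constant map sends both ends to the same 0-simplex, so their difference
      satisfies the condition in degree 0.\<close>
    have "chain_map 0 (\<lambda>_. a) (?E 0) = 0" for a :: "real \<times> (nat \<Rightarrow> real)"
      by (simp add: chain_map_diff cylinder_end_def simplex_map_def restrict_def cong: if_cong)
    then obtain w where w: "singular_chain (Suc 0) (?C 0) w" "chain_boundary (Suc 0) w = ?E 0"
      using cycle_boundary_contractible [OF contractible_cylinder_simplex_space E, of 0]
      by (metis chain_boundary_def)
    have "A 0 w"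
      using w chain_boundary_prism [where p = 0 and w = w and v = w and X = "simplex_space (Suc 0)" and h = "\<lambda>x. x"]
      by (simp add: A_def chain_boundary_def [of 0])
    then show "\<exists>w. A 0 w" ..
  next
    fix v p
    assume A: "A p v"
    let ?B = "chain_boundary (Suc p) (?I (Suc p))"
    define z where "z = ?E (Suc p) - prism p v (\<lambda>x. x) ?B"
    have v: "singular_chain (Suc p) (?C p) v"
      using A by (simp add: A_def)
    have I: "singular_chain (Suc p) (simplex_space (Suc p)) (?I (Suc p))"
      by (simp add: singular_chain_of singular_simplex_id_simplex)
    have B: "singular_chain p (simplex_space (Suc p)) ?B" "chain_boundary p ?B = 0"
      using singular_chain_boundary_alt [OF I] chain_boundary_boundary_alt [OF I] by auto
    have e: "chain_boundary (Suc p) (frag_of (cylinder_end t (Suc p))) = chain_map p (Pair t) ?B" for t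
      using chain_boundary_chain_map [OF I, of "Pair t"] by (simp add: cylinder_end_def)
    \<comment> \<open>By \<open>A\<close> the prism over \<open>?B\<close> has as boundary the
      difference of the two copies of \<open>?B\<close> at heights 1 and 0, which is also the
      boundary of the two ends.\<close>
    have "chain_boundary (Suc p) z = 0"
      using A B by (simp add: z_def A_def chain_boundary_diff e)
    moreover have "singular_chain (Suc p) (?C (Suc p)) z"
      unfolding z_def by (intro singular_chain_diff [OF E] singular_chain_prism [OF v _ B(1)]) simp
    ultimately obtain w where w: "singular_chain (Suc (Suc p)) (?C (Suc p)) w" "chain_boundary (Suc (Suc p)) w = z"
      using cycle_boundary_contractible [OF contractible_cylinder_simplex_space] by blast
    have "A (Suc p) w \<and> Q p v w"
      using w v chain_boundary_prism [where p = "Suc p" and w = w and v = v and X = "simplex_space (Suc (Suc p))" and h = "\<lambda>x. x"]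
      by (simp add: A_def Q_def z_def)
    then show "\<exists>w. A (Suc p) w \<and> Q p v w" ..
  qed
  then obtain P where P: "\<And>p. A p (P p)" "\<And>p. Q p (P p) (P (Suc p))"
    by blast
  show thesis
  proof
    fix p
    show "singular_chain (Suc p) (?C p) (P p)"
      using P(1) [of p] by (simp add: A_def)
    show "chain_boundary (Suc p) (P p) = ?E p - prism (p - 1) (P (p - 1)) (\<lambda>x. x) (chain_boundary p (?I p))"
    proof (cases p)
      case 0
      then show ?thesis
        using P(1) [of 0] by (simp add: A_def chain_boundary_def [of 0])
    next
      case (Suc q)
      then show ?thesis
        using P(2) [of q] by (simp add: Q_def)
    qed
  qed
qed

text \<open>The transpose of an operator \<open>d\<close> that raises the degree of chains by one;
  it lowers the degree of cochains. It serves both the prism operator and the contraction modulo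
  small chains.\<close>

definition cochain_shift ::
    "'a topology \<Rightarrow> (nat \<Rightarrow> ((nat \<Rightarrow> real) \<Rightarrow> 'a) \<Rightarrow> 'b chain) \<Rightarrow> ('b, 'r::{ring,monoid_mult}) cochains \<Rightarrow> ('a, 'r) cochains" where
  "cochain_shift X d c n \<sigma> = (if singular_simplex n X \<sigma> then chain_eval (c (Suc n)) (d n \<sigma>) else 0)"

lemma singular_cochains_shift:
  assumes "c \<in> singular_cochains Y"
  shows "cochain_shift X d c \<in> singular_cochains X"
proof (rule singular_cochainsI)
  show "{n. \<exists>\<sigma>. cochain_shift X d c n \<sigma> \<noteq> 0} \<subseteq> Suc -` {n. \<exists>\<sigma>. c n \<sigma> \<noteq> 0}"
    by (auto simp: cochain_shift_def split: if_splits) (metis chain_eval_zero)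
  show "finite (Suc -` {n. \<exists>\<sigma>. c n \<sigma> \<noteq> 0})"
    by (rule finite_vimageI) (use assms in \<open>simp_all add: singular_cochains_def\<close>)
qed (simp add: cochain_shift_def)

lemma coboundary_shift:
  assumes "singular_simplex (Suc n) X \<sigma>"
  shows "coboundary X (cochain_shift X d c) (Suc n) \<sigma> =
           chain_eval (c (Suc n)) (frag_extend (d n) (chain_boundary (Suc n) (frag_of \<sigma>)))"
proof -
  have "chain_eval (cochain_shift X d c n) x = chain_eval (c (Suc n)) (frag_extend (d n) x)"
    if "singular_chain n X x" for x
    using that unfolding singular_chain_def
    by (induction x rule: frag_induction) (auto simp: cochain_shift_def chain_eval_diff frag_extend_diff)
  then show ?thesis
    using assms by (simp add: coboundary_eq_chain_eval singular_chain_boundary_alt singular_chain_of)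
qed

lemma cocycle_eval_boundary:
  assumes "coboundary Y c = (\<lambda>n \<sigma>. 0)" "singular_chain (Suc n) Y x"
  shows "chain_eval (c n) (chain_boundary (Suc n) x) = 0"
  using chain_eval_coboundary [OF assms(2), of c] assms(1) by (simp add: chain_eval_zero)

text \<open>A cocycle evaluates to zero on the boundary of a prism. Evaluated on the prism identity
  it leaves the difference of the pullbacks equal to the coboundary of the transposed prism
  operator.\<close>

theorem homotopic_pullback:
  assumes h: "homotopic_with (\<lambda>h. True) X Y f g" and c: "c \<in> carrier (cocycle_ring R Y)"
  shows "(\<lambda>n \<sigma>. cochain_pullback X g c n \<sigma> - cochain_pullback X f c n \<sigma>) \<in> coboundaries R X"
proof -
  obtain h where conth: "continuous_map (cylinder X) Y h"
    and h0: "\<And>x. h (0, x) = f x" and h1: "\<And>x. h (1, x) = g x"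
    using h by (auto simp: homotopic_with_def)
  obtain P where P: "\<And>p. singular_chain (Suc p) (cylinder (simplex_space p)) (P p)"
    "\<And>p. chain_boundary (Suc p) (P p) = frag_of (cylinder_end 1 p) - frag_of (cylinder_end 0 p)
            - prism (p - 1) (P (p - 1)) (\<lambda>x. x) (chain_boundary p (frag_of (id_simplex p)))"
    by (rule universal_prism_exists) blast
  define d where "d n \<sigma> = chain_map (Suc n) (\<lambda>(t, x). h (t, \<sigma> x)) (P n)" for n \<sigma>
  have d: "frag_extend (d n) x = prism n (P n) h x" for n x
    by (simp add: prism_def d_def [abs_def])
  have c': "c \<in> singular_cochains Y" "coboundary Y c = (\<lambda>n \<sigma>. 0)"
    using c by (auto simp: cocycle_ring_simps)
  have "(\<lambda>n \<sigma>. cochain_pullback X g c n \<sigma> - cochain_pullback X f c n \<sigma>) = coboundary X (cochain_shift X d c)"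
  proof (intro ext)
    fix n \<sigma>
    show "cochain_pullback X g c n \<sigma> - cochain_pullback X f c n \<sigma> = coboundary X (cochain_shift X d c) n \<sigma>"
    proof (cases "singular_simplex n X \<sigma>")
      case \<sigma>: True
      have ch: "singular_chain n X (frag_of \<sigma>)"
        using \<sigma> by (simp add: singular_chain_of)
      have "chain_boundary (Suc n) (prism n (P n) h (frag_of \<sigma>)) =
          chain_map n g (frag_of \<sigma>) - chain_map n f (frag_of \<sigma>) - prism (n - 1) (P (n - 1)) h (chain_boundary n (frag_of \<sigma>))"
        using chain_boundary_prism [OF P(1) _ P(2) ch, of h] P(1) [of "n - 1"] by (cases n) (simp_all add: h0 h1)
      moreover have "chain_eval (c n) (chain_boundary (Suc n) (prism n (P n) h (frag_of \<sigma>))) = 0"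
        by (rule cocycle_eval_boundary [OF c'(2) singular_chain_prism [OF P(1) conth ch]])
      ultimately have "cochain_pullback X g c n \<sigma> - cochain_pullback X f c n \<sigma> =
          chain_eval (c n) (prism (n - 1) (P (n - 1)) h (chain_boundary n (frag_of \<sigma>)))"
        using \<sigma> by (simp add: chain_eval_diff cochain_pullback_def)
      also have "\<dots> = coboundary X (cochain_shift X d c) n \<sigma>"
        using \<sigma> by (cases n) (simp_all add: chain_boundary_def [of 0] coboundary_shift d)
      finally show ?thesis .
    qed (simp add: cochain_pullback_def coboundary_def)
  qed
  then show ?thesis
    using singular_cochains_shift [OF c'(1)] by (auto simp: coboundaries_def)
qed


section \<open>Products of classes vanishing on the members of an open cover\<close>

definition small_chain :: "'a topology \<Rightarrow> 'a set set \<Rightarrow> nat \<Rightarrow> 'a chain \<Rightarrow> bool" where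
  "small_chain X \<C> p c \<longleftrightarrow> Poly_Mapping.keys c \<subseteq> {\<sigma>. \<exists>V\<in>\<C>. singular_simplex p (subtopology X V) \<sigma>}"

lemma small_chain_0 [simp]: "small_chain X \<C> p 0"
  by (simp add: small_chain_def)

lemma small_chain_diff: "small_chain X \<C> p a \<Longrightarrow> small_chain X \<C> p b \<Longrightarrow> small_chain X \<C> p (a - b)"
  using keys_diff [of a b] unfolding small_chain_def by blast

lemma small_chainI: "singular_chain p (subtopology X V) c \<Longrightarrow> V \<in> \<C> \<Longrightarrow> small_chain X \<C> p c"
  by (auto simp: small_chain_def singular_chain_def)

text \<open>This is acyclicity of the chains modulo small chains. With \<open>h\<close> a chain
  homotopy from the identity to an iterated subdivision fine enough for \<open>z\<close>, the chain
  \<open>z\<close> is the subdivision of \<open>z\<close>, minus \<open>h\<close> of its boundary,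
  minus the boundary of \<open>h p z\<close>; the first two are small.\<close>

lemma small_chain_modulo_boundary:
  assumes \<C>: "\<And>U. U \<in> \<C> \<Longrightarrow> openin X U" "topspace X \<subseteq> \<Union>\<C>"
    and z: "singular_chain p X z" "small_chain X \<C> (p - 1) (chain_boundary p z)"
  obtains w where "singular_chain (Suc p) X w" "small_chain X \<C> p (z - chain_boundary (Suc p) w)"
proof -
  obtain n where n: "\<And>m f. n \<le> m \<Longrightarrow> f \<in> Poly_Mapping.keys ((singular_subdivision p ^^ m) z)
                      \<Longrightarrow> \<exists>V \<in> \<C>. f \<in> (standard_simplex p) \<rightarrow> V"
    using sufficient_iterated_singular_subdivision_exists [OF \<C> z(1)] by blast
  have "singular_chain p X ((singular_subdivision p ^^ m) z)" for m
    by (induction m) (auto simp: singular_chain_singular_subdivision z)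
  then have sub: "small_chain X \<C> p ((singular_subdivision p ^^ n) z)"
    using n [OF order_refl]
    by (fastforce simp: small_chain_def singular_chain_def singular_simplex_subtopology image_subset_iff Pi_iff)
  \<comment> \<open>The same \<open>h\<close> serves all topologies on the type, hence maps chains
    of each member of the cover to chains of that member and preserves smallness.\<close>
  obtain h where h: "\<And>p. h p 0 = (0 :: 'a chain)"
        "\<And>p c1 c2. h p (c1-c2) = h p c1 - h p c2"
        "\<And>p X c. singular_chain p X c \<Longrightarrow> singular_chain (Suc p) X (h p c)"
        "\<And>p X c. singular_chain p X c
                 \<Longrightarrow> chain_boundary (Suc p) (h p c) + h (p - Suc 0) (chain_boundary p c)
                   = (singular_subdivision p ^^ n) c - c"
    by (rule chain_homotopic_iterated_singular_subdivision) blast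
  have hsmall: "small_chain X \<C> (Suc q) (h q c)" if "small_chain X \<C> q c" for q c
    using that unfolding small_chain_def [of _ _ _ c]
  proof (induction c rule: frag_induction)
    case (one \<sigma>)
    then obtain V where "V \<in> \<C>" "singular_chain q (subtopology X V) (frag_of \<sigma>)"
      by (auto simp: singular_chain_of)
    then show ?case
      using h(3) small_chainI by blast
  qed (simp_all add: h small_chain_diff)
  have hb: "small_chain X \<C> p (h (p - 1) (chain_boundary p z))"
    using hsmall [OF z(2)] by (cases p) (simp_all add: chain_boundary_def [of 0] h)
  show thesis
  proof
    \<comment> \<open>The minus sign comes from the direction of the homotopy, whose identity has
      subdivision minus identity on the right.\<close>
    show "singular_chain (Suc p) X (- h p z)"
      using h(3) [OF z(1)] by (simp add: singular_chain_minus)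
    have "z - chain_boundary (Suc p) (- h p z) = (singular_subdivision p ^^ n) z - h (p - 1) (chain_boundary p z)"
      using h(4) [OF z(1)] by (simp add: chain_boundary_minus algebra_simps)
    then show "small_chain X \<C> p (z - chain_boundary (Suc p) (- h p z))"
      using sub hb by (simp add: small_chain_diff)
  qed
qed

text \<open>The quotient of the singular chains by the small ones is free and acyclic, hence contractible:
  a contraction is defined on the basis by recursion on the degree.\<close>

lemma small_chain_contraction:
  assumes \<C>: "\<And>U. U \<in> \<C> \<Longrightarrow> openin X U" "topspace X \<subseteq> \<Union>\<C>"
  obtains d where
    "\<And>p \<sigma>. singular_simplex p X \<sigma> \<Longrightarrow> singular_chain (Suc p) X (d p \<sigma>)"
    "\<And>p \<sigma>. singular_simplex p X \<sigma> \<Longrightarrow>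
      small_chain X \<C> p (frag_of \<sigma> - frag_extend (d (p - 1)) (chain_boundary p (frag_of \<sigma>))
                              - chain_boundary (Suc p) (d p \<sigma>))"
proof -
  \<comment> \<open>As in the prism construction, the recursion needs the contraction identity only
    on cycles, since it is applied to the boundary of a simplex.\<close>
  define A where "A p d \<longleftrightarrow> (\<forall>\<sigma>. singular_simplex p X \<sigma> \<longrightarrow> singular_chain (Suc p) X (d \<sigma>)) \<and>
      (\<forall>y. singular_chain p X y \<and> chain_boundary p y = 0 \<longrightarrow>
        small_chain X \<C> p (y - chain_boundary (Suc p) (frag_extend d y)))" for p d
  define Q where "Q p d e \<longleftrightarrow> (\<forall>\<sigma>. singular_simplex (Suc p) X \<sigma> \<longrightarrow>
      small_chain X \<C> (Suc p) (frag_of \<sigma> - frag_extend d (chain_boundary (Suc p) (frag_of \<sigma>))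
                              - chain_boundary (Suc (Suc p)) (e \<sigma>)))" for p d e
  \<comment> \<open>A 0-simplex is a point and lies in a member of the cover. So every chain in
    degree 0 is small, and the recursion can start with the zero operator.\<close>
  have vertex: "small_chain X \<C> 0 y" if "singular_chain 0 X y" for y
    unfolding small_chain_def
  proof
    fix \<sigma> assume "\<sigma> \<in> Poly_Mapping.keys y"
    then have \<sigma>: "singular_simplex 0 X \<sigma>"
      using that by (auto simp: singular_chain_def)
    let ?v = "\<lambda>j::nat. if j = 0 then 1 else 0 :: real"
    have "\<sigma> ?v \<in> topspace X"
      using \<sigma> by (auto simp: singular_simplex_iff continuous_map_def Pi_iff standard_simplex_0)
    then obtain V where "V \<in> \<C>" "\<sigma> ?v \<in> V"
      using \<C> by blast
    then show "\<sigma> \<in> {\<sigma>. \<exists>V\<in>\<C>. singular_simplex 0 (subtopology X V) \<sigma>}"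
      using \<sigma> by (auto simp: singular_simplex_subtopology standard_simplex_0)
  qed
  have "\<exists>d. \<forall>p. A p (d p) \<and> Q p (d p) (d (Suc p))"
  proof (rule dependent_nat_choice)
    have "A 0 (\<lambda>\<sigma>. 0)"
      using vertex by (simp add: A_def frag_extend_eq_0)
    then show "\<exists>d. A 0 d"
      by (rule exI [where x = "\<lambda>\<sigma>. 0"])
  next
    fix d p
    assume A: "A p d"
    let ?z = "\<lambda>\<sigma>. frag_of \<sigma> - frag_extend d (chain_boundary (Suc p) (frag_of \<sigma>))"
    have "\<exists>w. singular_chain (Suc (Suc p)) X w \<and> small_chain X \<C> (Suc p) (?z \<sigma> - chain_boundary (Suc (Suc p)) w)"
      if "singular_simplex (Suc p) X \<sigma>" for \<sigma>
    proof -
      have \<sigma>: "singular_chain (Suc p) X (frag_of \<sigma>)"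
        using that by (simp add: singular_chain_of)
      have b: "singular_chain p X (chain_boundary (Suc p) (frag_of \<sigma>))"
          "chain_boundary p (chain_boundary (Suc p) (frag_of \<sigma>)) = 0"
        using singular_chain_boundary_alt [OF \<sigma>] chain_boundary_boundary_alt [OF \<sigma>] by auto
      have "singular_chain (Suc p) X (?z \<sigma>)"
        using A b(1) by (intro singular_chain_diff [OF \<sigma>] singular_chain_extend) (auto simp: A_def singular_chain_def)
      \<comment> \<open>The boundary of \<open>?z \<sigma>\<close> is b minus the boundary of d(b),
        where b is the boundary of \<sigma>; as b is a cycle, \<open>A\<close> says that this is
        small.\<close>
      moreover have "small_chain X \<C> (Suc p - 1) (chain_boundary (Suc p) (?z \<sigma>))"
        using A b by (simp add: A_def chain_boundary_diff)
      ultimately show ?thesis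
        using small_chain_modulo_boundary [OF \<C>, of "Suc p" "?z \<sigma>"] by blast
    qed
    then obtain e where e: "\<And>\<sigma>. singular_simplex (Suc p) X \<sigma> \<Longrightarrow> singular_chain (Suc (Suc p)) X (e \<sigma>)"
        "\<And>\<sigma>. singular_simplex (Suc p) X \<sigma> \<Longrightarrow> small_chain X \<C> (Suc p) (?z \<sigma> - chain_boundary (Suc (Suc p)) (e \<sigma>))"
      by metis
    have "small_chain X \<C> (Suc p) (y - frag_extend d (chain_boundary (Suc p) y) - chain_boundary (Suc (Suc p)) (frag_extend e y))"
      if "singular_chain (Suc p) X y" for y
      using that unfolding singular_chain_def
    proof (induction y rule: frag_induction)
      case (diff a b)
      have "a - b - frag_extend d (chain_boundary (Suc p) (a - b)) - chain_boundary (Suc (Suc p)) (frag_extend e (a - b))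
        = (a - frag_extend d (chain_boundary (Suc p) a) - chain_boundary (Suc (Suc p)) (frag_extend e a))
        - (b - frag_extend d (chain_boundary (Suc p) b) - chain_boundary (Suc (Suc p)) (frag_extend e b))"
        by (simp add: chain_boundary_diff frag_extend_diff)
      then show ?case
        using small_chain_diff [OF diff] by (simp only:)
    qed (simp_all add: e)
    \<comment> \<open>On a cycle the middle term of the identity just shown is zero.\<close>
    then have "A (Suc p) e"
      using e(1) by (force simp: A_def)
    then show "\<exists>e. A (Suc p) e \<and> Q p d e"
      using e(2) by (auto simp: Q_def)
  qed
  then obtain d where d: "\<And>p. A p (d p)" "\<And>p. Q p (d p) (d (Suc p))"
    by blast
  show thesis
  proof
    fix p \<sigma>
    assume \<sigma>: "singular_simplex p X \<sigma>"
    show ch: "singular_chain (Suc p) X (d p \<sigma>)"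
      using d(1) [of p] \<sigma> by (simp add: A_def)
    show "small_chain X \<C> p (frag_of \<sigma> - frag_extend (d (p - 1)) (chain_boundary p (frag_of \<sigma>))
                              - chain_boundary (Suc p) (d p \<sigma>))"
    proof (cases p)
      case 0
      then show ?thesis
        using \<sigma> singular_chain_boundary_alt [OF ch]
        by (simp add: chain_boundary_def [of 0] singular_chain_diff singular_chain_of vertex)
    next
      case (Suc q)
      then show ?thesis
        using d(2) [of q] \<sigma> by (simp add: Q_def)
    qed
  qed
qed

text \<open>The cocycle is zero on small chains and on boundaries, so the contraction identity for a
  simplex reduces to: its value is that of \<open>c\<close> on \<open>d\<close> applied to the
  boundary of the simplex. Hence \<open>c\<close> is the coboundary of its transpose under
  \<open>d\<close>.\<close>

theorem cocycle_vanishing_on_small_simplices: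
  assumes \<C>: "\<And>U. U \<in> \<C> \<Longrightarrow> openin X U" "topspace X \<subseteq> \<Union>\<C>"
    and c: "c \<in> carrier (cocycle_ring R X)"
    and 0: "\<And>n \<sigma> V. V \<in> \<C> \<Longrightarrow> singular_simplex n (subtopology X V) \<sigma> \<Longrightarrow> c n \<sigma> = 0"
  shows "c \<in> coboundaries R X"
proof -
  obtain d where d: "\<And>p \<sigma>. singular_simplex p X \<sigma> \<Longrightarrow> singular_chain (Suc p) X (d p \<sigma>)"
    "\<And>p \<sigma>. singular_simplex p X \<sigma> \<Longrightarrow>
      small_chain X \<C> p (frag_of \<sigma> - frag_extend (d (p - 1)) (chain_boundary p (frag_of \<sigma>))
                              - chain_boundary (Suc p) (d p \<sigma>))"
    using small_chain_contraction [OF \<C>] by blast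
  have c': "c \<in> singular_cochains X" "coboundary X c = (\<lambda>n \<sigma>. 0)"
    using c by (auto simp: cocycle_ring_simps)
  have "c = coboundary X (cochain_shift X d c)"
  proof (intro ext)
    fix n \<sigma>
    show "c n \<sigma> = coboundary X (cochain_shift X d c) n \<sigma>"
    proof (cases "singular_simplex n X \<sigma>")
      case \<sigma>: True
      have "chain_eval (c n) (frag_of \<sigma> - frag_extend (d (n - 1)) (chain_boundary n (frag_of \<sigma>))
                              - chain_boundary (Suc n) (d n \<sigma>)) = 0"
        using d(2) [OF \<sigma>] 0 by (intro chain_eval_zero) (auto simp: small_chain_def)
      moreover have "chain_eval (c n) (chain_boundary (Suc n) (d n \<sigma>)) = 0"
        by (rule cocycle_eval_boundary [OF c'(2) d(1) [OF \<sigma>]])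
      ultimately have "c n \<sigma> = chain_eval (c n) (frag_extend (d (n - 1)) (chain_boundary n (frag_of \<sigma>)))"
        by (simp add: chain_eval_diff)
      also have "\<dots> = coboundary X (cochain_shift X d c) n \<sigma>"
        using \<sigma> by (cases n) (simp_all add: chain_boundary_def [of 0] coboundary_shift)
      finally show ?thesis .
    next
      case False
      then show ?thesis
        using c' by (simp add: singular_cochains_def coboundary_def)
    qed
  qed
  then show ?thesis
    using singular_cochains_shift [OF c'(1), of X d] unfolding coboundaries_def by blast
qed

section \<open>Cup products of cocycles that are exact on open sets\<close>

abbreviation cochain_restrict :: "'a topology \<Rightarrow> 'a set \<Rightarrow> ('a, 'r::{ring,monoid_mult}) cochains \<Rightarrow> ('a, 'r) cochains" where
  "cochain_restrict X S \<equiv> cochain_pullback (subtopology X S) (\<lambda>x. x)"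

lemma continuous_map_subtopology_inclusion:
  "continuous_map (subtopology X S) X (\<lambda>x. x)"
  "T \<subseteq> S \<Longrightarrow> continuous_map (subtopology X T) (subtopology X S) (\<lambda>x. x)"
  by (auto simp: continuous_map_in_subtopology continuous_map_from_subtopology)

lemma cochain_restrict_simplex:
  "singular_simplex n (subtopology X S) \<sigma> \<Longrightarrow> cochain_restrict X S c n \<sigma> = c n \<sigma>"
  by (simp add: cochain_pullback_def simplex_map_id_gen)

lemma cochain_restrict_restrict:
  "T \<subseteq> S \<Longrightarrow> cochain_pullback (subtopology X T) (\<lambda>x. x) (cochain_restrict X S c) = cochain_restrict X T c"
  using cochain_pullback_compose [OF continuous_map_subtopology_inclusion(2), of T S X "\<lambda>x. x" c]
  by (simp add: o_def)

text \<open>A primitive of the restriction is extended by zero to all simplices of \<open>X\<close>,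
  and its coboundary is subtracted from \<open>c\<close>.\<close>

lemma cohomologous_vanishing_cocycle:
  assumes c: "c \<in> carrier (cocycle_ring R X)" and S: "cochain_restrict X S c \<in> coboundaries R (subtopology X S)"
  obtains c' where "c' \<in> carrier (cocycle_ring R X)" "cohomology_class R X c' = cohomology_class R X c"
    "\<And>n \<sigma>. singular_simplex n (subtopology X S) \<sigma> \<Longrightarrow> c' n \<sigma> = 0"
proof -
  obtain a where a: "a \<in> singular_cochains (subtopology X S)" "cochain_restrict X S c = coboundary (subtopology X S) a"
    using S by (auto simp: coboundaries_def)
  \<comment> \<open>Cochains are total functions that are zero off the simplices of their space, so
    \<open>a\<close> is already its own extension by zero.\<close>
  have "a \<in> singular_cochains X"
    using a(1) by (auto simp: singular_cochains_def singular_simplex_subtopology)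
  then have b: "coboundary X a \<in> coboundaries R X"
    by (simp add: coboundaries_def)
  define c' where "c' = (\<lambda>n \<sigma>. c n \<sigma> - coboundary X a n \<sigma>)"
  have c': "c' \<in> carrier (cocycle_ring R X)"
    using c b coboundaries_subset [of R X]
    by (auto simp: c'_def cocycle_ring_simps singular_cochains_diff coboundary_diff)
  moreover have "cohomology_class R X c' = cohomology_class R X c"
    using coboundaries_minus [OF b] unfolding cohomology_class_eq_iff [OF c' c] by (simp add: c'_def)
  moreover have "c' n \<sigma> = 0" if \<sigma>: "singular_simplex n (subtopology X S) \<sigma>" for n \<sigma>
  proof -
    have "singular_simplex n X \<sigma>"
      using \<sigma> by (simp add: singular_simplex_subtopology)
    then have "coboundary X a n \<sigma> = coboundary (subtopology X S) a n \<sigma>"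
      using \<sigma> by (simp add: coboundary_def)
    also have "\<dots> = c n \<sigma>"
      using cochain_restrict_simplex [OF \<sigma>, of c] by (simp add: a(2))
    finally show ?thesis
      by (simp add: c'_def)
  qed
  ultimately show thesis
    using that by blast
qed

text \<open>With representatives that are zero on simplices in \<open>S\<close> and in
  \<open>T\<close>, every summand of the product has a zero factor: the front of a simplex in
  \<open>S\<close> stays in \<open>S\<close>, the back of one in \<open>T\<close> stays in
  \<open>T\<close>. Thus the product is zero on all simplices small for the cover by
  \<open>S\<close> and \<open>T\<close>.\<close>

lemma cup_product_vanishes_on_union:
  assumes S: "openin X S" "openin X T" "topspace X \<subseteq> S \<union> T"
    and a: "a \<in> carrier (cocycle_ring R X)" "cochain_restrict X S a \<in> coboundaries R (subtopology X S)"
    and b: "b \<in> carrier (cocycle_ring R X)" "cochain_restrict X T b \<in> coboundaries R (subtopology X T)"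
  shows "cup_product X a b \<in> coboundaries R X"
proof -
  interpret ring "cocycle_ring R X"
    by (rule ring_cocycle_ring)
  note hom = ring_hom_mult [OF cohomology_class_ring_hom, of _ R X]
  obtain a' where a': "a' \<in> carrier (cocycle_ring R X)" "cohomology_class R X a' = cohomology_class R X a"
      "\<And>n \<sigma>. singular_simplex n (subtopology X S) \<sigma> \<Longrightarrow> a' n \<sigma> = 0"
    using cohomologous_vanishing_cocycle [OF a] by blast
  obtain b' where b': "b' \<in> carrier (cocycle_ring R X)" "cohomology_class R X b' = cohomology_class R X b"
      "\<And>n \<sigma>. singular_simplex n (subtopology X T) \<sigma> \<Longrightarrow> b' n \<sigma> = 0"
    using cohomologous_vanishing_cocycle [OF b] by blast
  have cup: "cup_product X u v = u \<otimes>\<^bsub>cocycle_ring R X\<^esub> v" for u v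
    by (simp add: cocycle_ring_simps)
  have "cup_product X a' b' \<in> coboundaries R X"
  proof (rule cocycle_vanishing_on_small_simplices [where \<C> = "{S, T}"])
    show "cup_product X a' b' \<in> carrier (cocycle_ring R X)"
      using a' b' by (simp add: cup)
    fix n \<sigma> V
    assume "V \<in> {S, T}" and \<sigma>: "singular_simplex n (subtopology X V) \<sigma>"
    then consider "V = S" | "V = T"
      by auto
    then show "cup_product X a' b' n \<sigma> = 0"
    proof cases
      case 1
      then show ?thesis
        using singular_simplex_front_face [OF \<sigma>] by (simp add: cup_product_def a'(3))
    next
      case 2
      have "b' (n - p) (back_face p (n - p) \<sigma>) = 0" if "p \<le> n" for p
        using singular_simplex_back_face [of p "n - p" _ \<sigma>] \<sigma> that 2 by (intro b'(3)) simp
      then show ?thesis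
        by (simp add: cup_product_def)
    qed
  qed (use S in auto)
  then have "cohomology_class R X (cup_product X a' b') = \<zero>\<^bsub>singular_cohomology R X\<^esub>"
    using a' b' by (simp add: cohomology_class_eq_zero_iff cup)
  then have "cohomology_class R X (cup_product X a b) = \<zero>\<^bsub>singular_cohomology R X\<^esub>"
    using a b a' b' by (simp add: cup hom)
  then show ?thesis
    using a b by (simp add: cohomology_class_eq_zero_iff cup)
qed

definition cup_list :: "'r::{ring,monoid_mult} itself \<Rightarrow> 'a topology \<Rightarrow> ('a, 'r) cochains list \<Rightarrow> ('a, 'r) cochains" where
  "cup_list R X cs = foldr (\<lambda>x y. x \<otimes>\<^bsub>cocycle_ring R X\<^esub> y) cs \<one>\<^bsub>cocycle_ring R X\<^esub>"

lemma cup_list_simps [simp]: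
  "cup_list R X [] = \<one>\<^bsub>cocycle_ring R X\<^esub>"
  "cup_list R X (c # cs) = cup_product X c (cup_list R X cs)"
  by (simp_all add: cup_list_def cocycle_ring_simps)

lemma cup_list_carrier:
  assumes "set cs \<subseteq> carrier (cocycle_ring R X)"
  shows "cup_list R X cs \<in> carrier (cocycle_ring R X)"
proof -
  interpret ring "cocycle_ring R X"
    by (rule ring_cocycle_ring)
  have "cup_product X u v = u \<otimes>\<^bsub>cocycle_ring R X\<^esub> v" for u v
    by (simp add: cocycle_ring_simps)
  then show ?thesis
    using assms by (induction cs) simp_all
qed

theorem cup_list_vanishes_on_union:
  assumes "list_all2 (\<lambda>c S. c \<in> carrier (cocycle_ring R X) \<and> openin X S \<and>
             cochain_restrict X S c \<in> coboundaries R (subtopology X S)) cs Ss"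
  shows "cochain_restrict X (\<Union>(set Ss)) (cup_list R X cs) \<in> coboundaries R (subtopology X (\<Union>(set Ss)))"
  using assms
proof (induction cs Ss rule: list_all2_induct)
  case Nil
  \<comment> \<open>The empty product is the unit and the empty union has no simplices, so even the
    unit restricts to zero.\<close>
  have "\<not> singular_simplex n (subtopology X {}) \<sigma>" for n \<sigma>
    by (rule singular_simplex_empty) simp
  then have "cochain_restrict X {} \<one>\<^bsub>cocycle_ring R X\<^esub> = (\<lambda>n \<sigma>. 0)"
    by (intro ext) (simp add: cochain_pullback_def)
  then show ?case
    by (simp add: coboundaries_zero)
next
  case (Cons c cs S Ss)
  let ?T = "\<Union>(set Ss)"
  let ?Z = "subtopology X (S \<union> ?T)"
  have T: "openin X ?T"
    using Cons.hyps(2) by (intro openin_Union) (auto simp: list_all2_conv_all_nth in_set_conv_nth)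
  have cs: "cup_list R X cs \<in> carrier (cocycle_ring R X)"
    using Cons.hyps(2) by (intro cup_list_carrier) (auto simp: list_all2_conv_all_nth in_set_conv_nth)
  \<comment> \<open>The case of two sets requires that they cover the space; it is applied inside
    their union.\<close>
  have "cup_product ?Z (cochain_restrict X (S \<union> ?T) c) (cochain_restrict X (S \<union> ?T) (cup_list R X cs)) \<in> coboundaries R ?Z"
  proof (rule cup_product_vanishes_on_union)
    show "openin ?Z S" "openin ?Z ?T"
      using Cons.hyps(1) T by (auto simp: openin_subtopology)
    show "topspace ?Z \<subseteq> S \<union> ?T"
      by auto
    have "subtopology ?Z S = subtopology X S" "subtopology ?Z ?T = subtopology X ?T"
      by (simp_all add: subtopology_subtopology Int_absorb1)
    then show "cochain_restrict ?Z S (cochain_restrict X (S \<union> ?T) c) \<in> coboundaries R (subtopology ?Z S)"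
      "cochain_restrict ?Z ?T (cochain_restrict X (S \<union> ?T) (cup_list R X cs)) \<in> coboundaries R (subtopology ?Z ?T)"
      using Cons.hyps(1) Cons.IH by (simp_all add: cochain_restrict_restrict)
  qed (use Cons.hyps(1) cs in \<open>auto intro: cocycle_pullback continuous_map_subtopology_inclusion\<close>)
  then show ?case
    by (simp add: cup_product_pullback continuous_map_subtopology_inclusion)
qed


section \<open>Retracts of open subsets of a Euclidean space\<close>

text \<open>Replacing Euclidean spaces by the space of all real sequences makes products easy, and nothing
  below uses finite-dimensionality.\<close>

definition open_retract :: "'a topology \<Rightarrow> bool" where
  "open_retract E \<longleftrightarrow> (\<exists>U i r. openin (powertop_real (UNIV :: nat set)) U \<and>
      continuous_map E (subtopology (powertop_real UNIV) U) i \<and>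
      continuous_map (subtopology (powertop_real UNIV) U) E r \<and> (\<forall>x\<in>topspace E. r (i x) = x))"

lemma ENR_space_imp_open_retract:
  assumes "ENR_space E"
  shows "open_retract E"
proof -
  let ?R = "powertop_real (UNIV :: nat set)"
  obtain n U S where U: "openin (Euclidean_space n) U"
    and S: "S retract_of_space (subtopology (Euclidean_space n) U)"
    and E: "E homeomorphic_space (subtopology (Euclidean_space n) S)"
    using assms by (auto simp: ENR_space_def)
  obtain f g where fg: "continuous_map E (subtopology (Euclidean_space n) S) f"
      "continuous_map (subtopology (Euclidean_space n) S) E g" "\<And>x. x \<in> topspace E \<Longrightarrow> g (f x) = x"
    using E by (auto simp: homeomorphic_space_def homeomorphic_maps_def)
  obtain r where SU: "S \<subseteq> topspace (subtopology (Euclidean_space n) U)"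
    and r: "continuous_map (subtopology (Euclidean_space n) U) (subtopology (subtopology (Euclidean_space n) U) S) r"
      "\<And>x. x \<in> S \<Longrightarrow> r x = x"
    using S by (auto simp: retract_of_space_def)
  \<comment> \<open>\<open>Euclidean_space n\<close> consists of the sequences that vanish from
    index \<open>n\<close> on, and truncation retracts all sequences onto it. The preimage of
    \<open>U\<close> is the required open set.\<close>
  define tr where "tr x = (\<lambda>i. if i < n then x i else 0)" for x :: "nat \<Rightarrow> real"
  have tr: "continuous_map ?R (Euclidean_space n) tr"
    unfolding tr_def continuous_map_componentwise_Euclidean_space
    by (auto intro: continuous_map_product_projection)
  have tr_id: "tr x = x" if "x \<in> topspace (Euclidean_space n)" for x
    using that by (auto simp: tr_def topspace_Euclidean_space)
  define U' where "U' = {x \<in> topspace ?R. tr x \<in> U}"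
  have sub: "subtopology (subtopology (Euclidean_space n) U) S = subtopology (Euclidean_space n) S"
    using SU by (simp add: subtopology_subtopology Int_absorb1)
  show ?thesis
    unfolding open_retract_def
  proof (intro exI conjI ballI)
    show "openin ?R U'"
      unfolding U'_def by (rule openin_continuous_map_preimage [OF tr U])
    have f: "continuous_map E (Euclidean_space n) f" "f \<in> topspace E \<rightarrow> S"
      using fg(1) by (auto simp: continuous_map_in_subtopology)
    then have "continuous_map E ?R f"
      by (simp add: Euclidean_space_def continuous_map_in_subtopology)
    moreover have "f x \<in> U'" if "x \<in> topspace E" for x
    proof -
      have "f x \<in> S"
        using f(2) that by auto
      then have "f x \<in> topspace (Euclidean_space n)" "f x \<in> U"
        using SU by auto
      then show ?thesis
        by (simp add: U'_def tr_id)
    qed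
    ultimately show "continuous_map E (subtopology ?R U') f"
      by (auto simp: continuous_map_in_subtopology)
    have "continuous_map (subtopology ?R U') (subtopology (Euclidean_space n) U) tr"
      using tr by (auto simp: continuous_map_in_subtopology continuous_map_from_subtopology U'_def)
    then show "continuous_map (subtopology ?R U') E (g \<circ> (r \<circ> tr))"
      using r(1) fg(2) by (metis continuous_map_compose sub)
    show "(g \<circ> (r \<circ> tr)) (f x) = x" if "x \<in> topspace E" for x
    proof -
      have "f x \<in> S"
        using f(2) that by auto
      moreover from this have "f x \<in> topspace (Euclidean_space n)"
        using SU by auto
      ultimately show ?thesis
        using r(2) fg(3) that by (simp add: tr_id)
    qed
  qed
qed

text \<open>Metrizability passes to subspaces and to products with an interval, which normality
  alone does not; it supplies the normality for Tietze's theorem in both places.\<close>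

lemma open_retract_imp_metrizable:
  assumes "open_retract E"
  shows "metrizable_space E"
proof -
  obtain U i r where "continuous_map E (subtopology (powertop_real (UNIV :: nat set)) U) i"
      "continuous_map (subtopology (powertop_real UNIV) U) E r" "\<forall>x\<in>topspace E. r (i x) = x"
    using assms by (auto simp: open_retract_def)
  then have "retraction_map (subtopology (powertop_real UNIV) U) E r"
    by (auto simp: retraction_map_def retraction_maps_def)
  moreover have "metrizable_space (powertop_real (UNIV :: nat set))"
    by (simp add: euclidean_product_topology metrizable_space_euclidean)
  ultimately show ?thesis
    using metrizable_space_retraction_map_image metrizable_space_subtopology by blast
qed

lemma open_retract_open_subset:
  assumes "open_retract E" "openin E V"
  shows "open_retract (subtopology E V)"
proof -
  let ?R = "powertop_real (UNIV :: nat set)"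
  obtain U i r where U: "openin ?R U" and i: "continuous_map E (subtopology ?R U) i"
      and r: "continuous_map (subtopology ?R U) E r" and ri: "\<And>x. x \<in> topspace E \<Longrightarrow> r (i x) = x"
    using assms by (auto simp: open_retract_def)
  define U' where "U' = {x \<in> topspace (subtopology ?R U). r x \<in> V}"
  have U': "U' \<subseteq> U"
    by (auto simp: U'_def)
  show ?thesis
    unfolding open_retract_def
  proof (intro exI conjI ballI)
    have "openin (subtopology ?R U) U'"
      unfolding U'_def by (rule openin_continuous_map_preimage [OF r assms(2)])
    then show "openin ?R U'"
      using U by (rule openin_trans_full)
    have i': "continuous_map E ?R i" "i \<in> topspace E \<rightarrow> U"
      using i by (auto simp: continuous_map_in_subtopology)
    then show "continuous_map (subtopology E V) (subtopology ?R U') i"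
      using ri by (auto simp: continuous_map_in_subtopology continuous_map_from_subtopology U'_def)
    have "continuous_map (subtopology ?R U') E r"
      by (rule continuous_map_from_subtopology_mono [OF r U'])
    then show "continuous_map (subtopology ?R U') (subtopology E V) r"
      by (auto simp: continuous_map_in_subtopology U'_def)
    show "r (i x) = x" if "x \<in> topspace (subtopology E V)" for x
      using that ri by simp
  qed
qed

lemma open_retract_prod:
  assumes "open_retract E" "open_retract E'"
  shows "open_retract (prod_topology E E')"
proof -
  let ?R = "powertop_real (UNIV :: nat set)"
  obtain U i r where U: "openin ?R U" and i: "continuous_map E (subtopology ?R U) i"
      and r: "continuous_map (subtopology ?R U) E r" and ri: "\<And>x. x \<in> topspace E \<Longrightarrow> r (i x) = x"
    using assms(1) by (auto simp: open_retract_def)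
  obtain V j s where V: "openin ?R V" and j: "continuous_map E' (subtopology ?R V) j"
      and s: "continuous_map (subtopology ?R V) E' s" and sj: "\<And>x. x \<in> topspace E' \<Longrightarrow> s (j x) = x"
    using assms(2) by (auto simp: open_retract_def)
  \<comment> \<open>Interleaving even and odd coordinates identifies the space of sequences with its
    own square.\<close>
  define ev od :: "(nat \<Rightarrow> real) \<Rightarrow> nat \<Rightarrow> real" where "ev = (\<lambda>x k. x (2 * k))" and "od = (\<lambda>x k. x (2 * k + 1))"
  define mix :: "(nat \<Rightarrow> real) \<Rightarrow> (nat \<Rightarrow> real) \<Rightarrow> nat \<Rightarrow> real"
    where "mix = (\<lambda>x y k. if even k then x (k div 2) else y (k div 2))"
  have mix: "ev (mix x y) = x" "od (mix x y) = y" for x y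
    by (auto simp: ev_def od_def mix_def)
  have ev: "continuous_map ?R ?R ev" and od: "continuous_map ?R ?R od"
    by (auto simp: ev_def od_def continuous_map_componentwise_UNIV intro: continuous_map_product_projection)
  define W where "W = {x \<in> topspace ?R. ev x \<in> U} \<inter> {x \<in> topspace ?R. od x \<in> V}"
  show ?thesis
    unfolding open_retract_def
  proof (intro exI conjI ballI)
    show "openin ?R W"
      unfolding W_def by (intro openin_Int openin_continuous_map_preimage [OF ev U] openin_continuous_map_preimage [OF od V])
    have i': "continuous_map E ?R i" "i \<in> topspace E \<rightarrow> U" and j': "continuous_map E' ?R j" "j \<in> topspace E' \<rightarrow> V"
      using i j by (auto simp: continuous_map_in_subtopology)
    have "continuous_map (prod_topology E E') euclideanreal (\<lambda>z. mix (i (fst z)) (j (snd z)) k)" for k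
    proof -
      have "continuous_map E euclideanreal (\<lambda>x. i x k')" "continuous_map E' euclideanreal (\<lambda>x. j x k')" for k'
        using i'(1) j'(1) by (auto simp: continuous_map_componentwise_UNIV)
      then have "continuous_map (prod_topology E E') euclideanreal ((\<lambda>x. i x k') \<circ> fst)"
          "continuous_map (prod_topology E E') euclideanreal ((\<lambda>x. j x k') \<circ> snd)" for k'
        by (blast intro: continuous_map_compose continuous_map_fst continuous_map_snd)+
      then show ?thesis
        by (simp add: mix_def o_def)
    qed
    then show "continuous_map (prod_topology E E') (subtopology ?R W) (\<lambda>z. mix (i (fst z)) (j (snd z)))"
      using i'(2) j'(2) by (auto simp: continuous_map_in_subtopology continuous_map_componentwise_UNIV W_def mix)
    have "continuous_map (subtopology ?R W) (subtopology ?R U) ev" "continuous_map (subtopology ?R W) (subtopology ?R V) od"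
      using ev od by (auto simp: continuous_map_in_subtopology continuous_map_from_subtopology W_def)
    then have "continuous_map (subtopology ?R W) E (r \<circ> ev)" "continuous_map (subtopology ?R W) E' (s \<circ> od)"
      using r s by (blast intro: continuous_map_compose)+
    then show "continuous_map (subtopology ?R W) (prod_topology E E') (\<lambda>x. (r (ev x), s (od x)))"
      by (intro continuous_map_pairedI) (simp_all add: o_def)
    show "(r (ev (mix (i (fst z)) (j (snd z)))), s (od (mix (i (fst z)) (j (snd z))))) = z"
      if "z \<in> topspace (prod_topology E E')" for z
      using that by (auto simp: mix ri sj)
  qed
qed

text \<open>Tietze's theorem extends each coordinate of \<open>f\<close> followed by the embedding
  \<open>i\<close>. Where the resulting sequence still lies in \<open>U\<close>, the retraction
  brings it back to \<open>E\<close>.\<close>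

lemma open_retract_extension:
  assumes E: "open_retract E" and Z: "metrizable_space Z" and C: "closedin Z C"
    and f: "continuous_map (subtopology Z C) E f"
  obtains N F where "openin Z N" "C \<subseteq> N" "continuous_map (subtopology Z N) E F" "\<And>x. x \<in> C \<Longrightarrow> F x = f x"
proof -
  let ?R = "powertop_real (UNIV :: nat set)"
  obtain U i r where U: "openin ?R U" and i: "continuous_map E (subtopology ?R U) i"
      and r: "continuous_map (subtopology ?R U) E r" and ri: "\<And>x. x \<in> topspace E \<Longrightarrow> r (i x) = x"
    using E by (auto simp: open_retract_def)
  have CZ: "topspace (subtopology Z C) = C"
    using closedin_subset [OF C] by auto
  have "continuous_map (subtopology Z C) ?R (i \<circ> f)" and iU: "i \<in> topspace E \<rightarrow> U"
    using i f by (auto simp: continuous_map_in_subtopology intro: continuous_map_compose)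
  then have "continuous_map (subtopology Z C) euclideanreal (\<lambda>z. i (f z) k)" for k
    by (simp add: continuous_map_componentwise_UNIV)
  then have "\<exists>g. continuous_map Z euclideanreal g \<and> (\<forall>z\<in>C. g z = i (f z) k)" for k
    using Tietze_extension_realinterval [OF metrizable_imp_normal_space [OF Z] C is_interval_univ UNIV_not_empty, of "\<lambda>z. i (f z) k"]
    by (metis subset_UNIV)
  then obtain g where g: "\<And>k. continuous_map Z euclideanreal (g k)" "\<And>k z. z \<in> C \<Longrightarrow> g k z = i (f z) k"
    by metis
  define G where "G z = (\<lambda>k. g k z)" for z
  have G: "continuous_map Z ?R G"
    using g by (simp add: G_def continuous_map_componentwise_UNIV)
  have GC: "G z = i (f z)" if "z \<in> C" for z
    using g(2) that by (simp add: G_def)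
  have fE: "f z \<in> topspace E" if "z \<in> C" for z
    using continuous_map_image_subset_topspace [OF f] that CZ by auto
  define N where "N = {z \<in> topspace Z. G z \<in> U}"
  show thesis
  proof
    show "openin Z N"
      unfolding N_def by (rule openin_continuous_map_preimage [OF G U])
    show "C \<subseteq> N"
      using closedin_subset [OF C] fE iU by (auto simp: N_def GC)
    have "continuous_map (subtopology Z N) (subtopology ?R U) G"
      using G by (auto simp: continuous_map_in_subtopology continuous_map_from_subtopology N_def)
    then show "continuous_map (subtopology Z N) E (r \<circ> G)"
      using r by (rule continuous_map_compose)
    show "(r \<circ> G) x = f x" if "x \<in> C" for x
      using that by (simp add: GC ri fE)
  qed
qed

text \<open>The tube lemma for a set in place of a point: the tubes around its points are united,
  and the compact factor is the same for all of them.\<close>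

lemma tube_neighbourhood:
  assumes W: "openin (prod_topology X Z) W" and X: "compact_space X" and S: "topspace X \<times> S \<subseteq> W" "S \<subseteq> topspace Z"
  obtains N where "openin Z N" "S \<subseteq> N" "topspace X \<times> N \<subseteq> W"
proof
  let ?N = "\<Union>{N. openin Z N \<and> topspace X \<times> N \<subseteq> W}"
  show "openin Z ?N"
    by auto
  show "S \<subseteq> ?N"
  proof
    fix y assume y: "y \<in> S"
    then have "\<exists>U V. openin X U \<and> openin Z V \<and> topspace X \<subseteq> U \<and> y \<in> V \<and> U \<times> V \<subseteq> W"
      using X S by (intro tube_lemma_left [OF W]) (auto simp: compact_space_def)
    then show "y \<in> ?N"
      by blast
  qed
  show "topspace X \<times> ?N \<subseteq> W"
    by blast
qed

text \<open>The homotopy is the straight-line homotopy in the ambient vector space, followed by the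
  retraction; it is defined near the set on which the maps agree.\<close>

lemma open_retract_locally_homotopic:
  assumes E: "open_retract E" and f: "continuous_map Z E f" and g: "continuous_map Z E g"
    and S: "S \<subseteq> topspace Z" "\<And>x. x \<in> S \<Longrightarrow> f x = g x"
  obtains N where "openin Z N" "S \<subseteq> N" "homotopic_with (\<lambda>_. True) (subtopology Z N) E f g"
proof -
  let ?R = "powertop_real (UNIV :: nat set)"
  let ?I = "top_of_set {0..1::real}"
  obtain U i r where U: "openin ?R U" and i: "continuous_map E (subtopology ?R U) i"
      and r: "continuous_map (subtopology ?R U) E r" and ri: "\<And>x. x \<in> topspace E \<Longrightarrow> r (i x) = x"
    using E by (auto simp: open_retract_def)
  have i': "continuous_map E ?R i" "i \<in> topspace E \<rightarrow> U"
    using i by (auto simp: continuous_map_in_subtopology)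
  define L where "L = (\<lambda>(t, z) k. (1 - t) * i (f z) k + t * i (g z) k)"
  have L: "continuous_map (prod_topology ?I Z) ?R L"
  proof -
    have "continuous_map Z euclideanreal (\<lambda>z. i (f z) k)" "continuous_map Z euclideanreal (\<lambda>z. i (g z) k)" for k
      using continuous_map_compose [OF f i'(1)] continuous_map_compose [OF g i'(1)]
      by (auto simp: continuous_map_componentwise_UNIV)
    then have "continuous_map (prod_topology ?I Z) euclideanreal ((\<lambda>z. i (f z) k) \<circ> snd)"
        "continuous_map (prod_topology ?I Z) euclideanreal ((\<lambda>z. i (g z) k) \<circ> snd)" for k
      by (blast intro: continuous_map_compose continuous_map_snd)+
    moreover have "continuous_map (prod_topology ?I Z) euclideanreal fst"
      using continuous_map_fst continuous_map_into_fulltopology by blast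
    ultimately have "continuous_map (prod_topology ?I Z) euclideanreal
        (\<lambda>x. (1 - fst x) * i (f (snd x)) k + fst x * i (g (snd x)) k)" for k
      by (intro continuous_intros) (simp_all add: o_def)
    then show ?thesis
      by (simp add: L_def continuous_map_componentwise_UNIV case_prod_unfold)
  qed
  define W where "W = {x \<in> topspace (prod_topology ?I Z). L x \<in> U}"
  have W: "openin (prod_topology ?I Z) W"
    unfolding W_def by (rule openin_continuous_map_preimage [OF L U])
  have fE: "f z \<in> topspace E" "g z \<in> topspace E" if "z \<in> topspace Z" for z
    using f g that by (auto simp: continuous_map_def)
  \<comment> \<open>On \<open>S\<close> the segment is constant and so stays in \<open>U\<close>; by
    compactness of the interval the same holds near \<open>S\<close>.\<close>
  have "L (t, z) = i (f z)" if "z \<in> S" for t z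
    using S(2) [OF that] by (auto simp: L_def algebra_simps)
  then have "topspace ?I \<times> S \<subseteq> W"
    using S(1) fE funcset_mem [OF i'(2)] by (auto simp: W_def)
  then obtain N where N: "openin Z N" "S \<subseteq> N" "topspace ?I \<times> N \<subseteq> W"
    using tube_neighbourhood [OF W _ _ S(1)] by (auto simp: compact_space_subtopology)
  have "continuous_map (prod_topology ?I (subtopology Z N)) (subtopology ?R U) L"
    using L N(3) openin_subset [OF N(1)]
    by (auto simp: prod_topology_subtopology(2) continuous_map_in_subtopology continuous_map_from_subtopology W_def)
  then have "continuous_map (prod_topology ?I (subtopology Z N)) E (r \<circ> L)"
    using r by (rule continuous_map_compose)
  moreover have "(r \<circ> L) (0, z) = f z" "(r \<circ> L) (1, z) = g z" if "z \<in> topspace Z" for z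
    using fE [OF that] ri by (simp_all add: L_def)
  ultimately have "homotopic_with (\<lambda>_. True) (subtopology Z N) E f g"
    by (subst homotopic_with) auto
  with N show thesis
    using that by blast
qed

section \<open>Locally closed subsets and extension from them\<close>

text \<open>The form in which local compactness is used: it survives products and differences of
  open subsets, and reduces extension problems to closed subsets of an open set.\<close>

definition locally_closedin :: "'a topology \<Rightarrow> 'a set \<Rightarrow> bool" where
  "locally_closedin X S \<longleftrightarrow> (\<exists>U C. openin X U \<and> closedin X C \<and> S = U \<inter> C)"

lemma locally_closedin_subset: "locally_closedin X S \<Longrightarrow> S \<subseteq> topspace X"
  by (auto simp: locally_closedin_def dest: openin_subset)

lemma locally_closedin_Int:
  assumes "locally_closedin X S" "locally_closedin X T"
  shows "locally_closedin X (S \<inter> T)"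
proof -
  obtain U C U' C' where "openin X U" "closedin X C" "S = U \<inter> C" "openin X U'" "closedin X C'" "T = U' \<inter> C'"
    using assms by (auto simp: locally_closedin_def)
  then have "openin X (U \<inter> U')" "closedin X (C \<inter> C')" "S \<inter> T = (U \<inter> U') \<inter> (C \<inter> C')"
    by auto
  then show ?thesis
    unfolding locally_closedin_def by blast
qed

text \<open>Applied with \<open>S\<close> the product of the two subspaces, this covers the sets
  over which the sections are given.\<close>

lemma locally_closedin_diff_open:
  assumes "locally_closedin X S" "openin (subtopology X S) U" "openin (subtopology X S) V"
  shows "locally_closedin X (U - V)"
proof -
  obtain U' V' where U': "openin X U'" "U = U' \<inter> S" and V': "openin X V'" "V = V' \<inter> S"
    using assms(2,3) by (auto simp: openin_subtopology)
  have "locally_closedin X (U' \<inter> (topspace X - V'))"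
    using U' V' unfolding locally_closedin_def by blast
  moreover have "U - V = (U' \<inter> (topspace X - V')) \<inter> S"
    using locally_closedin_subset [OF assms(1)] U' V' by auto
  ultimately show ?thesis
    using assms(1) by (simp add: locally_closedin_Int)
qed

lemma locally_closedin_Times:
  assumes "locally_closedin X S" "locally_closedin Y T"
  shows "locally_closedin (prod_topology X Y) (S \<times> T)"
proof -
  obtain U C U' C' where "openin X U" "closedin X C" "S = U \<inter> C" "openin Y U'" "closedin Y C'" "T = U' \<inter> C'"
    using assms by (auto simp: locally_closedin_def)
  then have "openin (prod_topology X Y) (U \<times> U')" "closedin (prod_topology X Y) (C \<times> C')" "S \<times> T = (U \<times> U') \<inter> (C \<times> C')"
    by (auto simp: openin_prod_Times_iff closedin_prod_Times_iff)
  then show ?thesis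
    unfolding locally_closedin_def by blast
qed

lemma locally_closedin_topspace: "locally_closedin X (topspace X)"
  unfolding locally_closedin_def by (metis Int_absorb closedin_topspace openin_topspace)

lemma locally_compact_imp_locally_closedin:
  assumes "open_retract E" "X \<subseteq> topspace E" "locally_compact_space (subtopology E X)"
  shows "locally_closedin E X"
  using locally_compact_subspace_closed_Int_openin [of E X] assms
    metrizable_imp_Hausdorff_space [OF open_retract_imp_metrizable [OF assms(1)]]
  unfolding locally_closedin_def by blast

text \<open>The set is closed in some open \<open>U\<close>, and the closed case is applied inside
  \<open>U\<close>, which is again metrizable.\<close>

lemma open_retract_extension_locally_closed:
  assumes E: "open_retract E" and P: "open_retract P" and S: "locally_closedin P S"
    and f: "continuous_map (subtopology P S) E f"
  obtains N F where "openin P N" "S \<subseteq> N" "continuous_map (subtopology P N) E F" "\<And>x. x \<in> S \<Longrightarrow> F x = f x"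
proof -
  obtain U C where UC: "openin P U" "closedin P C" "S = U \<inter> C"
    using S by (auto simp: locally_closedin_def)
  have C: "closedin (subtopology P U) S"
    using UC by (auto simp: closedin_subtopology)
  have "subtopology (subtopology P U) S = subtopology P S"
    using UC by (simp add: subtopology_subtopology Int_absorb1)
  then have f': "continuous_map (subtopology (subtopology P U) S) E f"
    using f by simp
  obtain N F where N: "openin (subtopology P U) N" "S \<subseteq> N" "continuous_map (subtopology (subtopology P U) N) E F"
      "\<And>x. x \<in> S \<Longrightarrow> F x = f x"
    using open_retract_extension [OF E metrizable_space_subtopology [OF open_retract_imp_metrizable [OF P]] C f'] by blast
  show thesis
  proof
    show "openin P N"
      using N(1) UC(1) by (rule openin_trans_full)
    show "continuous_map (subtopology P N) E F"
      using N(1,3) openin_subset [OF N(1)] by (simp add: subtopology_subtopology Int_absorb1)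
  qed (use N in auto)
qed

text \<open>A homotopy on a locally closed set extends to a homotopy between some extensions of its ends;
  these are homotopic near the set to any given extensions.\<close>

lemma homotopy_near_locally_closed:
  assumes P: "open_retract P" and Q: "open_retract Q" and S: "locally_closedin P S"
    and h: "continuous_map (prod_topology (top_of_set {0..1::real}) (subtopology P S)) Q h"
    and D: "openin P D" "S \<subseteq> D"
    and f: "continuous_map (subtopology P D) Q f" "\<And>x. x \<in> S \<Longrightarrow> h (0, x) = f x"
    and g: "continuous_map (subtopology P D) Q g" "\<And>x. x \<in> S \<Longrightarrow> h (1, x) = g x"
  obtains N where "openin P N" "S \<subseteq> N" "N \<subseteq> D" "homotopic_with (\<lambda>_. True) (subtopology P N) Q f g"
proof -
  let ?I = "top_of_set {0..1::real}"
  obtain U C where UC: "openin P U" "closedin P C" "S = U \<inter> C"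
    using S by (auto simp: locally_closedin_def)
  let ?Z = "prod_topology ?I (subtopology P U)"
  have C: "closedin ?Z ({0..1} \<times> S)"
    using UC by (auto simp: closedin_prod_Times_iff closedin_subtopology)
  have "subtopology (subtopology P U) S = subtopology P S"
    using UC by (simp add: subtopology_subtopology Int_absorb1)
  then have h': "continuous_map (subtopology ?Z ({0..1} \<times> S)) Q h"
    using h by (simp add: subtopology_Times subtopology_subtopology)
  have "metrizable_space ?Z"
    by (simp add: metrizable_space_prod_topology metrizable_space_subtopology metrizable_space_euclidean open_retract_imp_metrizable P)
  then obtain W H where W: "openin ?Z W" "{0..1} \<times> S \<subseteq> W" "continuous_map (subtopology ?Z W) Q H"
      and H: "\<And>x. x \<in> {0..1} \<times> S \<Longrightarrow> H x = h x"
    using open_retract_extension [OF Q _ C h'] by blast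
  \<comment> \<open>The extended homotopy lives near [0,1] times \<open>S\<close> only; compactness
    of the interval gives a neighbourhood of \<open>S\<close> on which it is defined for all
    times.\<close>
  obtain V where V: "openin (subtopology P U) V" "S \<subseteq> V" "{0..1} \<times> V \<subseteq> W"
    using tube_neighbourhood [OF W(1), of S] W(2) UC locally_closedin_subset [OF S]
    by (auto simp: compact_space_subtopology)
  define M where "M = V \<inter> D"
  have V_open: "openin P V"
    using V(1) UC(1) by (rule openin_trans_full)
  then have M: "openin P M" "S \<subseteq> M" "M \<subseteq> D" "M \<subseteq> U"
    using D V(2) openin_subset [OF V(1)] by (auto simp: M_def)
  have "subtopology ?Z ({0..1} \<times> M) = prod_topology ?I (subtopology P M)"
    using M by (simp add: subtopology_Times subtopology_subtopology Int_absorb1)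
  moreover have "{0..1} \<times> M \<subseteq> W"
    using V(3) by (auto simp: M_def)
  ultimately have H_cont: "continuous_map (prod_topology ?I (subtopology P M)) Q H"
    using continuous_map_from_subtopology_mono [OF W(3), of "{0..1} \<times> M"] by simp
  then have hom: "homotopic_with (\<lambda>_. True) (subtopology P M) Q (\<lambda>x. H (0, x)) (\<lambda>x. H (1, x))"
    unfolding homotopic_with_def by blast
  note H01 = homotopic_with_imp_continuous_maps [OF hom]
  have fM: "continuous_map (subtopology P M) Q f" and gM: "continuous_map (subtopology P M) Q g"
    using f(1) g(1) M(3) by (blast intro: continuous_map_from_subtopology_mono)+
  have SM: "S \<subseteq> topspace (subtopology P M)"
    using M locally_closedin_subset [OF S] by auto
  \<comment> \<open>The ends of \<open>H\<close> agree with \<open>f\<close> and \<open>g\<close>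
    only on \<open>S\<close>. Maps into \<open>Q\<close> that agree on \<open>S\<close> are
    homotopic near \<open>S\<close>, so three homotopies are joined on a common
    neighbourhood.\<close>
  obtain N0 where N0: "openin (subtopology P M) N0" "S \<subseteq> N0"
      "homotopic_with (\<lambda>_. True) (subtopology (subtopology P M) N0) Q f (\<lambda>x. H (0, x))"
    using open_retract_locally_homotopic [OF Q fM conjunct1 [OF H01] SM] f(2) H by auto
  obtain N1 where N1: "openin (subtopology P M) N1" "S \<subseteq> N1"
      "homotopic_with (\<lambda>_. True) (subtopology (subtopology P M) N1) Q (\<lambda>x. H (1, x)) g"
    using open_retract_locally_homotopic [OF Q conjunct2 [OF H01] gM SM] g(2) H by auto
  define N where "N = N0 \<inter> N1"
  have sub: "subtopology (subtopology (subtopology P M) N0) N = subtopology P N"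
    "subtopology (subtopology (subtopology P M) N1) N = subtopology P N"
    "subtopology (subtopology P M) N = subtopology P N"
    using openin_subset [OF N0(1)] openin_subset [OF N1(1)]
    by (auto simp: N_def subtopology_subtopology intro: arg_cong [where f = "subtopology P"])
  have "homotopic_with (\<lambda>_. True) (subtopology P N) Q f (\<lambda>x. H (0, x))"
    "homotopic_with (\<lambda>_. True) (subtopology P N) Q (\<lambda>x. H (0, x)) (\<lambda>x. H (1, x))"
    "homotopic_with (\<lambda>_. True) (subtopology P N) Q (\<lambda>x. H (1, x)) g"
    using homotopic_from_subtopology [OF N0(3), of N] homotopic_from_subtopology [OF hom, of N]
      homotopic_from_subtopology [OF N1(3), of N] by (simp_all only: sub)
  then have "homotopic_with (\<lambda>_. True) (subtopology P N) Q f g"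
    using homotopic_with_trans by blast
  moreover have "openin P N"
    using N0(1) N1(1) M(1) openin_trans_full by (simp add: N_def) blast
  moreover have "S \<subseteq> N" "N \<subseteq> D"
    using N0 N1 M(3) openin_subset [OF N0(1)] by (auto simp: N_def)
  ultimately show thesis
    using that by blast
qed

text \<open>One half of the exponential law: the interval is locally compact, so a compact
  neighbourhood \<open>K\<close> of \<open>t\<close> with \<open>s a\<close> mapping
  \<open>K\<close> into \<open>U\<close> yields a subbasic open set of paths that controls all times
  in \<open>K\<close> at once.\<close>

lemma continuous_map_path_evaluation:
  assumes s: "continuous_map A (path_space X) s"
  shows "continuous_map (prod_topology (top_of_set {0..1::real}) A) X (\<lambda>(t, a). s a t)"
proof -
  let ?I = "top_of_set {0..1::real}"
  let ?B = "{{g \<in> continuous_maps ?I X. g ` K \<subseteq> U} | K U. compactin ?I K \<and> openin X U}"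
  \<comment> \<open>The points of a generated topology are those of the union of its subbasis, and
    every subbasic set here consists of continuous maps.\<close>
  have path: "s a \<in> continuous_maps ?I X" if "a \<in> topspace A" for a
  proof -
    have "s a \<in> \<Union>?B"
      using s that by (auto simp: continuous_map_def path_space_def compact_open_topology_def)
    then show ?thesis
      by auto
  qed
  have nbhd: "neighbourhood_base_of (compactin ?I) ?I"
    by (intro locally_compact_imp_neighbourhood_base compact_imp_locally_compact_space)
      (auto simp: compact_space_subtopology metrizable_imp_regular_space metrizable_space_subtopology metrizable_space_euclidean)
  show ?thesis
    unfolding continuous_map_def
  proof (intro conjI allI impI)
    show "(\<lambda>(t, a). s a t) \<in> topspace (prod_topology ?I A) \<rightarrow> topspace X"
      using path by (fastforce simp: continuous_maps_def continuous_map_def)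
    fix U assume U: "openin X U"
    show "openin (prod_topology ?I A) {x \<in> topspace (prod_topology ?I A). (case x of (t, a) \<Rightarrow> s a t) \<in> U}"
      unfolding openin_prod_topology_alt
    proof clarify
      fix t a
      assume ta: "(t, a) \<in> topspace (prod_topology ?I A)" "s a t \<in> U"
      then have t: "t \<in> {0..1}" and a: "a \<in> topspace A"
        by auto
      have "continuous_map ?I X (s a)"
        using path [OF a] by (simp add: continuous_maps_def)
      then have "openin ?I {x \<in> topspace ?I. s a x \<in> U}"
        using U by (rule openin_continuous_map_preimage)
      then obtain T K where TK: "openin ?I T" "compactin ?I K" "t \<in> T" "T \<subseteq> K" "K \<subseteq> {x \<in> topspace ?I. s a x \<in> U}"
        using nbhd t ta(2) unfolding neighbourhood_base_of by (metis (mono_tags, lifting) mem_Collect_eq topspace_euclidean_subtopology)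
      have "openin (path_space X) {g \<in> continuous_maps ?I X. g ` K \<subseteq> U}"
        unfolding path_space_def compact_open_topology_def
        by (rule topology_generated_by_Basis) (use TK(2) U in blast)
      then have V: "openin A {b \<in> topspace A. s b \<in> {g \<in> continuous_maps ?I X. g ` K \<subseteq> U}}" (is "openin A ?V")
        by (rule openin_continuous_map_preimage [OF s])
      have "a \<in> ?V"
        using a path TK(5) by auto
      moreover have "T \<times> ?V \<subseteq> {x \<in> topspace (prod_topology ?I A). (case x of (t, a) \<Rightarrow> s a t) \<in> U}"
        using TK(4) openin_subset [OF TK(1)] by auto
      ultimately show "\<exists>T V. openin ?I T \<and> openin A V \<and> t \<in> T \<and> a \<in> V \<and>
          T \<times> V \<subseteq> {x \<in> topspace (prod_topology ?I A). (case x of (t, a) \<Rightarrow> s a t) \<in> U}"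
        using TK(1,3) V by blast
    qed
  qed
qed


section \<open>Direct limits\<close>

locale direct_system =
  fixes D :: "'i set" and leq :: "'i \<Rightarrow> 'i \<Rightarrow> bool"
    and A :: "'i \<Rightarrow> ('c, 'm) ring_scheme" and \<rho> :: "'i \<Rightarrow> 'i \<Rightarrow> 'c \<Rightarrow> 'c"
  assumes nonempty: "D \<noteq> {}"
    and refl: "i \<in> D \<Longrightarrow> leq i i"
    and trans: "leq i j \<Longrightarrow> leq j k \<Longrightarrow> leq i k"
    and directed: "i \<in> D \<Longrightarrow> j \<in> D \<Longrightarrow> \<exists>k\<in>D. leq i k \<and> leq j k"
    and ring: "i \<in> D \<Longrightarrow> ring (A i)"
    and hom: "i \<in> D \<Longrightarrow> j \<in> D \<Longrightarrow> leq i j \<Longrightarrow> \<rho> i j \<in> ring_hom (A i) (A j)"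
    and ident: "i \<in> D \<Longrightarrow> a \<in> carrier (A i) \<Longrightarrow> \<rho> i i a = a"
    and comp: "i \<in> D \<Longrightarrow> j \<in> D \<Longrightarrow> k \<in> D \<Longrightarrow> leq i j \<Longrightarrow> leq j k \<Longrightarrow> a \<in> carrier (A i) \<Longrightarrow>
                 \<rho> j k (\<rho> i j a) = \<rho> i k a"
begin

abbreviation cls :: "'i \<Rightarrow> 'c \<Rightarrow> ('i \<times> 'c) set" where
  "cls \<equiv> direct_limit_class D leq A \<rho>"

abbreviation lim :: "('i \<times> 'c) set ring" where
  "lim \<equiv> direct_limit D leq A \<rho>"

lemma transition_closed:
  "i \<in> D \<Longrightarrow> j \<in> D \<Longrightarrow> leq i j \<Longrightarrow> a \<in> carrier (A i) \<Longrightarrow> \<rho> i j a \<in> carrier (A j)"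
  by (rule ring_hom_closed [OF hom])

lemma ring_closed:
  assumes "i \<in> D"
  shows "\<one>\<^bsub>A i\<^esub> \<in> carrier (A i)" "\<zero>\<^bsub>A i\<^esub> \<in> carrier (A i)"
    "a \<in> carrier (A i) \<Longrightarrow> b \<in> carrier (A i) \<Longrightarrow> a \<otimes>\<^bsub>A i\<^esub> b \<in> carrier (A i)"
proof -
  interpret ring "A i"
    by (rule ring [OF assms])
  show "\<one>\<^bsub>A i\<^esub> \<in> carrier (A i)" "\<zero>\<^bsub>A i\<^esub> \<in> carrier (A i)"
    "a \<in> carrier (A i) \<Longrightarrow> b \<in> carrier (A i) \<Longrightarrow> a \<otimes>\<^bsub>A i\<^esub> b \<in> carrier (A i)"
    by simp_all
qed

lemma in_class_iff:
  "(j, b) \<in> cls i a \<longleftrightarrow> i \<in> D \<and> a \<in> carrier (A i) \<and> j \<in> D \<and> b \<in> carrier (A j) \<and>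
     (\<exists>k\<in>D. leq i k \<and> leq j k \<and> \<rho> i k a = \<rho> j k b)"
  by (simp add: direct_limit_class_def direct_limit_rel_def)

lemma rel_sym: "sym (direct_limit_rel D leq A \<rho>)"
proof (rule symI)
  fix x y assume "(x, y) \<in> direct_limit_rel D leq A \<rho>"
  then show "(y, x) \<in> direct_limit_rel D leq A \<rho>"
    unfolding direct_limit_rel_def by (cases x, cases y) (clarsimp, metis)
qed

text \<open>The two equalities hold at unrelated indices \<open>k\<close> and \<open>l\<close>;
  directedness moves both to a common later index.\<close>

lemma rel_trans: "Relation.trans (direct_limit_rel D leq A \<rho>)"
proof (rule transI)
  fix x y z
  assume "(x, y) \<in> direct_limit_rel D leq A \<rho>" "(y, z) \<in> direct_limit_rel D leq A \<rho>"
  moreover obtain h a i b j c where xyz: "x = (h, a)" "y = (i, b)" "z = (j, c)"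
    by (metis surj_pair)
  ultimately obtain k l where D: "h \<in> D" "i \<in> D" "j \<in> D" and car: "a \<in> carrier (A h)" "b \<in> carrier (A i)" "c \<in> carrier (A j)"
    and k: "k \<in> D" "leq h k" "leq i k" "\<rho> h k a = \<rho> i k b"
    and l: "l \<in> D" "leq i l" "leq j l" "\<rho> i l b = \<rho> j l c"
    by (auto simp: direct_limit_rel_def)
  obtain m where m: "m \<in> D" "leq k m" "leq l m"
    using directed k l by blast
  have "\<rho> h m a = \<rho> k m (\<rho> h k a)"
    using comp [of h k m a] D k(1,2) m car by simp
  also have "\<dots> = \<rho> i m b"
    using comp [of i k m b] D k m car by simp
  also have "\<dots> = \<rho> l m (\<rho> i l b)"
    using comp [of i l m b] D l(1,2) m car by simp
  also have "\<dots> = \<rho> j m c"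
    using comp [of j l m c] D l m car by simp
  finally have "\<rho> h m a = \<rho> j m c" .
  moreover have "leq h m" "leq j m"
    using trans k l m by blast+
  ultimately show "(x, z) \<in> direct_limit_rel D leq A \<rho>"
    using D car m by (auto simp: direct_limit_rel_def xyz)
qed

lemma equiv_rel: "equiv (SIGMA i:D. carrier (A i)) (direct_limit_rel D leq A \<rho>)"
proof (rule equivI)
  show "refl_on (SIGMA i:D. carrier (A i)) (direct_limit_rel D leq A \<rho>)"
    by (rule refl_onI) (auto simp: direct_limit_rel_def intro: refl)
  show "direct_limit_rel D leq A \<rho> \<subseteq> (SIGMA i:D. carrier (A i)) \<times> (SIGMA i:D. carrier (A i))"
    by (auto simp: direct_limit_rel_def)
qed (rule rel_sym rel_trans)+

lemma class_eq_iff: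
  assumes "i \<in> D" "a \<in> carrier (A i)" "j \<in> D" "b \<in> carrier (A j)"
  shows "cls i a = cls j b \<longleftrightarrow> (\<exists>k\<in>D. leq i k \<and> leq j k \<and> \<rho> i k a = \<rho> j k b)"
proof -
  have "cls i a = cls j b \<longleftrightarrow> ((i, a), (j, b)) \<in> direct_limit_rel D leq A \<rho>"
    unfolding direct_limit_class_def
    by (rule eq_equiv_class_iff [OF equiv_rel]) (use assms in auto)
  then show ?thesis
    using assms by (simp add: direct_limit_rel_def)
qed

lemma class_transition:
  assumes "i \<in> D" "j \<in> D" "leq i j" "a \<in> carrier (A i)"
  shows "cls j (\<rho> i j a) = cls i a"
proof -
  note c = transition_closed [OF assms]
  have "\<rho> j j (\<rho> i j a) = \<rho> i j a"
    by (rule ident [OF assms(2) c])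
  then have "\<exists>k\<in>D. leq j k \<and> leq i k \<and> \<rho> j k (\<rho> i j a) = \<rho> i k a"
    using assms(2,3) refl by blast
  then show ?thesis
    by (simp only: class_eq_iff [OF assms(2) c assms(1,4)])
qed

lemma carrier_lim: "carrier lim = {cls i a | i a. i \<in> D \<and> a \<in> carrier (A i)}"
proof -
  have "carrier lim = (\<Union>x\<in>(SIGMA i:D. carrier (A i)). {direct_limit_rel D leq A \<rho> `` {x}})"
    by (simp add: direct_limit_def quotient_def)
  also have "\<dots> = {cls i a | i a. i \<in> D \<and> a \<in> carrier (A i)}"
    unfolding direct_limit_class_def by blast
  finally show ?thesis .
qed

text \<open>The defining union runs over all representatives and all common later indices. Every
  member of it is the same class, and the given representatives at \<open>i\<close> show that the
  union is not empty.\<close>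

lemma class_mult:
  assumes i: "i \<in> D" and ab: "a \<in> carrier (A i)" "b \<in> carrier (A i)"
  shows "cls i a \<otimes>\<^bsub>lim\<^esub> cls i b = cls i (a \<otimes>\<^bsub>A i\<^esub> b)"
proof -
  have eq: "cls k (\<rho> i' k a' \<otimes>\<^bsub>A k\<^esub> \<rho> j' k b') = cls i (a \<otimes>\<^bsub>A i\<^esub> b)"
    if a': "(i', a') \<in> cls i a" and b': "(j', b') \<in> cls i b" and k: "k \<in> D" "leq i' k" "leq j' k" for i' a' j' b' k
  proof -
    obtain k1 k2 where i': "i' \<in> D" "a' \<in> carrier (A i')" and j': "j' \<in> D" "b' \<in> carrier (A j')"
      and k1: "k1 \<in> D" "leq i k1" "leq i' k1" "\<rho> i k1 a = \<rho> i' k1 a'"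
      and k2: "k2 \<in> D" "leq i k2" "leq j' k2" "\<rho> i k2 b = \<rho> j' k2 b'"
      using a' b' by (auto simp: in_class_iff)
    obtain m0 where m0: "m0 \<in> D" "leq k1 m0" "leq k2 m0"
      using directed k1(1) k2(1) by blast
    obtain m where m: "m \<in> D" "leq m0 m" "leq k m"
      using directed m0(1) k(1) by blast
    have le: "leq k1 m" "leq k2 m" "leq i m"
      using trans m0 m k1 k2 by blast+
    have "\<rho> i m a = \<rho> i' m a'"
      using comp [of i k1 m a] comp [of i' k1 m a'] i i' k1 m le ab by simp
    moreover have "\<rho> i m b = \<rho> j' m b'"
      using comp [of i k2 m b] comp [of j' k2 m b'] i j' k2 m le ab by simp
    ultimately have "\<rho> k m (\<rho> i' k a' \<otimes>\<^bsub>A k\<^esub> \<rho> j' k b') = \<rho> i m (a \<otimes>\<^bsub>A i\<^esub> b)"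
      using ring_hom_mult [OF hom [OF k(1) m(1,3)]] ring_hom_mult [OF hom [OF i m(1) le(3)]] ab i' j' k m
        transition_closed [of i' k a'] transition_closed [of j' k b'] comp [of i' k m a'] comp [of j' k m b']
      by simp
    moreover have "\<rho> i' k a' \<otimes>\<^bsub>A k\<^esub> \<rho> j' k b' \<in> carrier (A k)" "a \<otimes>\<^bsub>A i\<^esub> b \<in> carrier (A i)"
      using i i' j' k ab transition_closed ring_closed by simp_all
    ultimately show ?thesis
      using i k m le by (subst class_eq_iff) auto
  qed
  have self: "(i, a) \<in> cls i a" "(i, b) \<in> cls i b"
    using i ab refl by (auto simp: in_class_iff)
  have "cls i a \<otimes>\<^bsub>lim\<^esub> cls i b = (\<Union>(i', a')\<in>cls i a. \<Union>(j', b')\<in>cls i b. \<Union>k\<in>{k\<in>D. leq i' k \<and> leq j' k}.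
      cls k (\<rho> i' k a' \<otimes>\<^bsub>A k\<^esub> \<rho> j' k b'))"
    by (simp add: direct_limit_def)
  also have "\<dots> = cls i (a \<otimes>\<^bsub>A i\<^esub> b)"
  proof (intro equalityI subsetI)
    fix x assume "x \<in> cls i (a \<otimes>\<^bsub>A i\<^esub> b)"
    then have "x \<in> cls i (\<rho> i i a \<otimes>\<^bsub>A i\<^esub> \<rho> i i b)"
      using i ab by (simp add: ident)
    then show "x \<in> (\<Union>(i', a')\<in>cls i a. \<Union>(j', b')\<in>cls i b. \<Union>k\<in>{k\<in>D. leq i' k \<and> leq j' k}.
      cls k (\<rho> i' k a' \<otimes>\<^bsub>A k\<^esub> \<rho> j' k b'))"
      using self i refl by blast
  next
    fix x assume "x \<in> (\<Union>(i', a')\<in>cls i a. \<Union>(j', b')\<in>cls i b. \<Union>k\<in>{k\<in>D. leq i' k \<and> leq j' k}.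
      cls k (\<rho> i' k a' \<otimes>\<^bsub>A k\<^esub> \<rho> j' k b'))"
    then obtain i' a' j' b' k where "(i', a') \<in> cls i a" "(j', b') \<in> cls i b" "k \<in> D" "leq i' k" "leq j' k"
        "x \<in> cls k (\<rho> i' k a' \<otimes>\<^bsub>A k\<^esub> \<rho> j' k b')"
      by auto
    then show "x \<in> cls i (a \<otimes>\<^bsub>A i\<^esub> b)"
      using eq by simp
  qed
  finally show ?thesis .
qed

text \<open>For a family compatible with the transitions the union over all indices is a single
  class; it is applied to the units and to the zeros.\<close>

lemma class_const:
  assumes c: "\<And>j. j \<in> D \<Longrightarrow> c j \<in> carrier (A j)"
    and \<rho>: "\<And>j k. j \<in> D \<Longrightarrow> k \<in> D \<Longrightarrow> leq j k \<Longrightarrow> \<rho> j k (c j) = c k" and i: "i \<in> D"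
  shows "(\<Union>k\<in>D. cls k (c k)) = cls i (c i)"
proof -
  have "cls k (c k) = cls i (c i)" if "k \<in> D" for k
  proof -
    obtain m where "m \<in> D" "leq k m" "leq i m"
      using directed \<open>k \<in> D\<close> i by blast
    then show ?thesis
      using that i c \<rho> by (subst class_eq_iff) auto
  qed
  then have "(\<Union>k\<in>D. cls k (c k)) = (\<Union>k\<in>D. cls i (c i))"
    by (rule SUP_cong [OF HOL.refl])
  then show ?thesis
    using i by auto
qed

lemma transition_zero: "i \<in> D \<Longrightarrow> j \<in> D \<Longrightarrow> leq i j \<Longrightarrow> \<rho> i j \<zero>\<^bsub>A i\<^esub> = \<zero>\<^bsub>A j\<^esub>"
  by (rule ring_hom_zero [OF hom ring ring])

lemma one_lim:
  assumes "i \<in> D"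
  shows "\<one>\<^bsub>lim\<^esub> = cls i \<one>\<^bsub>A i\<^esub>"
proof -
  have "(\<Union>k\<in>D. cls k \<one>\<^bsub>A k\<^esub>) = cls i \<one>\<^bsub>A i\<^esub>"
    by (rule class_const) (use assms in \<open>auto intro: ring_closed ring_hom_one [OF hom]\<close>)
  then show ?thesis
    by (simp add: direct_limit_def)
qed

lemma zero_lim:
  assumes "i \<in> D"
  shows "\<zero>\<^bsub>lim\<^esub> = cls i \<zero>\<^bsub>A i\<^esub>"
proof -
  have "(\<Union>k\<in>D. cls k \<zero>\<^bsub>A k\<^esub>) = cls i \<zero>\<^bsub>A i\<^esub>"
    by (rule class_const) (use assms in \<open>auto intro: ring_closed transition_zero\<close>)
  then show ?thesis
    by (simp add: direct_limit_def)
qed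

lemma class_eq_zero_iff:
  assumes "i \<in> D" "a \<in> carrier (A i)"
  shows "cls i a = \<zero>\<^bsub>lim\<^esub> \<longleftrightarrow> (\<exists>k\<in>D. leq i k \<and> \<rho> i k a = \<zero>\<^bsub>A k\<^esub>)"
proof -
  have "cls i a = \<zero>\<^bsub>lim\<^esub> \<longleftrightarrow> (\<exists>k\<in>D. leq i k \<and> leq i k \<and> \<rho> i k a = \<rho> i k \<zero>\<^bsub>A i\<^esub>)"
    unfolding zero_lim [OF assms(1)] by (rule class_eq_iff [OF assms assms(1) ring_closed(2) [OF assms(1)]])
  also have "\<dots> \<longleftrightarrow> (\<exists>k\<in>D. leq i k \<and> \<rho> i k a = \<zero>\<^bsub>A k\<^esub>)"
    by (rule bex_cong [OF HOL.refl]) (simp add: transition_zero [OF assms(1)] cong: conj_cong)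
  finally show ?thesis .
qed

end

text \<open>Only equations for \<open>h\<close> are assumed, so that the target may be a direct
  limit, whose ring axioms are not established here.\<close>

lemma foldr_mult_hom:
  assumes "Group.monoid R" "h \<one>\<^bsub>R\<^esub> = \<one>\<^bsub>S\<^esub>"
    and "\<And>x y. x \<in> carrier R \<Longrightarrow> y \<in> carrier R \<Longrightarrow> h (x \<otimes>\<^bsub>R\<^esub> y) = h x \<otimes>\<^bsub>S\<^esub> h y"
    and "set xs \<subseteq> carrier R"
  shows "foldr (\<lambda>x y. x \<otimes>\<^bsub>S\<^esub> y) (map h xs) \<one>\<^bsub>S\<^esub> = h (foldr (\<lambda>x y. x \<otimes>\<^bsub>R\<^esub> y) xs \<one>\<^bsub>R\<^esub>)"
proof -
  interpret Group.monoid R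
    by (rule assms)
  have "foldr (\<lambda>x y. x \<otimes>\<^bsub>R\<^esub> y) xs \<one>\<^bsub>R\<^esub> \<in> carrier R \<and> ?thesis"
    using assms(4) by (induction xs) (simp_all add: assms)
  then show ?thesis ..
qed


section \<open>Sections of the path fibration and the kernel of the graph\<close>

text \<open>Near \<open>S\<close> the inclusion into \<open>V\<close> is homotopic to
  \<open>G\<close> after the first projection. So \<open>a\<close> is cohomologous there to the
  pullback along the projection of the pullback along \<open>G\<close>, and the latter is
  exact.\<close>

lemma restriction_vanishes_over_section:
  fixes E :: "'a topology" and E' :: "'b topology"
  defines "P \<equiv> prod_topology E E'"
  assumes E: "open_retract E" "open_retract E'"
    and S: "locally_closedin P S" "S \<subseteq> X \<times> Y"
    and f: "continuous_map (subtopology E X) (subtopology E' Y) f"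
    and s: "continuous_map (subtopology P S) (path_space (subtopology E X)) s"
    and sec: "\<And>b. b \<in> S \<Longrightarrow> (s b 0, f (s b 1)) = b"
    and V: "openin P V" "X \<times> Y \<subseteq> V"
    and a: "a \<in> carrier (cocycle_ring R (subtopology P V))"
    and W: "openin E W" "X \<subseteq> W"
    and G: "continuous_map (subtopology E W) (subtopology P V) G" "\<And>x. x \<in> X \<Longrightarrow> G x = (x, f x)"
    and Ga: "cochain_pullback (subtopology E W) G a \<in> coboundaries R (subtopology E W)"
  obtains N where "openin P N" "S \<subseteq> N" "N \<subseteq> V" "cochain_restrict P N a \<in> coboundaries R (subtopology P N)"
proof -
  have P: "open_retract P"
    unfolding P_def by (rule open_retract_prod [OF E])
  let ?Q = "subtopology P V" and ?C = "cylinder (subtopology P S)"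
  have ev: "continuous_map ?C (subtopology E X) (\<lambda>(t, b). s b t)"
    by (rule continuous_map_path_evaluation [OF s])
  define h where "h = (\<lambda>z. (fst (snd z), f ((\<lambda>(t, b). s b t) z)))"
  have fst_cont: "continuous_map P E fst"
    unfolding P_def by (rule continuous_map_fst)
  have "continuous_map ?C E (fst \<circ> snd)"
    by (rule continuous_map_compose [OF continuous_map_snd continuous_map_from_subtopology [OF fst_cont]])
  moreover have fev: "continuous_map ?C (subtopology E' Y) (f \<circ> (\<lambda>(t, b). s b t))"
    by (rule continuous_map_compose [OF ev f])
  ultimately have "continuous_map ?C P h"
    unfolding h_def P_def
    by (intro continuous_map_pairedI) (auto simp: o_def continuous_map_in_subtopology)
  \<comment> \<open>The first coordinate is fixed in \<open>X\<close> and the second is a value of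
    \<open>f\<close>, hence in \<open>Y\<close>; the homotopy never leaves
    \<open>X \<times> Y\<close>.\<close>
  moreover have "h z \<in> V" if "z \<in> topspace ?C" for z
  proof -
    have "fst (snd z) \<in> X"
      using that S(2) by auto
    moreover have "f ((\<lambda>(t, b). s b t) z) \<in> Y"
      using fev that by (auto simp: continuous_map_in_subtopology Pi_iff)
    ultimately show ?thesis
      using V(2) by (auto simp: h_def)
  qed
  ultimately have h: "continuous_map ?C ?Q h"
    by (auto simp: continuous_map_in_subtopology)
  \<comment> \<open>The domain on which both maps to be compared are defined: the inclusion needs
    points of \<open>V\<close>, and \<open>G\<close> after \<open>fst\<close> needs first
    coordinates in \<open>W\<close>.\<close>
  define D where "D = V \<inter> (W \<times> topspace E')"
  have D: "openin P D"
    using V(1) W(1) by (auto simp: D_def P_def openin_prod_Times_iff)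
  have "S \<subseteq> topspace P"
    by (rule locally_closedin_subset [OF S(1)])
  then have SD: "S \<subseteq> D"
    using S(2) V(2) W(2) by (auto simp: D_def P_def)
  have fst_W: "continuous_map (subtopology P T) (subtopology E W) fst" if "T \<subseteq> D" for T
    using fst_cont that by (auto simp: continuous_map_in_subtopology continuous_map_from_subtopology D_def)
  have Gf: "continuous_map (subtopology P D) ?Q (G \<circ> fst)"
    by (rule continuous_map_compose [OF fst_W [OF order_refl] G(1)])
  have idD: "continuous_map (subtopology P D) ?Q (\<lambda>x. x)"
    by (rule continuous_map_subtopology_inclusion) (simp add: D_def)
  \<comment> \<open>The path \<open>s b\<close> starts at the first coordinate of \<open>b\<close>,
    so time 0 gives the graph there; \<open>f\<close> of its end is the second coordinate, so time 1
    gives \<open>b\<close>.\<close>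
  have h0: "h (0, b) = (G \<circ> fst) b" and h1: "h (1, b) = b" if "b \<in> S" for b
    using sec [OF that] G(2) S(2) that by (auto simp: h_def prod_eq_iff)
  obtain N where N: "openin P N" "S \<subseteq> N" "N \<subseteq> D" "homotopic_with (\<lambda>_. True) (subtopology P N) ?Q (G \<circ> fst) (\<lambda>x. x)"
    using homotopy_near_locally_closed [OF P open_retract_open_subset [OF P V(1)] S(1) h D SD Gf h0 idD h1] by blast
  have "cochain_pullback (subtopology P N) (G \<circ> fst) a \<in> coboundaries R (subtopology P N)"
    using coboundaries_pullback [OF fst_W [OF N(3)] Ga] cochain_pullback_compose [OF fst_W [OF N(3)]] by metis
  from coboundaries_add [OF homotopic_pullback [OF N(4) a] this]
  have "cochain_restrict P N a \<in> coboundaries R (subtopology P N)"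
    by simp
  with N show thesis
    using that by (auto simp: D_def)
qed

text \<open>Membership in the kernel at the level of cocycles, in a form common to both
  cohomologies: for Cech classes \<open>W\<close> and \<open>G\<close> are a neighbourhood and an
  extension of the graph, for singular classes the whole space and the graph itself.\<close>

definition graph_null ::
    "'r::{ring,monoid_mult} itself \<Rightarrow> 'a topology \<Rightarrow> 'a set \<Rightarrow> 'b topology \<Rightarrow> ('a \<Rightarrow> 'b)
       \<Rightarrow> ('a \<times> 'b) set \<Rightarrow> ('a \<times> 'b, 'r) cochains \<Rightarrow> bool" where
  "graph_null R E X E' f V a \<longleftrightarrow>
     a \<in> carrier (cocycle_ring R (subtopology (prod_topology E E') V)) \<and>
     (\<exists>W G. openin E W \<and> X \<subseteq> W \<and> continuous_map (subtopology E W) (subtopology (prod_topology E E') V) G \<and>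
        (\<forall>x\<in>X. G x = (x, f x)) \<and> cochain_pullback (subtopology E W) G a \<in> coboundaries R (subtopology E W))"

text \<open>The set \<open>T\<close> is the union of the neighbourhoods found for the sets
  \<open>U (Suc i) - U i\<close>, with the \<open>i\<close>-th cocycle matched to the
  \<open>i\<close>-th set. Cocycles are taken on a common \<open>V\<close>, so that their product
  exists before any restriction.\<close>

lemma graph_null_product_vanishes:
  fixes E :: "'a topology" and E' :: "'b topology"
  defines "P \<equiv> prod_topology E E'"
  assumes E: "open_retract E" "open_retract E'"
    and XY: "locally_closedin E X" "locally_closedin E' Y"
    and f: "continuous_map (subtopology E X) (subtopology E' Y) f"
    and B: "B = prod_topology (subtopology E X) (subtopology E' Y)"
    and U: "U 0 = {}" "U n = topspace B" "\<And>i. i \<le> n \<Longrightarrow> openin B (U i)"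
    and sec: "\<And>i. i \<in> {1..n} \<Longrightarrow> \<exists>s. continuous_map (subtopology B (U i - U (i - 1))) (path_space (subtopology E X)) s \<and>
        (\<forall>b\<in>U i - U (i - 1). (s b 0, f (s b 1)) = b)"
    and V: "openin P V" "X \<times> Y \<subseteq> V"
    and as: "length as = n" "\<And>a. a \<in> set as \<Longrightarrow> graph_null R E X E' f V a"
  obtains T where "openin P T" "X \<times> Y \<subseteq> T" "T \<subseteq> V"
    "cochain_restrict P T (cup_list R (subtopology P V) as) \<in> coboundaries R (subtopology P T)"
proof -
  have BP: "B = subtopology P (X \<times> Y)"
    by (simp add: B P_def subtopology_Times)
  have XY_sub: "X \<subseteq> topspace E" "Y \<subseteq> topspace E'"
    using XY by (simp_all add: locally_closedin_subset)
  then have topB: "topspace B = X \<times> Y"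
    by (auto simp: B)
  have lc: "locally_closedin P (X \<times> Y)"
    unfolding P_def by (rule locally_closedin_Times [OF XY])
  have "\<exists>N. openin P N \<and> U (Suc i) - U i \<subseteq> N \<and> N \<subseteq> V \<and> cochain_restrict P N (as ! i) \<in> coboundaries R (subtopology P N)"
    if i: "i < n" for i
  proof -
    let ?S = "U (Suc i) - U i"
    have Uo: "openin B (U (Suc i))" "openin B (U i)"
      using U(3) i by auto
    then have S: "locally_closedin P ?S"
      using lc unfolding BP by (intro locally_closedin_diff_open)
    have SXY: "?S \<subseteq> X \<times> Y"
      using openin_subset [OF Uo(1)] topB by auto
    then have "subtopology B ?S = subtopology P ?S"
      by (simp add: BP subtopology_subtopology Int_absorb1)
    then obtain s where s: "continuous_map (subtopology P ?S) (path_space (subtopology E X)) s"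
        "\<And>b. b \<in> ?S \<Longrightarrow> (s b 0, f (s b 1)) = b"
      using sec [of "Suc i"] i by auto
    have "graph_null R E X E' f V (as ! i)"
      using as i by simp
    then obtain W G where a: "as ! i \<in> carrier (cocycle_ring R (subtopology P V))"
      and W: "openin E W" "X \<subseteq> W" and G: "continuous_map (subtopology E W) (subtopology P V) G"
          "\<And>x. x \<in> X \<Longrightarrow> G x = (x, f x)"
          "cochain_pullback (subtopology E W) G (as ! i) \<in> coboundaries R (subtopology E W)"
      unfolding graph_null_def P_def by blast
    obtain N where "openin P N" "?S \<subseteq> N" "N \<subseteq> V" "cochain_restrict P N (as ! i) \<in> coboundaries R (subtopology P N)"
      using restriction_vanishes_over_section [OF E S [unfolded P_def] SXY f s(1) [unfolded P_def] s(2)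
          V(1) [unfolded P_def] V(2) a [unfolded P_def] W G [unfolded P_def]]
      unfolding P_def by blast
    then show ?thesis
      by blast
  qed
  then obtain N where N: "\<And>i. i < n \<Longrightarrow> openin P (N i)" "\<And>i. i < n \<Longrightarrow> U (Suc i) - U i \<subseteq> N i"
      "\<And>i. i < n \<Longrightarrow> N i \<subseteq> V" "\<And>i. i < n \<Longrightarrow> cochain_restrict P (N i) (as ! i) \<in> coboundaries R (subtopology P (N i))"
    by metis
  define T where "T = (\<Union>i<n. N i)"
  have TN: "\<Union>(set (map N [0..<n])) = T"
    by (auto simp: T_def)
  have TV: "T \<subseteq> V"
    using N(3) by (auto simp: T_def)
  have "list_all2 (\<lambda>c S. c \<in> carrier (cocycle_ring R (subtopology P V)) \<and> openin (subtopology P V) S \<and>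
      cochain_restrict (subtopology P V) S c \<in> coboundaries R (subtopology (subtopology P V) S)) as (map N [0..<n])"
    unfolding list_all2_conv_all_nth
  proof (intro conjI allI impI)
    fix i assume "i < length as"
    then have i: "i < n"
      using as(1) by simp
    show "as ! i \<in> carrier (cocycle_ring R (subtopology P V))"
      using as i by (simp add: graph_null_def P_def)
    have "openin P (N i)" "N i \<subseteq> V"
      using N i by auto
    moreover from this have "subtopology (subtopology P V) (N i) = subtopology P (N i)"
      by (simp add: subtopology_subtopology Int_absorb1)
    ultimately show "openin (subtopology P V) (map N [0..<n] ! i)"
      "cochain_restrict (subtopology P V) (map N [0..<n] ! i) (as ! i) \<in> coboundaries R (subtopology (subtopology P V) (map N [0..<n] ! i))"
      using i N(4) [OF i] V(1) by (auto simp: openin_open_subtopology)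
  qed (simp add: as)
  from cup_list_vanishes_on_union [OF this]
  have "cochain_restrict (subtopology P V) T (cup_list R (subtopology P V) as) \<in> coboundaries R (subtopology (subtopology P V) T)"
    by (simp only: TN)
  then have "cochain_restrict P T (cup_list R (subtopology P V) as) \<in> coboundaries R (subtopology P T)"
    using TV by (simp add: subtopology_subtopology Int_absorb1)
  moreover have "openin P T"
    using N(1) by (auto simp: T_def)
  moreover have "X \<times> Y \<subseteq> T"
  proof
    fix b assume "b \<in> X \<times> Y"
    then have b: "b \<in> U n" "b \<notin> U 0"
      using U topB by auto
    \<comment> \<open>\<open>Suc k\<close> is the first stage of the filtration that contains
      \<open>b\<close>; it is positive because \<open>U 0\<close> is empty.\<close>
    then obtain k where "k < n" "b \<notin> U k" "b \<in> U (Suc k)"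
      using ex_least_nat_less [of "\<lambda>i. b \<in> U i" n] by blast
    then show "b \<in> T"
      using N(2) by (auto simp: T_def)
  qed
  ultimately show thesis
    using that TV by blast
qed

text \<open>When \<open>V\<close> shrinks, \<open>W\<close> is replaced by the preimage of the
  smaller set under \<open>G\<close>, which still contains \<open>X\<close> because \<open>G\<close>
  extends the graph.\<close>

lemma graph_null_mono:
  fixes E :: "'a topology" and E' :: "'b topology"
  defines "P \<equiv> prod_topology E E'"
  assumes a: "graph_null R E X E' f V a" and V': "openin P V'" "V' \<subseteq> V" "\<And>x. x \<in> X \<Longrightarrow> (x, f x) \<in> V'"
  shows "graph_null R E X E' f V' (cochain_restrict P V' a)"
proof -
  obtain W G where a: "a \<in> carrier (cocycle_ring R (subtopology P V))"
    and W: "openin E W" "X \<subseteq> W" and G: "continuous_map (subtopology E W) (subtopology P V) G" "\<And>x. x \<in> X \<Longrightarrow> G x = (x, f x)"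
        "cochain_pullback (subtopology E W) G a \<in> coboundaries R (subtopology E W)"
    using a unfolding graph_null_def P_def by blast
  define W' where "W' = {x \<in> W. G x \<in> V'}"
  have W_top: "topspace (subtopology E W) = W"
    using openin_subset [OF W(1)] by auto
  have "openin (subtopology P V) V'"
    using V' by (auto simp: openin_subtopology)
  then have "openin (subtopology E W) W'"
    using openin_continuous_map_preimage [OF G(1), of V', unfolded W_top] by (simp add: W'_def)
  then have W': "openin E W'"
    using W(1) by (rule openin_trans_full)
  have W'W: "W' \<subseteq> W"
    by (auto simp: W'_def)
  have G': "continuous_map (subtopology E W') (subtopology P V') G"
    using continuous_map_from_subtopology_mono [OF G(1) W'W] by (auto simp: continuous_map_in_subtopology W'_def)
  have "cochain_pullback (subtopology E W') G (cochain_restrict P V' a) = cochain_pullback (subtopology E W') G a"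
    using cochain_pullback_compose [OF G', of "\<lambda>x. x" a] by (simp add: o_def)
  also have "\<dots> = cochain_restrict E W' (cochain_pullback (subtopology E W) G a)"
    using cochain_pullback_compose [OF continuous_map_subtopology_inclusion(2) [OF W'W], of E G a] by (simp add: o_def)
  also have "\<dots> \<in> coboundaries R (subtopology E W')"
    by (rule coboundaries_pullback [OF continuous_map_subtopology_inclusion(2) [OF W'W] G(3)])
  finally have "cochain_pullback (subtopology E W') G (cochain_restrict P V' a) \<in> coboundaries R (subtopology E W')" .
  moreover have "cochain_restrict P V' a \<in> carrier (cocycle_ring R (subtopology P V'))"
    by (rule cocycle_pullback [OF continuous_map_subtopology_inclusion(2) [OF V'(2)] a])
  moreover have "X \<subseteq> W'"
    using W(2) G(2) V'(3) by (auto simp: W'_def)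
  ultimately show ?thesis
    unfolding graph_null_def P_def [symmetric] using W' G' G(2) by blast
qed


section \<open>Cech cohomology\<close>

lemma cohomology_induced_ident:
  assumes "u \<in> carrier (singular_cohomology R X)"
  shows "cohomology_induced R X (\<lambda>x. x) u = u"
proof -
  obtain a where a: "a \<in> carrier (cocycle_ring R X)" "u = cohomology_class R X a"
    using assms by (auto simp: carrier_singular_cohomology)
  have "continuous_map X X (\<lambda>x. x)"
    by simp
  from cohomology_induced_class [OF this a(1)] show ?thesis
    using a by (simp add: cochain_pullback_ident cocycle_ring_simps)
qed

lemma cohomology_induced_compose:
  assumes "continuous_map X Y g" "continuous_map Y Z h" "u \<in> carrier (singular_cohomology R Z)"
  shows "cohomology_induced R X g (cohomology_induced R Y h u) = cohomology_induced R X (h \<circ> g) u"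
proof -
  obtain a where a: "a \<in> carrier (cocycle_ring R Z)" "u = cohomology_class R Z a"
    using assms(3) by (auto simp: carrier_singular_cohomology)
  show ?thesis
    by (simp add: a(2) cohomology_induced_class [OF assms(2) a(1)]
        cohomology_induced_class [OF assms(1) cocycle_pullback [OF assms(2) a(1)]]
        cohomology_induced_class [OF continuous_map_compose [OF assms(1,2)] a(1)]
        cochain_pullback_compose [OF assms(1)])
qed

lemma cohomology_induced_homotopic:
  assumes "homotopic_with (\<lambda>_. True) X Y f g" "u \<in> carrier (singular_cohomology R Y)"
  shows "cohomology_induced R X f u = cohomology_induced R X g u"
proof -
  have "continuous_map X Y f" "continuous_map X Y g"
    using homotopic_with_imp_continuous_maps [OF assms(1)] by auto
  moreover have "homotopic_with (\<lambda>_. True) X Y g f"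
    using assms(1) by (rule homotopic_with_symD)
  moreover obtain a where "a \<in> carrier (cocycle_ring R Y)" "u = cohomology_class R Y a"
    using assms(2) by (auto simp: carrier_singular_cohomology)
  ultimately show ?thesis
    by (simp add: cohomology_induced_class cohomology_class_eq_iff cocycle_pullback homotopic_pullback)
qed

lemma cohomology_induced_closed:
  "continuous_map X Y g \<Longrightarrow> u \<in> carrier (singular_cohomology R Y) \<Longrightarrow>
     cohomology_induced R X g u \<in> carrier (singular_cohomology R X)"
  by (rule ring_hom_closed [OF cohomology_induced_ring_hom])

lemma direct_system_cech:
  assumes "Z \<subseteq> topspace E"
  shows "direct_system (open_nbhds E Z) (\<lambda>U V. V \<subseteq> U) (nbhd_cohomology R E) (cohomology_restrict R E)"
proof (rule direct_system.intro)
  show "open_nbhds E Z \<noteq> {}"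
    using assms by (auto simp: open_nbhds_def)
  show "\<exists>k\<in>open_nbhds E Z. k \<subseteq> i \<and> k \<subseteq> j" if "i \<in> open_nbhds E Z" "j \<in> open_nbhds E Z" for i j
    by (rule bexI [where x = "i \<inter> j"]) (use that in \<open>auto simp: open_nbhds_def\<close>)
  show "ring (nbhd_cohomology R E i)" for i
    by (simp add: nbhd_cohomology_def ring_singular_cohomology)
  show "cohomology_restrict R E i j \<in> ring_hom (nbhd_cohomology R E i) (nbhd_cohomology R E j)" if "j \<subseteq> i" for i j
    unfolding nbhd_cohomology_def cohomology_restrict_def
    by (rule cohomology_induced_ring_hom [OF continuous_map_subtopology_inclusion(2) [OF that]])
  show "cohomology_restrict R E i i a = a" if "a \<in> carrier (nbhd_cohomology R E i)" for i a
    using that by (simp add: nbhd_cohomology_def cohomology_restrict_def cohomology_induced_ident)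
  show "cohomology_restrict R E j k (cohomology_restrict R E i j a) = cohomology_restrict R E i k a"
    if "j \<subseteq> i" "k \<subseteq> j" "a \<in> carrier (nbhd_cohomology R E i)" for i j k a
    using cohomology_induced_compose [OF continuous_map_subtopology_inclusion(2) [OF that(2)]
        continuous_map_subtopology_inclusion(2) [OF that(1)], of a R] that(3)
    by (simp add: nbhd_cohomology_def cohomology_restrict_def o_def)
qed auto

lemma carrier_cech_cohomology:
  assumes "Z \<subseteq> topspace E"
  shows "carrier (cech_cohomology R E Z) =
    {cech_class R E Z V v | V v. V \<in> open_nbhds E Z \<and> v \<in> carrier (nbhd_cohomology R E V)}"
  unfolding cech_cohomology_def cech_class_def
  by (rule direct_system.carrier_lim [OF direct_system_cech [OF assms]])

lemma cech_class_eq_iff: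
  assumes "Z \<subseteq> topspace E" "U \<in> open_nbhds E Z" "u \<in> carrier (nbhd_cohomology R E U)"
    "V \<in> open_nbhds E Z" "v \<in> carrier (nbhd_cohomology R E V)"
  shows "cech_class R E Z U u = cech_class R E Z V v \<longleftrightarrow>
    (\<exists>K\<in>open_nbhds E Z. K \<subseteq> U \<and> K \<subseteq> V \<and> cohomology_restrict R E U K u = cohomology_restrict R E V K v)"
  unfolding cech_class_def
  by (rule direct_system.class_eq_iff [OF direct_system_cech [OF assms(1)] assms(2-5)])

lemma cech_class_restrict:
  assumes "Z \<subseteq> topspace E" "U \<in> open_nbhds E Z" "V \<in> open_nbhds E Z" "V \<subseteq> U" "u \<in> carrier (nbhd_cohomology R E U)"
  shows "cech_class R E Z V (cohomology_restrict R E U V u) = cech_class R E Z U u"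
  unfolding cech_class_def
  by (rule direct_system.class_transition [OF direct_system_cech [OF assms(1)] assms(2-5)])

lemma cech_class_eq_zero_iff:
  assumes "Z \<subseteq> topspace E" "U \<in> open_nbhds E Z" "u \<in> carrier (nbhd_cohomology R E U)"
  shows "cech_class R E Z U u = \<zero>\<^bsub>cech_cohomology R E Z\<^esub> \<longleftrightarrow>
    (\<exists>K\<in>open_nbhds E Z. K \<subseteq> U \<and> cohomology_restrict R E U K u = \<zero>\<^bsub>nbhd_cohomology R E K\<^esub>)"
  unfolding cech_class_def cech_cohomology_def
  by (rule direct_system.class_eq_zero_iff [OF direct_system_cech [OF assms(1)] assms(2-3)])

text \<open>The two representatives agree after restriction to some \<open>K\<close>. The two
  extensions, cut down to map into \<open>K\<close>, agree on \<open>Z\<close> and are therefore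
  homotopic into \<open>K\<close> near \<open>Z\<close>, so they pull back to the same class
  there.\<close>

lemma cech_induced_unique:
  assumes E: "open_retract P" and Z: "Z \<subseteq> topspace E" "Z' \<subseteq> topspace P"
    and V: "V1 \<in> open_nbhds P Z'" "V2 \<in> open_nbhds P Z'"
    and v: "v1 \<in> carrier (nbhd_cohomology R P V1)" "v2 \<in> carrier (nbhd_cohomology R P V2)"
    and eq: "cech_class R P Z' V1 v1 = cech_class R P Z' V2 v2"
    and W: "W1 \<in> open_nbhds E Z" "W2 \<in> open_nbhds E Z"
    and G: "continuous_map (subtopology E W1) (subtopology P V1) G1" "continuous_map (subtopology E W2) (subtopology P V2) G2"
    and agree: "\<And>z. z \<in> Z \<Longrightarrow> G1 z = G2 z" "\<And>z. z \<in> Z \<Longrightarrow> G1 z \<in> Z'"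
  shows "cech_class R E Z W1 (cohomology_induced R (subtopology E W1) G1 v1) =
         cech_class R E Z W2 (cohomology_induced R (subtopology E W2) G2 v2)"
proof -
  obtain K where K: "K \<in> open_nbhds P Z'" "K \<subseteq> V1" "K \<subseteq> V2"
      "cohomology_restrict R P V1 K v1 = cohomology_restrict R P V2 K v2"
    using eq unfolding cech_class_eq_iff [OF Z(2) V(1) v(1) V(2) v(2)] by blast
  have W_top: "topspace (subtopology E W1) = W1" "topspace (subtopology E W2) = W2"
    using W openin_subset by (auto simp: open_nbhds_def)
  have Ko: "openin P K" "openin (subtopology P V1) K" "openin (subtopology P V2) K"
    using K V by (auto simp: open_nbhds_def openin_open_subtopology)
  define M where "M = {x \<in> W1. G1 x \<in> K} \<inter> {x \<in> W2. G2 x \<in> K}"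
  have "openin (subtopology E W1) {x \<in> W1. G1 x \<in> K}" "openin (subtopology E W2) {x \<in> W2. G2 x \<in> K}"
    using openin_continuous_map_preimage [OF G(1) Ko(2), unfolded W_top]
      openin_continuous_map_preimage [OF G(2) Ko(3), unfolded W_top] by blast+
  then have Mo: "openin E M"
    using W by (auto simp: M_def open_nbhds_def openin_open_subtopology)
  have ZM: "Z \<subseteq> M"
    using W agree K(1) by (auto simp: M_def open_nbhds_def)
  have MW: "M \<subseteq> W1" "M \<subseteq> W2"
    by (auto simp: M_def)
  have GM: "continuous_map (subtopology E M) (subtopology P K) G1" "continuous_map (subtopology E M) (subtopology P K) G2"
    using continuous_map_from_subtopology_mono [OF G(1) MW(1)] continuous_map_from_subtopology_mono [OF G(2) MW(2)]
    by (auto simp: continuous_map_in_subtopology M_def)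
  obtain N where N: "openin (subtopology E M) N" "Z \<subseteq> N" "homotopic_with (\<lambda>_. True) (subtopology (subtopology E M) N) (subtopology P K) G1 G2"
    using open_retract_locally_homotopic [OF open_retract_open_subset [OF E Ko(1)] GM, of Z] ZM Z(1) agree by auto
  have NM: "N \<subseteq> M"
    using openin_subset [OF N(1)] by auto
  have sub: "subtopology (subtopology E M) N = subtopology E N"
    using NM by (simp add: subtopology_subtopology Int_absorb1)
  have No: "N \<in> open_nbhds E Z"
    using openin_trans_full [OF N(1) Mo] N(2) by (simp add: open_nbhds_def)
  note incl = continuous_map_subtopology_inclusion(2)
  \<comment> \<open>A naturality square: pulling back and then restricting to \<open>N\<close> is
    the same as restricting to \<open>K\<close> and then pulling back along the smaller map.\<close>
  have step: "cohomology_restrict R E Wi N (cohomology_induced R (subtopology E Wi) Gi vi) =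
      cohomology_induced R (subtopology E N) Gi (cohomology_restrict R P Vi K vi)"
    if "N \<subseteq> Wi" "K \<subseteq> Vi" "continuous_map (subtopology E Wi) (subtopology P Vi) Gi"
      "continuous_map (subtopology E M) (subtopology P K) Gi" "vi \<in> carrier (nbhd_cohomology R P Vi)" for Wi Vi Gi vi
    using cohomology_induced_compose [OF incl [OF that(1)] that(3), of vi R]
      cohomology_induced_compose [OF continuous_map_from_subtopology_mono [OF that(4) NM] incl [OF that(2)], of vi R] that(5)
    by (simp add: cohomology_restrict_def nbhd_cohomology_def o_def)
  have "cohomology_restrict R P V1 K v1 \<in> carrier (singular_cohomology R (subtopology P K))"
    using v(1) cohomology_induced_closed [OF incl [OF K(2)]] by (simp add: cohomology_restrict_def nbhd_cohomology_def)
  then have "cohomology_induced R (subtopology E N) G1 (cohomology_restrict R P V1 K v1) =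
      cohomology_induced R (subtopology E N) G2 (cohomology_restrict R P V1 K v1)"
    by (rule cohomology_induced_homotopic [OF N(3) [unfolded sub]])
  then have "cohomology_restrict R E W1 N (cohomology_induced R (subtopology E W1) G1 v1) =
      cohomology_restrict R E W2 N (cohomology_induced R (subtopology E W2) G2 v2)"
    using step [of W1 V1 G1 v1] step [of W2 V2 G2 v2] NM MW K G GM v by auto
  moreover have "cohomology_induced R (subtopology E W1) G1 v1 \<in> carrier (nbhd_cohomology R E W1)"
    "cohomology_induced R (subtopology E W2) G2 v2 \<in> carrier (nbhd_cohomology R E W2)"
    using v G by (auto simp: nbhd_cohomology_def intro: cohomology_induced_closed)
  ultimately show ?thesis
    using No NM MW W by (subst cech_class_eq_iff [OF Z(1)]) blast+
qed

text \<open>This resolves the definite description in \<open>cech_induced\<close>. A value exists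
  because \<open>g\<close> extends to a neighbourhood of the locally closed \<open>Z\<close>, it is
  unique by \<open>cech_induced_unique\<close>, and so it comes with data of the described
  kind.\<close>

lemma cech_induced_eq_class:
  assumes E: "open_retract E" "open_retract P" and Z: "locally_closedin E Z" "Z' \<subseteq> topspace P"
    and g: "continuous_map (subtopology E Z) (subtopology P Z') g"
    and \<xi>: "\<xi> \<in> carrier (cech_cohomology R P Z')"
  obtains V v W G where "V \<in> open_nbhds P Z'" "v \<in> carrier (nbhd_cohomology R P V)" "\<xi> = cech_class R P Z' V v"
    "W \<in> open_nbhds E Z" "continuous_map (subtopology E W) (subtopology P V) G" "\<And>z. z \<in> Z \<Longrightarrow> G z = g z"
    "cech_induced R E Z P Z' g \<xi> = cech_class R E Z W (cohomology_induced R (subtopology E W) G v)"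
proof -
  have ZE: "Z \<subseteq> topspace E"
    by (rule locally_closedin_subset [OF Z(1)])
  have gZ: "g z \<in> Z'" if "z \<in> Z" for z
    using g that ZE by (auto simp: continuous_map_in_subtopology Pi_iff)
  define \<phi> where "\<phi> \<eta> \<longleftrightarrow> (\<exists>V v W G. V \<in> open_nbhds P Z' \<and> v \<in> carrier (nbhd_cohomology R P V) \<and>
                \<xi> = cech_class R P Z' V v \<and>
                W \<in> open_nbhds E Z \<and>
                continuous_map (subtopology E W) (subtopology P V) G \<and>
                (\<forall>z\<in>Z. G z = g z) \<and>
                \<eta> = cech_class R E Z W (cohomology_induced R (subtopology E W) G v))" for \<eta>
  obtain V v where V: "V \<in> open_nbhds P Z'" "v \<in> carrier (nbhd_cohomology R P V)" "\<xi> = cech_class R P Z' V v"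
    using \<xi> carrier_cech_cohomology [OF Z(2), of R] by blast
  have Vo: "openin P V" "Z' \<subseteq> V"
    using V(1) by (auto simp: open_nbhds_def)
  have "continuous_map (subtopology E Z) (subtopology P V) g"
    using g Vo(2) by (auto simp: continuous_map_in_subtopology)
  then obtain W G where W: "openin E W" "Z \<subseteq> W" "continuous_map (subtopology E W) (subtopology P V) G" "\<And>z. z \<in> Z \<Longrightarrow> G z = g z"
    using open_retract_extension_locally_closed [OF open_retract_open_subset [OF E(2) Vo(1)] E(1) Z(1)] by blast
  have "\<phi> (cech_class R E Z W (cohomology_induced R (subtopology E W) G v))"
    unfolding \<phi>_def
    by (intro exI [of _ V] exI [of _ v] exI [of _ W] exI [of _ G]) (use V W in \<open>auto simp: open_nbhds_def\<close>)
  moreover have "\<eta> = \<eta>'" if \<eta>: "\<phi> \<eta>" and \<eta>': "\<phi> \<eta>'" for \<eta> \<eta>'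
  proof -
    obtain V1 v1 W1 G1 where 1: "V1 \<in> open_nbhds P Z'" "v1 \<in> carrier (nbhd_cohomology R P V1)" "\<xi> = cech_class R P Z' V1 v1"
      "W1 \<in> open_nbhds E Z" "continuous_map (subtopology E W1) (subtopology P V1) G1" "\<And>z. z \<in> Z \<Longrightarrow> G1 z = g z"
      "\<eta> = cech_class R E Z W1 (cohomology_induced R (subtopology E W1) G1 v1)"
      using \<eta> unfolding \<phi>_def by blast
    obtain V2 v2 W2 G2 where 2: "V2 \<in> open_nbhds P Z'" "v2 \<in> carrier (nbhd_cohomology R P V2)" "\<xi> = cech_class R P Z' V2 v2"
      "W2 \<in> open_nbhds E Z" "continuous_map (subtopology E W2) (subtopology P V2) G2" "\<And>z. z \<in> Z \<Longrightarrow> G2 z = g z"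
      "\<eta>' = cech_class R E Z W2 (cohomology_induced R (subtopology E W2) G2 v2)"
      using \<eta>' unfolding \<phi>_def by blast
    show ?thesis
      unfolding 1(7) 2(7)
      by (rule cech_induced_unique [OF E(2) ZE Z(2) 1(1) 2(1) 1(2) 2(2) _ 1(4) 2(4) 1(5) 2(5)])
        (use 1(3,6) 2(3,6) gZ in auto)
  qed
  ultimately have "\<phi> (THE \<eta>. \<phi> \<eta>)"
    by (metis theI)
  moreover have "cech_induced R E Z P Z' g \<xi> = (THE \<eta>. \<phi> \<eta>)"
    unfolding cech_induced_def \<phi>_def ..
  ultimately have "\<phi> (cech_induced R E Z P Z' g \<xi>)"
    by simp
  then show thesis
    unfolding \<phi>_def using that by blast
qed

text \<open>That the image is zero in the limit means that the pullback along \<open>G\<close>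
  becomes exact on a smaller neighbourhood \<open>K\<close> of \<open>X\<close>; it replaces
  \<open>W\<close>, while \<open>V\<close> and the cocycle stay.\<close>

lemma cech_kernel_graph_null:
  fixes E :: "'a topology" and E' :: "'b topology"
  defines "P \<equiv> prod_topology E E'"
  assumes E: "open_retract E" "open_retract E'"
    and XY: "locally_closedin E X" "locally_closedin E' Y"
    and f: "continuous_map (subtopology E X) (subtopology E' Y) f"
    and \<xi>: "\<xi> \<in> a_kernel (cech_cohomology R P (X \<times> Y)) (cech_cohomology R E X)
                   (cech_induced R E X P (X \<times> Y) (\<lambda>x. (x, f x)))"
  obtains V a where "V \<in> open_nbhds P (X \<times> Y)" "graph_null R E X E' f V a"
    "\<xi> = cech_class R P (X \<times> Y) V (cohomology_class R (subtopology P V) a)"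
proof -
  have P: "open_retract P"
    unfolding P_def by (rule open_retract_prod [OF E])
  have XY_sub: "X \<subseteq> topspace E" "Y \<subseteq> topspace E'"
    using XY by (simp_all add: locally_closedin_subset)
  then have sub: "X \<times> Y \<subseteq> topspace P"
    by (auto simp: P_def)
  have \<xi>1: "\<xi> \<in> carrier (cech_cohomology R P (X \<times> Y))"
    and \<xi>2: "cech_induced R E X P (X \<times> Y) (\<lambda>x. (x, f x)) \<xi> = \<zero>\<^bsub>cech_cohomology R E X\<^esub>"
    using \<xi> by (auto simp: a_kernel_def')
  have "continuous_map (subtopology E X) E' f" "f \<in> topspace (subtopology E X) \<rightarrow> Y"
    using f by (auto simp: continuous_map_in_subtopology)
  then have g: "continuous_map (subtopology E X) (subtopology P (X \<times> Y)) (\<lambda>x. (x, f x))"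
    unfolding P_def continuous_map_in_subtopology
    by (auto intro!: continuous_map_pairedI continuous_map_subtopology_inclusion)
  obtain V v W G where V: "V \<in> open_nbhds P (X \<times> Y)" "v \<in> carrier (nbhd_cohomology R P V)" "\<xi> = cech_class R P (X \<times> Y) V v"
    and W: "W \<in> open_nbhds E X" and G: "continuous_map (subtopology E W) (subtopology P V) G" "\<And>x. x \<in> X \<Longrightarrow> G x = (x, f x)"
    and eq: "cech_induced R E X P (X \<times> Y) (\<lambda>x. (x, f x)) \<xi> = cech_class R E X W (cohomology_induced R (subtopology E W) G v)"
    using cech_induced_eq_class [OF E(1) P XY(1) sub g \<xi>1] by blast
  obtain a where a: "a \<in> carrier (cocycle_ring R (subtopology P V))" "v = cohomology_class R (subtopology P V) a"
    using V(2) by (auto simp: nbhd_cohomology_def carrier_singular_cohomology)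
  have "cohomology_induced R (subtopology E W) G v \<in> carrier (nbhd_cohomology R E W)"
    using V(2) unfolding nbhd_cohomology_def by (rule cohomology_induced_closed [OF G(1)])
  from cech_class_eq_zero_iff [OF XY_sub(1) W this] obtain K where K: "K \<in> open_nbhds E X" "K \<subseteq> W"
      "cohomology_restrict R E W K (cohomology_induced R (subtopology E W) G v) = \<zero>\<^bsub>nbhd_cohomology R E K\<^esub>"
    using eq \<xi>2 by auto
  note incl = continuous_map_subtopology_inclusion(2) [OF K(2), of E]
  have GK: "continuous_map (subtopology E K) (subtopology P V) G"
    by (rule continuous_map_from_subtopology_mono [OF G(1) K(2)])
  have "cohomology_restrict R E W K (cohomology_induced R (subtopology E W) G v) =
      cohomology_class R (subtopology E K) (cochain_pullback (subtopology E K) G a)"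
    using cochain_pullback_compose [OF incl, of G a]
    by (simp add: cohomology_restrict_def a cohomology_induced_class [OF G(1)] cohomology_induced_class [OF incl]
        cocycle_pullback [OF G(1)] o_def)
  then have "cochain_pullback (subtopology E K) G a \<in> coboundaries R (subtopology E K)"
    using K(3) cohomology_class_eq_zero_iff [OF cocycle_pullback [OF GK a(1)]] by (simp add: nbhd_cohomology_def)
  then have "graph_null R E X E' f V a"
    unfolding graph_null_def P_def [symmetric] using a(1) K(1) GK G(2) by (auto simp: open_nbhds_def)
  then show thesis
    using that V a(2) by blast
qed

lemma cech_class_cohomology_class_restrict:
  assumes "Z \<subseteq> topspace P" "V \<in> open_nbhds P Z" "V' \<in> open_nbhds P Z" "V' \<subseteq> V" "a \<in> carrier (cocycle_ring R (subtopology P V))"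
  shows "cech_class R P Z V' (cohomology_class R (subtopology P V') (cochain_restrict P V' a)) =
         cech_class R P Z V (cohomology_class R (subtopology P V) a)"
proof -
  have "cohomology_class R (subtopology P V) a \<in> carrier (nbhd_cohomology R P V)"
    using assms(5) by (simp add: nbhd_cohomology_def carrier_singular_cohomology)
  from cech_class_restrict [OF assms(1-4) this] show ?thesis
    by (simp only: cohomology_restrict_def
        cohomology_induced_class [OF continuous_map_subtopology_inclusion(2) [OF assms(4)] assms(5)])
qed

text \<open>Each kernel element comes with its own neighbourhood. By induction on the list they are
  intersected, and \<open>graph_null\<close> survives the restriction.\<close>

lemma cech_kernel_common_nbhd:
  fixes E :: "'a topology" and E' :: "'b topology"
  defines "P \<equiv> prod_topology E E'"
  assumes E: "open_retract E" "open_retract E'"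
    and XY: "locally_closedin E X" "locally_closedin E' Y"
    and f: "continuous_map (subtopology E X) (subtopology E' Y) f"
    and xs: "set xs \<subseteq> a_kernel (cech_cohomology R P (X \<times> Y)) (cech_cohomology R E X)
                   (cech_induced R E X P (X \<times> Y) (\<lambda>x. (x, f x)))"
  shows "\<exists>V as. V \<in> open_nbhds P (X \<times> Y) \<and> (\<forall>a\<in>set as. graph_null R E X E' f V a) \<and>
    xs = map (\<lambda>a. cech_class R P (X \<times> Y) V (cohomology_class R (subtopology P V) a)) as"
proof -
  have XY_sub: "X \<subseteq> topspace E" "Y \<subseteq> topspace E'"
    using XY by (simp_all add: locally_closedin_subset)
  then have sub: "X \<times> Y \<subseteq> topspace P"
    by (auto simp: P_def)
  have fXY: "(x, f x) \<in> X \<times> Y" if "x \<in> X" for x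
    using f that XY_sub by (auto simp: continuous_map_in_subtopology Pi_iff)
  show ?thesis
    using xs
  proof (induction xs)
    case Nil
    then show ?case
      using sub by (intro exI [of _ "topspace P"] exI [of _ "[]"]) (simp add: open_nbhds_def)
  next
    case (Cons \<xi> xs)
    then obtain V as where V: "V \<in> open_nbhds P (X \<times> Y)" "\<forall>a\<in>set as. graph_null R E X E' f V a"
        "xs = map (\<lambda>a. cech_class R P (X \<times> Y) V (cohomology_class R (subtopology P V) a)) as"
      by auto
    have "\<xi> \<in> a_kernel (cech_cohomology R P (X \<times> Y)) (cech_cohomology R E X)
                   (cech_induced R E X P (X \<times> Y) (\<lambda>x. (x, f x)))"
      using Cons.prems by simp
    then obtain V1 a where V1: "V1 \<in> open_nbhds P (X \<times> Y)" "graph_null R E X E' f V1 a"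
        "\<xi> = cech_class R P (X \<times> Y) V1 (cohomology_class R (subtopology P V1) a)"
      using cech_kernel_graph_null [OF E XY f] unfolding P_def by blast
    define V' where "V' = V1 \<inter> V"
    have V': "V' \<in> open_nbhds P (X \<times> Y)"
      using V(1) V1(1) by (auto simp: V'_def open_nbhds_def)
    have mono: "graph_null R E X E' f V' (cochain_restrict P V' b)"
      "cech_class R P (X \<times> Y) V' (cohomology_class R (subtopology P V') (cochain_restrict P V' b)) =
       cech_class R P (X \<times> Y) T (cohomology_class R (subtopology P T) b)"
      if "graph_null R E X E' f T b" "T \<in> open_nbhds P (X \<times> Y)" "V' \<subseteq> T" for T b
    proof -
      have "b \<in> carrier (cocycle_ring R (subtopology P T))"
        using that(1) by (simp add: graph_null_def P_def)
      then show "cech_class R P (X \<times> Y) V' (cohomology_class R (subtopology P V') (cochain_restrict P V' b)) =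
          cech_class R P (X \<times> Y) T (cohomology_class R (subtopology P T) b)"
        by (rule cech_class_cohomology_class_restrict [OF sub that(2) V' that(3)])
      show "graph_null R E X E' f V' (cochain_restrict P V' b)"
        unfolding P_def
      proof (rule graph_null_mono [OF that(1)])
        show "openin (prod_topology E E') V'"
          using V' by (simp add: open_nbhds_def P_def)
        show "(x, f x) \<in> V'" if "x \<in> X" for x
          using fXY [OF that] V' by (auto simp: open_nbhds_def)
      qed (rule that(3))
    qed
    have sub': "V' \<subseteq> V1" "V' \<subseteq> V"
      by (auto simp: V'_def)
    show ?case
      by (rule exI [of _ V'], rule exI [of _ "map (cochain_restrict P V') (a # as)"])
        (use V' V V1 mono sub' in \<open>auto simp: comp_def\<close>)
  qed
qed

lemma cup_list_cohomology_class:
  assumes "set as \<subseteq> carrier (cocycle_ring R X)"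
  shows "foldr (\<lambda>x y. x \<otimes>\<^bsub>singular_cohomology R X\<^esub> y) (map (cohomology_class R X) as) \<one>\<^bsub>singular_cohomology R X\<^esub>
           = cohomology_class R X (cup_list R X as)"
  unfolding cup_list_def
proof (rule foldr_mult_hom [OF _ _ _ assms])
  show "Group.monoid (cocycle_ring R X)"
    by (rule ring.is_monoid [OF ring_cocycle_ring])
qed (simp_all only: ring_hom_one [OF cohomology_class_ring_hom] ring_hom_mult [OF cohomology_class_ring_hom])

lemma cup_list_cech_class:
  assumes "Z \<subseteq> topspace P" "V \<in> open_nbhds P Z" "set as \<subseteq> carrier (cocycle_ring R (subtopology P V))"
  shows "foldr (\<lambda>x y. x \<otimes>\<^bsub>cech_cohomology R P Z\<^esub> y)
           (map (\<lambda>a. cech_class R P Z V (cohomology_class R (subtopology P V) a)) as) \<one>\<^bsub>cech_cohomology R P Z\<^esub>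
         = cech_class R P Z V (cohomology_class R (subtopology P V) (cup_list R (subtopology P V) as))"
proof -
  interpret direct_system "open_nbhds P Z" "\<lambda>U V. V \<subseteq> U" "nbhd_cohomology R P" "cohomology_restrict R P"
    by (rule direct_system_cech [OF assms(1)])
  let ?H = "singular_cohomology R (subtopology P V)"
  let ?as = "map (cohomology_class R (subtopology P V)) as"
  have "foldr (\<lambda>x y. x \<otimes>\<^bsub>cech_cohomology R P Z\<^esub> y) (map (cech_class R P Z V) ?as) \<one>\<^bsub>cech_cohomology R P Z\<^esub>
      = cech_class R P Z V (foldr (\<lambda>x y. x \<otimes>\<^bsub>?H\<^esub> y) ?as \<one>\<^bsub>?H\<^esub>)"
  proof (rule foldr_mult_hom)
    show "Group.monoid ?H"
      by (rule ring.is_monoid [OF ring_singular_cohomology])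
    show "cech_class R P Z V \<one>\<^bsub>?H\<^esub> = \<one>\<^bsub>cech_cohomology R P Z\<^esub>"
      using one_lim [OF assms(2)] by (simp add: cech_class_def cech_cohomology_def nbhd_cohomology_def)
    show "cech_class R P Z V (x \<otimes>\<^bsub>?H\<^esub> y) = cech_class R P Z V x \<otimes>\<^bsub>cech_cohomology R P Z\<^esub> cech_class R P Z V y"
      if "x \<in> carrier ?H" "y \<in> carrier ?H" for x y
      using class_mult [OF assms(2), of x y] that by (simp add: cech_class_def cech_cohomology_def nbhd_cohomology_def)
    show "set ?as \<subseteq> carrier ?H"
      using assms(3) by (auto simp: carrier_singular_cohomology)
  qed
  then show ?thesis
    by (simp add: cup_list_cohomology_class [OF assms(3)] comp_def)
qed

section \<open>The two estimates\<close>

text \<open>Both sides are infima of sets of lengths, and the assumption puts every length of a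
  filtration with sections into the set for the nilpotency index. An infinite sectional number is
  the case of an empty set.\<close>

lemma nil_index_le_sectional_number:
  assumes "\<And>n U xs. U 0 = {} \<Longrightarrow> U n = topspace B \<Longrightarrow> (\<And>i. i \<le> n \<Longrightarrow> openin B (U i)) \<Longrightarrow>
      (\<And>i. i \<in> {1..n} \<Longrightarrow> \<exists>s. continuous_map (subtopology B (U i - U (i - 1))) F s \<and>
                          (\<forall>b \<in> U i - U (i - 1). p (s b) = b)) \<Longrightarrow>
      length xs = n \<Longrightarrow> set xs \<subseteq> J \<Longrightarrow> foldr (\<lambda>x y. x \<otimes>\<^bsub>R\<^esub> y) xs \<one>\<^bsub>R\<^esub> = \<zero>\<^bsub>R\<^esub>"
  shows "nil_index R J \<le> sectional_number F B p"
  unfolding nil_index_def sectional_number_def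
proof (rule Inf_superset_mono, clarify)
  fix n :: nat and U
  assume U: "U 0 = {}" "U n = topspace B" "\<forall>i\<le>n. openin B (U i)"
    and s: "\<forall>i\<in>{1..n}. \<exists>s. continuous_map (subtopology B (U i - U (i - 1))) F s \<and> (\<forall>b \<in> U i - U (i - 1). p (s b) = b)"
  have "foldr (\<lambda>x y. x \<otimes>\<^bsub>R\<^esub> y) xs \<one>\<^bsub>R\<^esub> = \<zero>\<^bsub>R\<^esub>" if "length xs = n" "set xs \<subseteq> J" for xs
    by (rule assms [OF U(1,2) U(3) [rule_format] s [rule_format] that])
  then show "\<exists>m. enat n = enat m \<and> (\<forall>xs. length xs = m \<and> set xs \<subseteq> J \<longrightarrow> foldr (\<lambda>x y. x \<otimes>\<^bsub>R\<^esub> y) xs \<one>\<^bsub>R\<^esub> = \<zero>\<^bsub>R\<^esub>)"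
    by blast
qed

theorem TC_ge_nil_cech:
  fixes E :: "'a topology" and E' :: "'b topology"
  assumes E: "open_retract E" "open_retract E'"
    and XY: "locally_closedin E X" "locally_closedin E' Y"
    and f: "continuous_map (subtopology E X) (subtopology E' Y) f"
  shows "nil_index (cech_cohomology R (prod_topology E E') (X \<times> Y))
           (a_kernel (cech_cohomology R (prod_topology E E') (X \<times> Y)) (cech_cohomology R E X)
              (cech_induced R E X (prod_topology E E') (X \<times> Y) (\<lambda>x. (x, f x))))
         \<le> TC (subtopology E X) (subtopology E' Y) f"
  unfolding TC_def
proof (rule nil_index_le_sectional_number)
  let ?P = "prod_topology E E'" and ?B = "prod_topology (subtopology E X) (subtopology E' Y)"
  fix n U xs
  assume U: "U 0 = {}" "U n = topspace ?B" "\<And>i. i \<le> n \<Longrightarrow> openin ?B (U i)"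
    and sec: "\<And>i. i \<in> {1..n} \<Longrightarrow> \<exists>s. continuous_map (subtopology ?B (U i - U (i - 1))) (path_space (subtopology E X)) s \<and>
        (\<forall>b\<in>U i - U (i - 1). (s b 0, f (s b 1)) = b)"
    and xs: "length xs = n" "set xs \<subseteq> a_kernel (cech_cohomology R ?P (X \<times> Y)) (cech_cohomology R E X)
              (cech_induced R E X ?P (X \<times> Y) (\<lambda>x. (x, f x)))"
  have sub: "X \<times> Y \<subseteq> topspace ?P"
    using locally_closedin_subset [OF XY(1)] locally_closedin_subset [OF XY(2)] by auto
  obtain V as where V: "V \<in> open_nbhds ?P (X \<times> Y)" and as: "\<And>a. a \<in> set as \<Longrightarrow> graph_null R E X E' f V a"
    and xs_eq: "xs = map (\<lambda>a. cech_class R ?P (X \<times> Y) V (cohomology_class R (subtopology ?P V) a)) as"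
    using cech_kernel_common_nbhd [OF E XY f xs(2)] by blast
  have V': "openin ?P V" "X \<times> Y \<subseteq> V"
    using V by (auto simp: open_nbhds_def)
  have "length as = n"
    using xs(1) by (simp add: xs_eq)
  then obtain T where T: "openin ?P T" "X \<times> Y \<subseteq> T" "T \<subseteq> V"
      "cochain_restrict ?P T (cup_list R (subtopology ?P V) as) \<in> coboundaries R (subtopology ?P T)"
    using graph_null_product_vanishes [OF E XY f HOL.refl U sec V' _ as] by blast
  have as_car: "set as \<subseteq> carrier (cocycle_ring R (subtopology ?P V))"
    using as by (auto simp: graph_null_def)
  let ?c = "cup_list R (subtopology ?P V) as"
  have c: "?c \<in> carrier (cocycle_ring R (subtopology ?P V))"
    by (rule cup_list_carrier [OF as_car])
  have T': "T \<in> open_nbhds ?P (X \<times> Y)"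
    using T by (simp add: open_nbhds_def)
  note incl = continuous_map_subtopology_inclusion(2) [OF T(3), of ?P]
  have "cohomology_restrict R ?P V T (cohomology_class R (subtopology ?P V) ?c) = \<zero>\<^bsub>nbhd_cohomology R ?P T\<^esub>"
    using T(4) by (simp add: cohomology_restrict_def nbhd_cohomology_def cohomology_induced_class [OF incl c]
        cohomology_class_eq_zero_iff [OF cocycle_pullback [OF incl c]])
  moreover have "cohomology_class R (subtopology ?P V) ?c \<in> carrier (nbhd_cohomology R ?P V)"
    using c by (simp add: nbhd_cohomology_def carrier_singular_cohomology)
  ultimately have "cech_class R ?P (X \<times> Y) V (cohomology_class R (subtopology ?P V) ?c) = \<zero>\<^bsub>cech_cohomology R ?P (X \<times> Y)\<^esub>"
    using cech_class_eq_zero_iff [OF sub V] T' T(3) by blast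
  then show "foldr (\<lambda>x y. x \<otimes>\<^bsub>cech_cohomology R ?P (X \<times> Y)\<^esub> y) xs \<one>\<^bsub>cech_cohomology R ?P (X \<times> Y)\<^esub> = \<zero>\<^bsub>cech_cohomology R ?P (X \<times> Y)\<^esub>"
    unfolding xs_eq by (simp add: cup_list_cech_class [OF sub V as_car])
qed

theorem TC_ge_nil_singular:
  fixes X :: "'a topology" and Y :: "'b topology"
  assumes E: "open_retract X" "open_retract Y" and f: "continuous_map X Y f"
  shows "nil_index (singular_cohomology R (prod_topology X Y))
           (a_kernel (singular_cohomology R (prod_topology X Y)) (singular_cohomology R X)
              (cohomology_induced R X (\<lambda>x. (x, f x))))
         \<le> TC X Y f"
  unfolding TC_def
proof (rule nil_index_le_sectional_number)
  let ?P = "prod_topology X Y"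
  let ?V = "topspace X \<times> topspace Y"
  fix n U xs
  assume U: "U 0 = {}" "U n = topspace ?P" "\<And>i. i \<le> n \<Longrightarrow> openin ?P (U i)"
    and sec: "\<And>i. i \<in> {1..n} \<Longrightarrow> \<exists>s. continuous_map (subtopology ?P (U i - U (i - 1))) (path_space X) s \<and>
        (\<forall>b\<in>U i - U (i - 1). (s b 0, f (s b 1)) = b)"
    and xs: "length xs = n" "set xs \<subseteq> a_kernel (singular_cohomology R ?P) (singular_cohomology R X)
              (cohomology_induced R X (\<lambda>x. (x, f x)))"
  have PV: "subtopology ?P ?V = ?P"
    using subtopology_topspace [of ?P] by simp
  have g: "continuous_map X ?P (\<lambda>x. (x, f x))"
    using f by (intro continuous_map_pairedI) auto
  have "\<exists>a. graph_null R X (topspace X) Y f ?V a \<and> \<xi> = cohomology_class R ?P a" if \<xi>: "\<xi> \<in> set xs" for \<xi>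
  proof -
    have k: "\<xi> \<in> carrier (singular_cohomology R ?P)" "cohomology_induced R X (\<lambda>x. (x, f x)) \<xi> = \<zero>\<^bsub>singular_cohomology R X\<^esub>"
      using xs(2) \<xi> by (auto simp: a_kernel_def')
    then obtain a where a: "a \<in> carrier (cocycle_ring R ?P)" "\<xi> = cohomology_class R ?P a"
      by (auto simp: carrier_singular_cohomology)
    have "cochain_pullback X (\<lambda>x. (x, f x)) a \<in> coboundaries R X"
      using k(2) cohomology_class_eq_zero_iff [OF cocycle_pullback [OF g a(1)]]
      by (simp add: a(2) cohomology_induced_class [OF g a(1)])
    then have "graph_null R X (topspace X) Y f ?V a"
      unfolding graph_null_def using a(1) g
      by (intro conjI exI [of _ "topspace X"] exI [of _ "\<lambda>x. (x, f x)"]) (simp_all add: PV)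
    then show ?thesis
      using a(2) by blast
  qed
  then obtain r where r: "\<And>\<xi>. \<xi> \<in> set xs \<Longrightarrow> graph_null R X (topspace X) Y f ?V (r \<xi>)"
      "\<And>\<xi>. \<xi> \<in> set xs \<Longrightarrow> \<xi> = cohomology_class R ?P (r \<xi>)"
    by metis
  define as where "as = map r xs"
  have as: "\<And>a. a \<in> set as \<Longrightarrow> graph_null R X (topspace X) Y f ?V a" "length as = n"
    using r xs(1) by (auto simp: as_def)
  have xs_eq: "xs = map (cohomology_class R ?P) as"
    using r(2) by (simp add: as_def map_idI [symmetric] comp_def)
  have "openin ?P ?V"
    using openin_topspace [of ?P] by simp
  then obtain T where T: "openin ?P T" "?V \<subseteq> T" "T \<subseteq> ?V"
      "cochain_restrict ?P T (cup_list R (subtopology ?P ?V) as) \<in> coboundaries R (subtopology ?P T)"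
    using graph_null_product_vanishes [OF E locally_closedin_topspace locally_closedin_topspace, where f = f and R = R and B = ?P and U = U and n = n and V = ?V and as = as]
      f U sec as by (auto simp: subtopology_topspace)
  \<comment> \<open>Here the neighbourhood \<open>V\<close> is the whole product, so vanishing on
    \<open>T\<close> is already vanishing of the class and no limit is involved.\<close>
  then have "T = ?V"
    by blast
  have as_car: "set as \<subseteq> carrier (cocycle_ring R ?P)"
    using as by (auto simp: graph_null_def PV)
  have c: "cup_list R ?P as \<in> carrier (cocycle_ring R ?P)"
    by (rule cup_list_carrier [OF as_car])
  then have "cochain_pullback ?P (\<lambda>x. x) (cup_list R ?P as) = cup_list R ?P as"
    by (intro cochain_pullback_ident) (simp add: cocycle_ring_simps)
  then have "cup_list R ?P as \<in> coboundaries R ?P"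
    using T(4) by (simp only: \<open>T = ?V\<close> PV)
  then show "foldr (\<lambda>x y. x \<otimes>\<^bsub>singular_cohomology R ?P\<^esub> y) xs \<one>\<^bsub>singular_cohomology R ?P\<^esub> = \<zero>\<^bsub>singular_cohomology R ?P\<^esub>"
    unfolding xs_eq cup_list_cohomology_class [OF as_car] cohomology_class_eq_zero_iff [OF c] .
qed

theorem theorem3p21:
  shows "(\<forall>(E :: 'a topology) (E' :: 'b topology) X Y (f :: 'a \<Rightarrow> 'b).
            ENR_space E \<and> ENR_space E' \<and>
            X \<subseteq> topspace E \<and> locally_compact_space (subtopology E X) \<and>
            Y \<subseteq> topspace E' \<and> locally_compact_space (subtopology E' Y) \<and>
            path_connected_space (subtopology E X) \<and> path_connected_space (subtopology E' Y) \<and>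
            continuous_map (subtopology E X) (subtopology E' Y) f \<and> f ` X = Y \<longrightarrow>
            TC (subtopology E X) (subtopology E' Y) f \<ge>
              nil_index (cech_cohomology TYPE('r::{ring,monoid_mult}) (prod_topology E E') (X \<times> Y))
                (a_kernel (cech_cohomology TYPE('r) (prod_topology E E') (X \<times> Y))
                          (cech_cohomology TYPE('r) E X)
                          (cech_induced TYPE('r) E X (prod_topology E E') (X \<times> Y) (\<lambda>x. (x, f x)))))
       \<and>
         (\<forall>(X :: 'a topology) (Y :: 'b topology) (f :: 'a \<Rightarrow> 'b).
            ENR_space X \<and> ENR_space Y \<and>
            path_connected_space X \<and> path_connected_space Y \<and>
            continuous_map X Y f \<and> f ` topspace X = topspace Y \<longrightarrow>
            TC X Y f \<ge>
              nil_index (singular_cohomology TYPE('r) (prod_topology X Y))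
                (a_kernel (singular_cohomology TYPE('r) (prod_topology X Y))
                          (singular_cohomology TYPE('r) X)
                          (cohomology_induced TYPE('r) X (\<lambda>x. (x, f x)))))"
proof (intro conjI allI impI; elim conjE)
  fix E :: "'a topology" and E' :: "'b topology" and X Y and f :: "'a \<Rightarrow> 'b"
  assume "ENR_space E" "ENR_space E'"
    and X: "X \<subseteq> topspace E" "locally_compact_space (subtopology E X)"
    and Y: "Y \<subseteq> topspace E'" "locally_compact_space (subtopology E' Y)"
    and f: "continuous_map (subtopology E X) (subtopology E' Y) f"
  then have E: "open_retract E" "open_retract E'"
    by (simp_all add: ENR_space_imp_open_retract)
  show "nil_index (cech_cohomology TYPE('r) (prod_topology E E') (X \<times> Y))
          (a_kernel (cech_cohomology TYPE('r) (prod_topology E E') (X \<times> Y)) (cech_cohomology TYPE('r) E X)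
             (cech_induced TYPE('r) E X (prod_topology E E') (X \<times> Y) (\<lambda>x. (x, f x))))
        \<le> TC (subtopology E X) (subtopology E' Y) f"
    by (rule TC_ge_nil_cech [OF E locally_compact_imp_locally_closedin [OF E(1) X]
          locally_compact_imp_locally_closedin [OF E(2) Y] f])
next
  fix X :: "'a topology" and Y :: "'b topology" and f :: "'a \<Rightarrow> 'b"
  assume "ENR_space X" "ENR_space Y" and "continuous_map X Y f"
  then show "nil_index (singular_cohomology TYPE('r) (prod_topology X Y))
          (a_kernel (singular_cohomology TYPE('r) (prod_topology X Y)) (singular_cohomology TYPE('r) X)
             (cohomology_induced TYPE('r) X (\<lambda>x. (x, f x))))
        \<le> TC X Y f"
    by (intro TC_ge_nil_singular ENR_space_imp_open_retract)
qed

end
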